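(* Let $\mathscr X\subset\mathbb R^n$ be a bounded open set with smooth boundary $\partial\mathscr X$, let $\mathbf b:\mathbb R^n\to\mathbb R^n$ and $\mathbf B:\mathbb R^n\to\mathbb R^{n\times m}$ satisfy the standing assumptions listed in the context, let $g:\partial\mathscr X\to\mathbb R$ be continuous and let $x\in\mathscr X$. Consider the linear problem on measures $$\min_{\mu,\nu}\ \langle g,\nu\rangle\quad\text{s.t.}\quad \nu+L'\mu=\delta_x, \qquad (P)$$ where $\mu$ and $\nu$ range over measures on $\mathscr X$ and $\partial\mathscr X$ respectively. The linear problem dual to $(P)$ is $$\max_v\ v(x)\quad\text{s.t.}\quad Lv\le0\ \text{ in }\mathscr X,\qquad v\le g\ \text{ on }\partial\mathscr X, \qquad (D)$$ where the maximization is over functions $v\in C^2(\mathscr X)\cap C(\overline{\mathscr X})$. There is no duality gap, i.e. the value of $(D)$ is equal to the value of $(P)$.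
   Context: Standing assumptions: $\mathbf W$ is an $m$-dimensional Brownian motion. The functions $\mathbf b=(b_i)_{i=1,\dots,n}$ and $\mathbf B=(b_{ij})_{i=1,\dots,n,\,j=1,\dots,m}$ are continuous on $\mathbb R^n$ and grow at most linearly outside $\mathscr X$. The matrix $\mathbf B$ has full rank, so that the $n\times n$ matrix $\mathbf A=(a_{ij})$, $a_{ij}:=\frac12\sum_{k=1}^m b_{ik}b_{jk}$, is positive definite at every point. For each initial condition $x$ the stochastic differential equation $d\mathbf X=\mathbf b(\mathbf X)dt+\mathbf B(\mathbf X)d\mathbf W$, $\mathbf X(0)=x$, has a unique solution. Operator: $L$ is defined by $-Lf:=\sum_{i,j=1}^n a_{ij}\,\partial_i\partial_j f+\sum_{i=1}^n b_i\,\partial_i f$. Measures: all measures are finite positive Borel measures; $\langle f,\mu\rangle:=\int f\,d\mu$; $\delta_x$ is the Dirac measure at $x$. Kolmogorov equation: $\nu+L'\mu=\delta_x$ means $\langle f,\nu\rangle+\langle Lf,\mu\rangle=f(x)$ for all $f\in C^2(\overline{\mathscr X})$, where $\overline{\mathscr X}=\mathscr X\cup\partial\mathscr X$. Duality: the dual of $(P)$ is the Lagrangian dual, that is, the maximization over $v$ of the infimum over measures $\mu$ on $\mathscr X$ and $\nu$ on $\partial\mathscr X$ of the Lagrangian $\ell(\mu,\nu,v):=\langle g-v,\nu\rangle+\langle -Lv,\mu\rangle+v(x)$. The value of a maximization (minimization) problem is its supremum (infimum). *)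

theory Defs
  imports "HOL-Probability.Probability"
begin

section \<open>Function spaces and smooth domains\<close>

definition partial :: "'n \<Rightarrow> (real ^ 'n \<Rightarrow> real) \<Rightarrow> real ^ 'n \<Rightarrow> real" where
  "partial i f y = frechet_derivative f (at y) (axis i 1)"

text \<open>Only meant for open \<open>S\<close>.\<close>

primrec Ck_on :: "nat \<Rightarrow> (real ^ 'n) set \<Rightarrow> (real ^ 'n \<Rightarrow> real) \<Rightarrow> bool" where
  "Ck_on 0 S f \<longleftrightarrow> continuous_on S f"
| "Ck_on (Suc k) S f \<longleftrightarrow> f differentiable_on S \<and> (\<forall>i. Ck_on k S (partial i f))"

definition smooth_on :: "(real ^ 'n) set \<Rightarrow> (real ^ 'n \<Rightarrow> real) \<Rightarrow> bool" where
  "smooth_on S f \<longleftrightarrow> (\<forall>k. Ck_on k S f)"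

definition extends_continuously :: "(real ^ 'n) set \<Rightarrow> (real ^ 'n \<Rightarrow> real) \<Rightarrow> bool" where
  "extends_continuously S h \<longleftrightarrow>
     (\<exists>H. continuous_on (closure S) H \<and> (\<forall>y\<in>S. H y = h y))"

text \<open>\<open>C\<^sup>2\<close> up to the boundary: all partial derivatives of order at most two extend
  continuously from the open set \<open>S\<close> to its closure. The values of \<open>f\<close> itself on the
  frontier matter, so \<open>f\<close> is required to be its own extension.\<close>

definition C2_closure :: "(real ^ 'n) set \<Rightarrow> (real ^ 'n \<Rightarrow> real) set" where
  "C2_closure S = {f. Ck_on 2 S f \<and> continuous_on (closure S) f \<and>
     (\<forall>i. extends_continuously S (partial i f)) \<and>
     (\<forall>i j. extends_continuously S (partial i (partial j f)))}"

definition C2_interior :: "(real ^ 'n) set \<Rightarrow> (real ^ 'n \<Rightarrow> real) set" where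
  "C2_interior S = {f. Ck_on 2 S f \<and> continuous_on (closure S) f}"

text \<open>Near each frontier point the domain is a sublevel set of a smooth function with
  nonvanishing gradient.\<close>

definition smooth_boundary :: "(real ^ 'n) set \<Rightarrow> bool" where
  "smooth_boundary S \<longleftrightarrow> (\<forall>p\<in>frontier S. \<exists>U \<rho>. open U \<and> p \<in> U \<and> smooth_on U \<rho> \<and>
     (\<forall>y\<in>U. \<exists>i. partial i \<rho> y \<noteq> 0) \<and>
     S \<inter> U = {y\<in>U. \<rho> y < 0} \<and> frontier S \<inter> U = {y\<in>U. \<rho> y = 0})"

section \<open>Stochastic differential equations\<close>

text \<open>Time is \<open>[0, \<infinity>)\<close>, embedded in the reals; nothing is assumed about \<open>W\<close> at negative
  times. The filtration can be taken constant there.\<close>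

locale brownian_motion = prob_space M + filtration "space M" F
  for M :: "'w measure" and F :: "real \<Rightarrow> 'w measure" +
  fixes W :: "real \<Rightarrow> 'w \<Rightarrow> real ^ 'm"
  assumes subalgebra_F: "subalgebra M (F t)"
    and adapted: "0 \<le> t \<Longrightarrow> W t \<in> borel_measurable (F t)"
    and starts_at_0: "AE \<omega> in M. W 0 \<omega> = 0"
    and continuous_paths: "AE \<omega> in M. continuous_on {0..} (\<lambda>t. W t \<omega>)"
    and independent_increments: "0 \<le> s \<Longrightarrow> s < t \<Longrightarrow>
      indep_set (sets (F s)) (sets (vimage_algebra (space M) (\<lambda>\<omega>. W t \<omega> - W s \<omega>) borel))"
    and gaussian_increments: "0 \<le> s \<Longrightarrow> s < t \<Longrightarrow>
      distributed M lborel (\<lambda>\<omega>. W t \<omega> - W s \<omega>)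
        (\<lambda>z. ennreal (\<Prod>k\<in>UNIV. normal_density 0 (sqrt (t - s)) (z $ k)))"

definition vanishes_in_probability :: "'w measure \<Rightarrow> (nat \<Rightarrow> 'w \<Rightarrow> ennreal) \<Rightarrow> bool" where
  "vanishes_in_probability M Z \<longleftrightarrow> (\<forall>j. Z j \<in> borel_measurable M) \<and>
     (\<forall>\<epsilon>>0. (\<lambda>j. measure M {\<omega>\<in>space M. ennreal \<epsilon> < Z j \<omega>}) \<longlonglongrightarrow> 0)"

text \<open>A simple process on \<open>[0, T]\<close> with \<open>N\<close> steps takes the value \<open>\<eta> k\<close> on
  \<open>[\<tau> k, \<tau> (k + 1))\<close>.\<close>

definition simple_process ::
  "(real \<Rightarrow> 'w measure) \<Rightarrow> real \<Rightarrow> nat \<Rightarrow> (nat \<Rightarrow> real) \<Rightarrow> (nat \<Rightarrow> 'w \<Rightarrow> real ^ 'm ^ 'n) \<Rightarrow> bool"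
  where "simple_process F T N \<tau> \<eta> \<longleftrightarrow> \<tau> 0 = 0 \<and> \<tau> N = T \<and> (\<forall>k<N. \<tau> k < \<tau> (Suc k)) \<and>
     (\<forall>k<N. \<eta> k \<in> borel_measurable (F (\<tau> k)) \<and> bounded (\<eta> k ` space (F (\<tau> k))))"

definition simple_value ::
  "nat \<Rightarrow> (nat \<Rightarrow> real) \<Rightarrow> (nat \<Rightarrow> 'w \<Rightarrow> real ^ 'm ^ 'n) \<Rightarrow> real \<Rightarrow> 'w \<Rightarrow> real ^ 'm ^ 'n" where
  "simple_value N \<tau> \<eta> s \<omega> = (\<Sum>k<N. indicator {\<tau> k..<\<tau> (Suc k)} s *\<^sub>R \<eta> k \<omega>)"

definition simple_integral ::
  "(real \<Rightarrow> 'w \<Rightarrow> real ^ 'm) \<Rightarrow> nat \<Rightarrow> (nat \<Rightarrow> real) \<Rightarrow> (nat \<Rightarrow> 'w \<Rightarrow> real ^ 'm ^ 'n) \<Rightarrow>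
     'w \<Rightarrow> real ^ 'n" where
  "simple_integral W N \<tau> \<eta> \<omega> = (\<Sum>k<N. \<eta> k \<omega> *v (W (\<tau> (Suc k)) \<omega> - W (\<tau> k) \<omega>))"

text \<open>\<open>I\<close> is a version of the Ito integral of \<open>H\<close> over \<open>[0, T]\<close>: the limit in probability of
  the integrals of simple processes that approximate \<open>H\<close> in \<open>L\<^sup>2([0, T])\<close>, in probability.\<close>

definition has_ito_integral ::
  "'w measure \<Rightarrow> (real \<Rightarrow> 'w measure) \<Rightarrow> (real \<Rightarrow> 'w \<Rightarrow> real ^ 'm) \<Rightarrow>
     (real \<Rightarrow> 'w \<Rightarrow> real ^ 'm ^ 'n) \<Rightarrow> real \<Rightarrow> ('w \<Rightarrow> real ^ 'n) \<Rightarrow> bool" where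
  "has_ito_integral M F W H T I \<longleftrightarrow> I \<in> borel_measurable M \<and>
     (\<exists>N \<tau> \<eta>. (\<forall>j. simple_process F T (N j) (\<tau> j) (\<eta> j)) \<and>
        vanishes_in_probability M (\<lambda>j \<omega>.
          \<integral>\<^sup>+s\<in>{0..T}. ennreal ((norm (H s \<omega> - simple_value (N j) (\<tau> j) (\<eta> j) s \<omega>))\<^sup>2) \<partial>lborel) \<and>
        vanishes_in_probability M (\<lambda>j \<omega>.
          ennreal (norm (simple_integral W (N j) (\<tau> j) (\<eta> j) \<omega> - I \<omega>))))"

definition sde_solution ::
  "'w measure \<Rightarrow> (real \<Rightarrow> 'w measure) \<Rightarrow> (real \<Rightarrow> 'w \<Rightarrow> real ^ 'm) \<Rightarrow>
     (real ^ 'n \<Rightarrow> real ^ 'n) \<Rightarrow> (real ^ 'n \<Rightarrow> real ^ 'm ^ 'n) \<Rightarrow> real ^ 'n \<Rightarrow>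
     (real \<Rightarrow> 'w \<Rightarrow> real ^ 'n) \<Rightarrow> bool" where
  "sde_solution M F W b B x X \<longleftrightarrow>
     (\<forall>t\<ge>0. X t \<in> borel_measurable (F t)) \<and>
     (\<forall>\<omega>\<in>space M. continuous_on {0..} (\<lambda>t. X t \<omega>)) \<and>
     (\<forall>t\<ge>0. \<exists>I. has_ito_integral M F W (\<lambda>s \<omega>. B (X s \<omega>)) t I \<and>
        (AE \<omega> in M. X t \<omega> = x + (LBINT s:{0..t}. b (X s \<omega>)) + I \<omega>))"

definition sde_uniquely_solvable ::
  "'w measure \<Rightarrow> (real \<Rightarrow> 'w measure) \<Rightarrow> (real \<Rightarrow> 'w \<Rightarrow> real ^ 'm) \<Rightarrow>
     (real ^ 'n \<Rightarrow> real ^ 'n) \<Rightarrow> (real ^ 'n \<Rightarrow> real ^ 'm ^ 'n) \<Rightarrow> real ^ 'n \<Rightarrow> bool" where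
  "sde_uniquely_solvable M F W b B x \<longleftrightarrow>
     (\<exists>X. sde_solution M F W b B x X \<and>
        (\<forall>Y. sde_solution M F W b B x Y \<longrightarrow> (AE \<omega> in M. \<forall>t\<ge>0. Y t \<omega> = X t \<omega>)))"

definition linear_growth_outside ::
  "(real ^ 'n) set \<Rightarrow> (real ^ 'n \<Rightarrow> 'v::real_normed_vector) \<Rightarrow> bool" where
  "linear_growth_outside S f \<longleftrightarrow> (\<exists>K. \<forall>y. y \<notin> S \<longrightarrow> norm (f y) \<le> K * (1 + norm y))"

section \<open>The linear problems\<close>

definition diffusion_matrix :: "(real ^ 'n \<Rightarrow> real ^ 'm ^ 'n) \<Rightarrow> real ^ 'n \<Rightarrow> real ^ 'n ^ 'n" where
  "diffusion_matrix B y = (\<chi> i j. (1 / 2) * (\<Sum>k\<in>UNIV. B y $ i $ k * B y $ j $ k))"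

definition L_op ::
  "(real ^ 'n \<Rightarrow> real ^ 'n) \<Rightarrow> (real ^ 'n \<Rightarrow> real ^ 'm ^ 'n) \<Rightarrow>
     (real ^ 'n \<Rightarrow> real) \<Rightarrow> real ^ 'n \<Rightarrow> real" where
  "L_op b B f y =
     - ((\<Sum>i\<in>UNIV. \<Sum>j\<in>UNIV. diffusion_matrix B y $ i $ j * partial i (partial j f) y)
        + (\<Sum>i\<in>UNIV. b y $ i * partial i f y))"

definition measures_on :: "(real ^ 'n) set \<Rightarrow> (real ^ 'n) measure set" where
  "measures_on S = {\<mu>. finite_measure \<mu> \<and> sets \<mu> = sets (restrict_space borel S)}"

definition primal_feasible ::
  "(real ^ 'n) set \<Rightarrow> (real ^ 'n \<Rightarrow> real ^ 'n) \<Rightarrow> (real ^ 'n \<Rightarrow> real ^ 'm ^ 'n) \<Rightarrow> real ^ 'n \<Rightarrow>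
     ((real ^ 'n) measure \<times> (real ^ 'n) measure) set" where
  "primal_feasible S b B x = {(\<mu>, \<nu>). \<mu> \<in> measures_on S \<and> \<nu> \<in> measures_on (frontier S) \<and>
     (\<forall>f\<in>C2_closure S. (\<integral>y. f y \<partial>\<nu>) + (\<integral>y. L_op b B f y \<partial>\<mu>) = f x)}"

definition primal_value ::
  "(real ^ 'n) set \<Rightarrow> (real ^ 'n \<Rightarrow> real ^ 'n) \<Rightarrow> (real ^ 'n \<Rightarrow> real ^ 'm ^ 'n) \<Rightarrow>
     (real ^ 'n \<Rightarrow> real) \<Rightarrow> real ^ 'n \<Rightarrow> ereal" where
  "primal_value S b B g x = (INF (\<mu>, \<nu>)\<in>primal_feasible S b B x. ereal (\<integral>y. g y \<partial>\<nu>))"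

definition dual_feasible ::
  "(real ^ 'n) set \<Rightarrow> (real ^ 'n \<Rightarrow> real ^ 'n) \<Rightarrow> (real ^ 'n \<Rightarrow> real ^ 'm ^ 'n) \<Rightarrow>
     (real ^ 'n \<Rightarrow> real) \<Rightarrow> (real ^ 'n \<Rightarrow> real) set" where
  "dual_feasible S b B g = {v \<in> C2_interior S.
     (\<forall>y\<in>S. L_op b B v y \<le> 0) \<and> (\<forall>y\<in>frontier S. v y \<le> g y)}"

definition dual_value ::
  "(real ^ 'n) set \<Rightarrow> (real ^ 'n \<Rightarrow> real ^ 'n) \<Rightarrow> (real ^ 'n \<Rightarrow> real ^ 'm ^ 'n) \<Rightarrow>
     (real ^ 'n \<Rightarrow> real) \<Rightarrow> real ^ 'n \<Rightarrow> ereal" where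
  "dual_value S b B g x = (SUP v\<in>dual_feasible S b B g. ereal (v x))"

text \<open>For \<open>v\<close> in \<open>C2_interior S\<close> the function \<open>L v\<close> may be unbounded near the frontier, so its
  integral is taken in the extended reals. Since \<open>\<infinity> - \<infinity> = \<infinity>\<close> in type \<^typ>\<open>ereal\<close>, a
  measure against which it is undefined does not contribute to the infimum below.\<close>

definition ext_integral :: "'a measure \<Rightarrow> ('a \<Rightarrow> real) \<Rightarrow> ereal" where
  "ext_integral \<mu> f =
     enn2ereal (\<integral>\<^sup>+y. ennreal (f y) \<partial>\<mu>) - enn2ereal (\<integral>\<^sup>+y. ennreal (- f y) \<partial>\<mu>)"

definition lagrangian ::
  "(real ^ 'n \<Rightarrow> real ^ 'n) \<Rightarrow> (real ^ 'n \<Rightarrow> real ^ 'm ^ 'n) \<Rightarrow> (real ^ 'n \<Rightarrow> real) \<Rightarrow> real ^ 'n \<Rightarrow>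
     (real ^ 'n) measure \<Rightarrow> (real ^ 'n) measure \<Rightarrow> (real ^ 'n \<Rightarrow> real) \<Rightarrow> ereal" where
  "lagrangian b B g x \<mu> \<nu> v =
     ereal (\<integral>y. g y - v y \<partial>\<nu>) + ext_integral \<mu> (\<lambda>y. - L_op b B v y) + ereal (v x)"

definition lagrange_dual_function ::
  "(real ^ 'n) set \<Rightarrow> (real ^ 'n \<Rightarrow> real ^ 'n) \<Rightarrow> (real ^ 'n \<Rightarrow> real ^ 'm ^ 'n) \<Rightarrow>
     (real ^ 'n \<Rightarrow> real) \<Rightarrow> real ^ 'n \<Rightarrow> (real ^ 'n \<Rightarrow> real) \<Rightarrow> ereal" where
  "lagrange_dual_function S b B g x v =
     (INF (\<mu>, \<nu>)\<in>measures_on S \<times> measures_on (frontier S). lagrangian b B g x \<mu> \<nu> v)"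

end

theory Submission
  imports Defs
begin

text \<open>Call \<open>v\<close> a subsolution if \<open>L v \<le> 0\<close>.

  The value of (D) is at most that of (P): a subsolution \<open>v\<close> that is merely continuous up to the
  boundary is no admissible test function, so it is first glued, by a convex soft maximum, to a
  function that is smooth up to the boundary, slightly above \<open>v\<close> on the frontier, and a subsolution
  in the boundary layer where it dominates; a barrier \<open>\<theta>\<close> with \<open>\<theta> = 1\<close> and arbitrarily large
  \<open>- L \<theta>\<close> on the frontier makes the latter possible.

  The value of (P) is at most that of (D): if \<open>D\<close> bounds (D), then by the Hahn-Banach theorem some
  positive functional on pairs of bounded functions satisfies the constraint and maps \<open>(0, g)\<close> to at
  most \<open>D\<close>; the required finiteness comes from a strict subsolution (Slater point). By the Riesz
  theorem the functional is given by measures on the closed domain and on its frontier, and the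
  barrier shows that the first one does not charge the frontier.\<close>

section \<open>Second-order calculus and the operator \<open>L\<close>\<close>

text \<open>Two mismatches shape the proof. Test functions of (P) are C^2 up to the frontier, while
  \<open>L v\<close> may blow up there for a competitor \<open>v\<close> of (D); and
  \<open>X\<close> is not compact, so mass of \<mu> could escape to the frontier. For merely
  continuous coefficients a classical solution of the Dirichlet problem need not exist, so explicit
  functions take its place. They rest on one identity, L(\<phi>(f)) = \<phi>'(f) L f - \<phi>''(f)
  A\<nabla>f . \<nabla>f. A convex nondecreasing \<phi> preserves subsolutions, hence maxima can be
  smoothed; an exponential of rate \<tau> gains \<tau>^2 in the second-order term against losses of
  order \<tau>, hence barriers exist. The barrier stays between 0 and 1 however large - L \<theta>
  is, so testing with it costs at most the mass of \<nu>. The separating functional acts on all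
  bounded functions, not only on continuous ones: the order is then pointwise on \<open>X\<close>
  and on the frontier, and indicators are available for the Riesz theorem.\<close>

text \<open>Gradient and Hessian are carried as explicit functions, because \<open>partial\<close>
  is built on a chosen derivative and does not compute. Row \<open>H y $ i\<close> is the gradient
  of the i-th entry of \<open>G\<close>; symmetry of \<open>H\<close> is not part of the
  notion.\<close>

definition jet2 ::
  "(real ^ 'n) set \<Rightarrow> (real ^ 'n \<Rightarrow> real) \<Rightarrow> (real ^ 'n \<Rightarrow> real ^ 'n) \<Rightarrow> (real ^ 'n \<Rightarrow> real ^ 'n ^ 'n) \<Rightarrow> bool"
  where "jet2 S f G H \<longleftrightarrow>
     (\<forall>y\<in>S. (f has_derivative (\<lambda>h. G y \<bullet> h)) (at y)) \<and>
     (\<forall>y\<in>S. \<forall>i. ((\<lambda>y. G y $ i) has_derivative (\<lambda>h. H y $ i \<bullet> h)) (at y)) \<and>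
     continuous_on S H"

definition outer :: "real ^ 'n \<Rightarrow> real ^ 'n \<Rightarrow> real ^ 'n ^ 'n" where
  "outer u v = (\<chi> i j. u $ i * v $ j)"

lemma outer_nth [simp]: "outer u v $ i = (u $ i) *\<^sub>R v"
  by (simp add: outer_def vec_eq_iff)

lemma continuous_on_outer [continuous_intros]:
  assumes "continuous_on S f" "continuous_on S g"
  shows "continuous_on S (\<lambda>y. outer (f y) (g y))"
  unfolding outer_def by (intro continuous_on_vec_lambda continuous_intros assms)

lemma continuous_on_vecI:
  assumes "\<And>i. continuous_on S (\<lambda>y. f y $ i)"
  shows "continuous_on S (f :: _ \<Rightarrow> _ ^ 'n)"
proof -
  have "continuous_on S (\<lambda>y. \<chi> i. f y $ i)" by (intro continuous_on_vec_lambda assms)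
  then show ?thesis by simp
qed

lemma jet2D:
  assumes "jet2 S f G H"
  shows "\<And>y. y \<in> S \<Longrightarrow> (f has_derivative (\<lambda>h. G y \<bullet> h)) (at y)"
    "\<And>y i. y \<in> S \<Longrightarrow> ((\<lambda>y. G y $ i) has_derivative (\<lambda>h. H y $ i \<bullet> h)) (at y)"
    "continuous_on S H"
  using assms by (auto simp: jet2_def)

lemma jet2_continuous:
  assumes "jet2 S f G H"
  shows "continuous_on S f" "continuous_on S G" "continuous_on S H"
proof -
  show "continuous_on S f"
    by (intro continuous_at_imp_continuous_on ballI has_derivative_continuous[OF jet2D(1)[OF assms]])
  show "continuous_on S G"
    by (intro continuous_on_vecI continuous_at_imp_continuous_on ballI
        has_derivative_continuous[OF jet2D(2)[OF assms]])
  show "continuous_on S H" by (rule jet2D(3)[OF assms])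
qed

lemma jet2_subset: "jet2 S f G H \<Longrightarrow> T \<subseteq> S \<Longrightarrow> jet2 T f G H"
  by (auto simp: jet2_def intro: continuous_on_subset)

lemma jet2_cong:
  assumes "jet2 S f G H" "open S" "\<And>y. y \<in> S \<Longrightarrow> g y = f y"
  shows "jet2 S g G H"
  unfolding jet2_def
proof (intro conjI ballI)
  fix y assume "y \<in> S"
  then show "(g has_derivative (\<lambda>h. G y \<bullet> h)) (at y)"
    using assms by (intro has_derivative_transform_within_open[OF jet2D(1)[OF assms(1)]]) auto
qed (use jet2D(2,3)[OF assms(1)] in auto)

lemma partial_eq: "(f has_derivative (\<lambda>h. v \<bullet> h)) (at y) \<Longrightarrow> partial i f y = v $ i"
  unfolding partial_def by (metis frechet_derivative_at inner_axis real_inner_1_right)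

lemma jet2_partial: "jet2 S f G H \<Longrightarrow> y \<in> S \<Longrightarrow> partial i f y = G y $ i"
  using jet2D(1) partial_eq by blast

lemma jet2_partial_partial:
  assumes "jet2 S f G H" "open S" "y \<in> S"
  shows "(partial j f has_derivative (\<lambda>h. H y $ j \<bullet> h)) (at y)"
    "partial i (partial j f) y = H y $ j $ i"
proof -
  show "(partial j f has_derivative (\<lambda>h. H y $ j \<bullet> h)) (at y)"
    using assms jet2_partial[OF assms(1)]
    by (intro has_derivative_transform_within_open[OF jet2D(2)[OF assms(1,3)]]) auto
  then show "partial i (partial j f) y = H y $ j $ i" by (rule partial_eq)
qed

lemma has_derivative_gradient:
  fixes f :: "real ^ 'n \<Rightarrow> real"
  assumes "f differentiable (at y)"
  shows "(f has_derivative (\<lambda>h. (\<chi> i. partial i f y) \<bullet> h)) (at y)"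
proof -
  let ?D = "frechet_derivative f (at y)"
  have D: "(f has_derivative ?D) (at y)" using assms frechet_derivative_works by blast
  then have lin: "linear ?D" by (rule has_derivative_linear)
  have "?D h = (\<chi> i. partial i f y) \<bullet> h" for h
  proof -
    have "?D h = ?D (\<Sum>i\<in>UNIV. h $ i *s axis i 1)" by (simp add: basis_expansion)
    also have "\<dots> = (\<Sum>i\<in>UNIV. h $ i * ?D (axis i 1))"
      by (simp add: linear_sum[OF lin] linear_cmul[OF lin] scalar_mult_eq_scaleR)
    also have "\<dots> = (\<chi> i. partial i f y) \<bullet> h" by (simp add: inner_vec_def partial_def mult.commute)
    finally show ?thesis .
  qed
  then have "?D = (\<lambda>h. (\<chi> i. partial i f y) \<bullet> h)" by auto
  with D show ?thesis by simp
qed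

text \<open>The bridge between the recursive definition and explicit jets: regularity claims are
  proved by exhibiting a jet, for which sums, products and composites have closed formulas.\<close>

lemma Ck_on_2_iff:
  fixes f :: "real ^ 'n \<Rightarrow> real"
  assumes "open S"
  shows "Ck_on 2 S f \<longleftrightarrow> (\<exists>G H. jet2 S f G H)"
proof
  assume a: "Ck_on 2 S f"
  have d: "h differentiable (at y)" if "h differentiable_on S" "y \<in> S" for h :: "real ^ 'n \<Rightarrow> real" and y
    using that assms differentiable_on_eq_differentiable_at by blast
  have "jet2 S f (\<lambda>y. \<chi> i. partial i f y) (\<lambda>y. \<chi> j i. partial i (partial j f) y)"
    unfolding jet2_def
  proof (intro conjI ballI allI)
    fix y i assume "y \<in> S"
    then show "(f has_derivative (\<lambda>h. (\<chi> i. partial i f y) \<bullet> h)) (at y)"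
      using a d by (intro has_derivative_gradient) (auto simp: numeral_2_eq_2)
    have "(partial i f has_derivative (\<lambda>h. (\<chi> k. partial k (partial i f) y) \<bullet> h)) (at y)"
      using a d \<open>y \<in> S\<close> by (intro has_derivative_gradient) (auto simp: numeral_2_eq_2)
    then show "((\<lambda>y. (\<chi> i. partial i f y) $ i) has_derivative
        (\<lambda>h. (\<chi> j i. partial i (partial j f) y) $ i \<bullet> h)) (at y)" by simp
  qed (use a in \<open>auto simp: numeral_2_eq_2 intro!: continuous_on_vec_lambda\<close>)
  then show "\<exists>G H. jet2 S f G H" by blast
next
  assume "\<exists>G H. jet2 S f G H"
  then obtain G H where j: "jet2 S f G H" by auto
  have "continuous_on S (partial i (partial j f))" for i j
  proof -
    have "continuous_on S (\<lambda>y. H y $ j $ i)" by (intro continuous_intros jet2_continuous(3)[OF j])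
    then show ?thesis
      by (rule continuous_on_eq) (simp add: jet2_partial_partial[OF j assms])
  qed
  moreover have "f differentiable_on S" "partial i f differentiable_on S" for i
    unfolding differentiable_on_eq_differentiable_at[OF assms]
    by (rule ballI, rule differentiableI, erule jet2D(1)[OF j] jet2_partial_partial(1)[OF j assms])+
  ultimately show "Ck_on 2 S f" by (simp add: numeral_2_eq_2)
qed

lemma Ck_on_2I: "open S \<Longrightarrow> jet2 S f G H \<Longrightarrow> Ck_on 2 S f"
  using Ck_on_2_iff[of S f] by blast

lemma Ck_on_2E:
  assumes "Ck_on 2 S f" "open S"
  obtains G H where "jet2 S f G H"
  using assms(1) Ck_on_2_iff[OF assms(2), of f] by blast

lemma diffusion_matrix_sym: "diffusion_matrix B y $ i $ j = diffusion_matrix B y $ j $ i"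
  by (simp add: diffusion_matrix_def mult.commute)

text \<open>The second partial \<open>partial i (partial j f)\<close> is the entry
  \<open>H y $ j $ i\<close>. The symmetry of \<open>diffusion_matrix\<close> absorbs this
  transposition, so equality of mixed derivatives is not invoked.\<close>

lemma L_op_jet2:
  assumes "jet2 S f G H" "open S" "y \<in> S"
  shows "L_op b B f y = - (diffusion_matrix B y \<bullet> H y + b y \<bullet> G y)"
proof -
  let ?A = "diffusion_matrix B y"
  have "(\<Sum>i\<in>UNIV. \<Sum>j\<in>UNIV. ?A $ i $ j * partial i (partial j f) y) = (\<Sum>j\<in>UNIV. \<Sum>i\<in>UNIV. ?A $ j $ i * H y $ j $ i)"
    by (subst sum.swap) (simp add: jet2_partial_partial(2)[OF assms] diffusion_matrix_sym)
  also have "\<dots> = ?A \<bullet> H y" by (simp add: inner_vec_def)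
  finally show ?thesis by (simp add: L_op_def jet2_partial[OF assms(1,3)] inner_vec_def)
qed

text \<open>\<open>L_op\<close> is a local operator. This evaluates it on functions defined by
  cases, by passing to the branch that is active near the point.\<close>

lemma L_op_cong:
  assumes "open S" "y \<in> S" "\<And>z. z \<in> S \<Longrightarrow> f z = g z"
  shows "L_op b B f y = L_op b B g y"
proof -
  have 1: "partial i f z = partial i g z" if "z \<in> S" "\<And>z. z \<in> S \<Longrightarrow> f z = g z" for i z
    and f g :: "real ^ 'a \<Rightarrow> real"
  proof -
    \<comment> \<open>Both functions have the same set of derivatives at \<open>z\<close>, so the
      choice inside \<open>frechet_derivative\<close> returns the same map, even if that set is
      empty.\<close>
    have "(f has_derivative D) (at z) \<longleftrightarrow> (g has_derivative D) (at z)" for D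
      using has_derivative_transform_within_open[of f D z UNIV S g]
        has_derivative_transform_within_open[of g D z UNIV S f] that assms(1) by auto
    then show ?thesis by (simp add: partial_def frechet_derivative_def)
  qed
  have 2: "partial i (partial j f) y = partial i (partial j g) y" for i j
    using 1[of y "partial j f" "partial j g"] 1[of _ f g] assms by blast
  show ?thesis unfolding L_op_def 2 using 1[of y f g] assms by simp
qed

lemma jet2_const: "jet2 S (\<lambda>_. c) (\<lambda>_. 0) (\<lambda>_. 0)"
  by (auto simp: jet2_def)

lemma jet2_inner: "jet2 S (\<lambda>y. a \<bullet> y) (\<lambda>_. a) (\<lambda>_. 0)"
  by (auto simp: jet2_def intro!: derivative_eq_intros)

lemma jet2_add:
  assumes "jet2 S f G H" "jet2 S f' G' H'"
  shows "jet2 S (\<lambda>y. f y + f' y) (\<lambda>y. G y + G' y) (\<lambda>y. H y + H' y)"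
  unfolding jet2_def vector_add_component inner_add_left
  by (intro conjI ballI allI has_derivative_add continuous_intros
      jet2D[OF assms(1)] jet2D[OF assms(2)])

lemma jet2_mult:
  assumes "jet2 S f G H" "jet2 S f' G' H'"
  shows "jet2 S (\<lambda>y. f y * f' y) (\<lambda>y. f y *\<^sub>R G' y + f' y *\<^sub>R G y)
    (\<lambda>y. f y *\<^sub>R H' y + f' y *\<^sub>R H y + outer (G y) (G' y) + outer (G' y) (G y))"
  unfolding jet2_def
proof (intro conjI ballI allI)
  fix y i assume "y \<in> S"
  note d = jet2D(1,2)[OF assms(1) this] jet2D(1,2)[OF assms(2) this]
  show "((\<lambda>y. f y * f' y) has_derivative (\<lambda>h. (f y *\<^sub>R G' y + f' y *\<^sub>R G y) \<bullet> h)) (at y)"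
    by (rule has_derivative_eq_rhs[OF has_derivative_mult[OF d(1,3)]]) (auto simp: inner_add_left)
  show "((\<lambda>y. (f y *\<^sub>R G' y + f' y *\<^sub>R G y) $ i) has_derivative
      (\<lambda>h. (f y *\<^sub>R H' y + f' y *\<^sub>R H y + outer (G y) (G' y) + outer (G' y) (G y)) $ i \<bullet> h)) (at y)"
    unfolding vector_add_component vector_scaleR_component real_scaleR_def
    by (rule has_derivative_eq_rhs[OF has_derivative_add[OF has_derivative_mult[OF d(1,4)] has_derivative_mult[OF d(3,2)]]])
      (auto simp: inner_add_left)
next
  show "continuous_on S (\<lambda>y. f y *\<^sub>R H' y + f' y *\<^sub>R H y + outer (G y) (G' y) + outer (G' y) (G y))"
    by (intro continuous_intros jet2_continuous[OF assms(1)] jet2_continuous[OF assms(2)])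
qed

lemma jet2_compose:
  fixes \<phi> \<phi>' \<phi>'' :: "real \<Rightarrow> real"
  assumes "jet2 S f G H"
    and \<phi>: "\<And>t. (\<phi> has_real_derivative \<phi>' t) (at t)" "\<And>t. (\<phi>' has_real_derivative \<phi>'' t) (at t)"
      "continuous_on UNIV \<phi>''"
  shows "jet2 S (\<lambda>y. \<phi> (f y)) (\<lambda>y. \<phi>' (f y) *\<^sub>R G y) (\<lambda>y. \<phi>' (f y) *\<^sub>R H y + \<phi>'' (f y) *\<^sub>R outer (G y) (G y))"
  unfolding jet2_def
proof (intro conjI ballI allI)
  fix y i assume "y \<in> S"
  note d = jet2D(1,2)[OF assms(1) this]
  have c: "((\<lambda>y. \<phi> (f y)) has_derivative (\<lambda>h. \<phi>' (f y) * (G y \<bullet> h))) (at y)"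
    "((\<lambda>y. \<phi>' (f y)) has_derivative (\<lambda>h. \<phi>'' (f y) * (G y \<bullet> h))) (at y)"
    by (intro has_derivative_compose[OF d(1), of \<phi>, unfolded o_def] has_derivative_compose[OF d(1), of \<phi>', unfolded o_def];
      use \<phi>(1,2)[of "f y"] in \<open>simp add: has_field_derivative_def\<close>)+
  show "((\<lambda>y. \<phi> (f y)) has_derivative (\<lambda>h. (\<phi>' (f y) *\<^sub>R G y) \<bullet> h)) (at y)" using c(1) by simp
  show "((\<lambda>y. (\<phi>' (f y) *\<^sub>R G y) $ i) has_derivative
      (\<lambda>h. (\<phi>' (f y) *\<^sub>R H y + \<phi>'' (f y) *\<^sub>R outer (G y) (G y)) $ i \<bullet> h)) (at y)"
    unfolding vector_scaleR_component real_scaleR_def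
    by (rule has_derivative_eq_rhs[OF has_derivative_mult[OF c(2) d(2)]]) (auto simp: inner_add_left)
next
  have "continuous_on UNIV \<phi>'" using \<phi>(2) by (intro DERIV_continuous_on) (auto intro: has_field_derivative_at_within)
  then show "continuous_on S (\<lambda>y. \<phi>' (f y) *\<^sub>R H y + \<phi>'' (f y) *\<^sub>R outer (G y) (G y))"
    using \<phi>(3) by (intro continuous_intros jet2_continuous[OF assms(1)])
      (auto intro: continuous_on_compose2[OF _ jet2_continuous(1)[OF assms(1)]])
qed

lemma jet2_norm_square:
  fixes p :: "real ^ 'n"
  shows
  "jet2 S (\<lambda>y. (y - p) \<bullet> (y - p)) (\<lambda>y. 2 *\<^sub>R (y - p)) (\<lambda>_. 2 *\<^sub>R mat 1)"
  unfolding jet2_def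
proof (intro conjI ballI allI)
  fix y :: "real ^ 'n" and i
  show "((\<lambda>y. (y - p) \<bullet> (y - p)) has_derivative (\<lambda>h. 2 *\<^sub>R (y - p) \<bullet> h)) (at y)"
    by (auto intro!: derivative_eq_intros simp: inner_commute)
  have "(mat 1 :: real ^ 'n ^ 'n) $ i \<bullet> h = h $ i" for h
    by (simp add: inner_vec_def mat_def if_distrib[of "\<lambda>x. x * _"] cong: if_cong)
  moreover have "((\<lambda>y. 2 * (y $ i - p $ i)) has_derivative (\<lambda>h. 2 * h $ i)) (at y)"
    by (auto intro!: derivative_eq_intros bounded_linear_imp_has_derivative bounded_linear_vec_nth)
  ultimately show "((\<lambda>y. (2 *\<^sub>R (y - p)) $ i) has_derivative (\<lambda>h. (2 *\<^sub>R mat 1) $ i \<bullet> h)) (at y)" by simp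
qed auto

lemma Ck_on_2_cong:
  assumes "open S" "Ck_on 2 S f" "\<And>y. y \<in> S \<Longrightarrow> g y = f y"
  shows "Ck_on 2 S g"
  by (rule Ck_on_2E[OF assms(2,1)]) (rule Ck_on_2I[OF assms(1) jet2_cong[OF _ assms(1,3)]])

text \<open>On both open sets it is the same function, with the same partial derivatives, and
  continuity and differentiability are local. In this way functions glued from two formulas are
  recognized as C^2.\<close>

lemma Ck_on_Un:
  assumes "open S" "open T" "Ck_on k S f" "Ck_on k T f"
  shows "Ck_on k (S \<union> T) f"
  using assms(3,4)
proof (induction k arbitrary: f)
  case 0
  then show ?case using assms by (auto intro: continuous_on_open_Un)
next
  case (Suc k)
  have "f differentiable_on S \<union> T"
    using Suc.prems assms(1,2) by (auto simp: differentiable_on_eq_differentiable_at open_Un)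
  then show ?case using Suc by simp
qed

text \<open>The derivatives on the neighbourhood \<open>U\<close> are themselves the continuous
  extensions that \<open>C2_closure\<close> asks for.\<close>

lemma C2_closureI:
  assumes "open S" "open U" "closure S \<subseteq> U" "Ck_on 2 U f"
  shows "f \<in> C2_closure S"
proof -
  obtain G H where j: "jet2 U f G H" using Ck_on_2E[OF assms(4,2)] .
  have SU: "S \<subseteq> U" using assms closure_subset by blast
  have "Ck_on 2 S f" by (rule Ck_on_2I[OF assms(1) jet2_subset[OF j SU]])
  moreover have "continuous_on (closure S) f"
    using jet2_continuous(1)[OF j] assms(3) continuous_on_subset by blast
  moreover have "extends_continuously S (partial i f)" for i
  proof -
    have "continuous_on (closure S) (\<lambda>y. G y $ i)"
      by (intro continuous_intros continuous_on_subset[OF jet2_continuous(2)[OF j] assms(3)])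
    then show ?thesis unfolding extends_continuously_def using jet2_partial[OF j] SU by fastforce
  qed
  moreover have "extends_continuously S (partial i (partial k f))" for i k
  proof -
    have "continuous_on (closure S) (\<lambda>y. H y $ k $ i)"
      by (intro continuous_intros continuous_on_subset[OF jet2_continuous(3)[OF j] assms(3)])
    then show ?thesis unfolding extends_continuously_def
      using jet2_partial_partial(2)[OF j assms(2)] SU by fastforce
  qed
  ultimately show ?thesis by (simp add: C2_closure_def)
qed

section \<open>Convex C^2 profiles on the real line\<close>

lemma has_real_derivative_pos_part_square:
  "((\<lambda>t::real. (max 0 t)\<^sup>2) has_real_derivative 2 * max 0 t) (at t)"
proof -
  consider "t > 0" | "t < 0" | "t = 0" by linarith
  then show ?thesis
  proof cases
    case 1
    have "((\<lambda>t::real. t\<^sup>2) has_real_derivative 2 * t) (at t)" by (auto intro!: derivative_eq_intros)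
    then have "((\<lambda>t::real. (max 0 t)\<^sup>2) has_real_derivative 2 * t) (at t)"
      by (rule has_field_derivative_transform_within_open[of _ _ _ "{0<..}"]) (use 1 in auto)
    then show ?thesis using 1 by simp
  next
    case 2
    have "((\<lambda>t::real. 0) has_real_derivative 0) (at t)" by simp
    then have "((\<lambda>t::real. (max 0 t)\<^sup>2) has_real_derivative 0) (at t)"
      by (rule has_field_derivative_transform_within_open[of _ _ _ "{..<0}"]) (use 2 in auto)
    then show ?thesis using 2 by simp
  next
    case 3
    have "((\<lambda>h::real. (max 0 h)\<^sup>2 / h) \<longlongrightarrow> 0) (at 0)"
    proof (rule tendsto_rabs_zero_cancel, rule tendsto_sandwich[of "\<lambda>_. 0" _ _ "\<lambda>h. \<bar>h\<bar>"])
      show "\<forall>\<^sub>F h in at (0::real). \<bar>(max 0 h)\<^sup>2 / h\<bar> \<le> \<bar>h\<bar>"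
        by (rule always_eventually) (auto simp: max_def power2_eq_square)
    qed (auto intro!: tendsto_eq_intros)
    then show ?thesis using 3 by (simp add: has_field_derivative_iff)
  qed
qed

text \<open>The lowest integer power of the positive part that is C^2. It is convex and
  nondecreasing and vanishes on the negative half-line, so its composites can be continued by
  zero.\<close>

definition pos_cube :: "real \<Rightarrow> real" where
  "pos_cube t = (max 0 t) ^ 3"

lemma pos_cube_derivatives:
  "(pos_cube has_real_derivative 3 * (max 0 t)\<^sup>2) (at t)"
  "((\<lambda>t. 3 * (max 0 t)\<^sup>2) has_real_derivative 6 * max 0 t) (at t)"
  "continuous_on UNIV (\<lambda>t::real. 6 * max 0 t)"
proof -
  have "pos_cube = (\<lambda>t. t * (max 0 t)\<^sup>2)"
    by (auto simp: pos_cube_def max_def power2_eq_square power3_eq_cube)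
  then show "(pos_cube has_real_derivative 3 * (max 0 t)\<^sup>2) (at t)"
    using DERIV_mult[OF DERIV_ident has_real_derivative_pos_part_square[of t]]
    by (auto simp: max_def power2_eq_square algebra_simps split: if_splits)
  show "((\<lambda>t. 3 * (max 0 t)\<^sup>2) has_real_derivative 6 * max 0 t) (at t)"
    using DERIV_cmult[OF has_real_derivative_pos_part_square[of t], of 3] by simp
qed (intro continuous_intros)

text \<open>A \<open>C\<^sup>2\<close> convex substitute for the positive part, obtained as a second difference of cubes.\<close>

definition soft_pos :: "real \<Rightarrow> real" where
  "soft_pos t = (pos_cube (t + 1) - 2 * pos_cube t + pos_cube (t - 1)) / 6"

definition soft_pos' :: "real \<Rightarrow> real" where
  "soft_pos' t = ((max 0 (t + 1))\<^sup>2 - 2 * (max 0 t)\<^sup>2 + (max 0 (t - 1))\<^sup>2) / 2"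

text \<open>This is the hat function supported on [-1, 1] with peak 1 at 0; accordingly
  \<open>soft_pos\<close> is the positive part smoothed by convolution with that hat.\<close>

definition soft_pos'' :: "real \<Rightarrow> real" where
  "soft_pos'' t = max 0 (t + 1) - 2 * max 0 t + max 0 (t - 1)"

lemma soft_pos_derivatives:
  "(soft_pos has_real_derivative soft_pos' t) (at t)"
  "(soft_pos' has_real_derivative soft_pos'' t) (at t)"
  "continuous_on UNIV soft_pos''"
proof -
  have s: "((\<lambda>t. t + c) has_real_derivative 1) (at t)" for c by (auto intro!: derivative_eq_intros)
  have 1: "((\<lambda>t. pos_cube (t + c)) has_real_derivative 3 * (max 0 (t + c))\<^sup>2) (at t)" for c
    using DERIV_chain2[OF pos_cube_derivatives(1) s, of c] by simp
  have 2: "((\<lambda>t. (max 0 (t + c))\<^sup>2) has_real_derivative 2 * max 0 (t + c)) (at t)" for c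
    using DERIV_chain2[OF has_real_derivative_pos_part_square s, of c] by simp
  show "(soft_pos has_real_derivative soft_pos' t) (at t)"
  proof -
    have "((\<lambda>t. (pos_cube (t + 1) - 2 * pos_cube (t + 0) + pos_cube (t + (-1))) / 6) has_real_derivative
        (3 * (max 0 (t + 1))\<^sup>2 - 2 * (3 * (max 0 (t + 0))\<^sup>2) + 3 * (max 0 (t + (-1)))\<^sup>2) / 6) (at t)"
      by (intro DERIV_cdivide DERIV_add DERIV_diff DERIV_cmult 1)
    then show ?thesis by (simp add: soft_pos_def[abs_def] soft_pos'_def add_divide_distrib diff_divide_distrib)
  qed
  show "(soft_pos' has_real_derivative soft_pos'' t) (at t)"
  proof -
    have "((\<lambda>t. ((max 0 (t + 1))\<^sup>2 - 2 * (max 0 (t + 0))\<^sup>2 + (max 0 (t + (-1)))\<^sup>2) / 2) has_real_derivative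
        (2 * max 0 (t + 1) - 2 * (2 * max 0 (t + 0)) + 2 * max 0 (t + (-1))) / 2) (at t)"
      by (intro DERIV_cdivide DERIV_add DERIV_diff DERIV_cmult 2)
    then show ?thesis by (simp add: soft_pos'_def[abs_def] soft_pos''_def add_divide_distrib diff_divide_distrib)
  qed
  show "continuous_on UNIV soft_pos''"
    unfolding soft_pos''_def[abs_def] by (intro continuous_intros)
qed

lemma soft_pos_eq_0: "t \<le> -1 \<Longrightarrow> soft_pos t = 0"
  by (simp add: soft_pos_def pos_cube_def)

text \<open>Here none of the three cubes is cut off, and the second difference of t^3 is 6 t, whence
  the divisor 6.\<close>

lemma soft_pos_eq_self: "1 \<le> t \<Longrightarrow> soft_pos t = t"
  by (simp add: soft_pos_def pos_cube_def power3_eq_cube algebra_simps)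

lemma soft_pos'_eq_0: "t \<le> -1 \<Longrightarrow> soft_pos' t = 0"
  by (simp add: soft_pos'_def)

lemma soft_pos''_nonneg: "0 \<le> soft_pos'' t"
  by (auto simp: soft_pos''_def max_def)

text \<open>By convexity \<open>soft_pos'\<close> increases, from the value 0 at -1 to the value 1
  at 1. Being in [0, 1], it can serve as the weight of a convex combination of \<open>L v\<close>
  and \<open>L w\<close>.\<close>

lemma soft_pos'_bounds: "0 \<le> soft_pos' t" "soft_pos' t \<le> 1"
proof -
  have mono: "soft_pos' s \<le> soft_pos' t" if "s \<le> t" for s t
    by (rule DERIV_nonneg_imp_nondecreasing[OF that]) (use soft_pos_derivatives(2) soft_pos''_nonneg in blast)
  show "0 \<le> soft_pos' t" using mono[of "min t (-1)" t] soft_pos'_eq_0[of "min t (-1)"] by simp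
  have "soft_pos' (max t 1) = 1" by (simp add: soft_pos'_def power2_eq_square algebra_simps)
  then show "soft_pos' t \<le> 1" using mono[of t "max t 1"] by simp
qed

lemma soft_pos_nonneg: "0 \<le> soft_pos t"
proof -
  have "soft_pos (min t (-1)) \<le> soft_pos t"
    by (rule DERIV_nonneg_imp_nondecreasing) (use soft_pos_derivatives(1) soft_pos'_bounds(1) in auto)
  then show ?thesis using soft_pos_eq_0[of "min t (-1)"] by simp
qed

section \<open>Ellipticity, linearity and the chain rule for the operator\<close>

lemma diffusion_matrix_outer:
  fixes B :: "real ^ 'n \<Rightarrow> real ^ 'm ^ 'n"
  shows "diffusion_matrix B y \<bullet> outer u v = (1/2) * ((transpose (B y) *v u) \<bullet> (transpose (B y) *v v))"
proof -
  have "diffusion_matrix B y \<bullet> outer u v =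
      (\<Sum>i\<in>UNIV. \<Sum>j\<in>UNIV. \<Sum>k\<in>UNIV. (1/2) * ((B y $ i $ k * u $ i) * (B y $ j $ k * v $ j)))"
    by (simp add: inner_vec_def diffusion_matrix_def sum_distrib_left sum_distrib_right algebra_simps)
  also have "\<dots> = (\<Sum>i\<in>UNIV. \<Sum>k\<in>UNIV. \<Sum>j\<in>UNIV. (1/2) * ((B y $ i $ k * u $ i) * (B y $ j $ k * v $ j)))"
    by (intro sum.cong refl sum.swap)
  also have "\<dots> = (\<Sum>k\<in>UNIV. \<Sum>i\<in>UNIV. \<Sum>j\<in>UNIV. (1/2) * ((B y $ i $ k * u $ i) * (B y $ j $ k * v $ j)))"
    by (rule sum.swap)
  also have "\<dots> = (\<Sum>k\<in>UNIV. (1/2) * ((\<Sum>i\<in>UNIV. B y $ i $ k * u $ i) * (\<Sum>j\<in>UNIV. B y $ j $ k * v $ j)))"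
    unfolding sum_product by (simp only: sum_distrib_left)
  also have "\<dots> = (1/2) * ((transpose (B y) *v u) \<bullet> (transpose (B y) *v v))"
    by (simp add: inner_vec_def matrix_vector_mult_def transpose_def sum_distrib_left)
  finally show ?thesis .
qed

lemma diffusion_matrix_outer_nonneg: "0 \<le> diffusion_matrix B y \<bullet> outer u u"
  by (simp add: diffusion_matrix_outer)

text \<open>Full rank makes the transpose of \<open>B y\<close> injective, and the quadratic form is
  half the squared norm of the image of \<open>u\<close> under that transpose.\<close>

lemma diffusion_matrix_outer_pos:
  fixes B :: "real ^ 'n \<Rightarrow> real ^ 'm ^ 'n"
  assumes "rank (B y) = CARD('n)" "u \<noteq> 0"
  shows "0 < diffusion_matrix B y \<bullet> outer u u"
proof -
  have "inj ((*v) (transpose (B y)))" using assms(1) by (simp add: full_rank_injective[symmetric] rank_transpose)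
  then have "transpose (B y) *v u \<noteq> 0" using assms(2) injD[of "(*v) (transpose (B y))" u 0] by auto
  then show ?thesis by (simp add: diffusion_matrix_outer)
qed

lemma continuous_on_diffusion_matrix [continuous_intros]:
  assumes "continuous_on S B"
  shows "continuous_on S (diffusion_matrix B)"
  unfolding diffusion_matrix_def[abs_def]
  by (intro continuous_on_vec_lambda continuous_intros assms)

lemma jet2_scale:
  assumes "jet2 S f G H"
  shows "jet2 S (\<lambda>y. c * f y) (\<lambda>y. c *\<^sub>R G y) (\<lambda>y. c *\<^sub>R H y)"
  using jet2_mult[OF jet2_const[of S c] assms] by (simp add: outer_def zero_vec_def[symmetric])

lemma outer_scaleR [simp]: "outer (c *\<^sub>R u) v = c *\<^sub>R outer u v" "outer u (c *\<^sub>R v) = c *\<^sub>R outer u v"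
  by (simp_all add: vec_eq_iff)

lemma L_op_add:
  assumes "open S" "Ck_on 2 S f" "Ck_on 2 S g" "y \<in> S"
  shows "L_op b B (\<lambda>y. f y + g y) y = L_op b B f y + L_op b B g y"
proof -
  obtain G H where f: "jet2 S f G H" using Ck_on_2E[OF assms(2,1)] .
  obtain G' H' where g: "jet2 S g G' H'" using Ck_on_2E[OF assms(3,1)] .
  note j = f g
  show ?thesis
    by (simp add: L_op_jet2[OF j(1) assms(1,4)] L_op_jet2[OF j(2) assms(1,4)]
        L_op_jet2[OF jet2_add[OF j] assms(1,4)] inner_add_right)
qed

lemma L_op_scale:
  assumes "open S" "Ck_on 2 S f" "y \<in> S"
  shows "L_op b B (\<lambda>y. c * f y) y = c * L_op b B f y"
proof -
  obtain G H where j: "jet2 S f G H" using Ck_on_2E[OF assms(2,1)] .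
  show ?thesis
    by (simp add: L_op_jet2[OF j(1) assms(1,3)] L_op_jet2[OF jet2_scale[OF j] assms(1,3)] algebra_simps)
qed

lemma L_op_const: "L_op b B (\<lambda>_. c) y = 0"
  by (simp add: L_op_jet2[OF jet2_const[of UNIV] open_UNIV])

lemma Ck_on_2_const: "open S \<Longrightarrow> Ck_on 2 S (\<lambda>_. c)"
  by (rule Ck_on_2I[OF _ jet2_const])

lemma Ck_on_2_add: "open S \<Longrightarrow> Ck_on 2 S f \<Longrightarrow> Ck_on 2 S g \<Longrightarrow> Ck_on 2 S (\<lambda>y. f y + g y)"
  by (erule (1) Ck_on_2E, erule (1) Ck_on_2E, rule Ck_on_2I, assumption, rule jet2_add)

lemma Ck_on_2_scale: "open S \<Longrightarrow> Ck_on 2 S f \<Longrightarrow> Ck_on 2 S (\<lambda>y. c * f y)"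
  by (erule (1) Ck_on_2E, rule Ck_on_2I, assumption, rule jet2_scale)

lemma Ck_on_2_subset: "open S \<Longrightarrow> open T \<Longrightarrow> T \<subseteq> S \<Longrightarrow> Ck_on 2 S f \<Longrightarrow> Ck_on 2 T f"
  by (erule (1) Ck_on_2E, rule Ck_on_2I, assumption, rule jet2_subset)

lemma Ck_on_2_continuous: "open S \<Longrightarrow> Ck_on 2 S f \<Longrightarrow> continuous_on S f"
  by (erule (1) Ck_on_2E, rule jet2_continuous(1))

lemma L_op_sum:
  assumes "open S" "y \<in> S" "finite I" "\<And>i. i \<in> I \<Longrightarrow> Ck_on 2 S (f i)"
  shows "L_op b B (\<lambda>y. \<Sum>i\<in>I. f i y) y = (\<Sum>i\<in>I. L_op b B (f i) y) \<and> Ck_on 2 S (\<lambda>y. \<Sum>i\<in>I. f i y)"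
  using assms(3,4)
proof (induction I rule: finite_induct)
  case empty
  then show ?case using L_op_const[of b B 0] Ck_on_2_const[OF assms(1)] by simp
next
  case (insert i I)
  then show ?case
    using L_op_add[OF assms(1) _ _ assms(2), where b=b and B=B, of "f i" "\<lambda>y. \<Sum>i\<in>I. f i y"]
      Ck_on_2_add[OF assms(1), of "f i" "\<lambda>y. \<Sum>i\<in>I. f i y"] by simp
qed

lemma L_op_compose:
  assumes "open S" "jet2 S f G H" "y \<in> S"
    and \<phi>: "\<And>t. (\<phi> has_real_derivative \<phi>' t) (at t)" "\<And>t. (\<phi>' has_real_derivative \<phi>'' t) (at t)"
      "continuous_on UNIV \<phi>''"
  shows "L_op b B (\<lambda>y. \<phi> (f y)) y =
    \<phi>' (f y) * L_op b B f y - \<phi>'' (f y) * (diffusion_matrix B y \<bullet> outer (G y) (G y))"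
  by (simp add: L_op_jet2[OF assms(2,1,3)] L_op_jet2[OF jet2_compose[OF assms(2) \<phi>] assms(1,3)]
      inner_add_right algebra_simps)

lemma continuous_on_L_op:
  assumes "open S" "Ck_on 2 S f" "continuous_on S b" "continuous_on S B"
  shows "continuous_on S (L_op b B f)"
proof -
  obtain G H where j: "jet2 S f G H" using Ck_on_2E[OF assms(2,1)] .
  have "continuous_on S (\<lambda>y. - (diffusion_matrix B y \<bullet> H y + b y \<bullet> G y))"
    by (intro continuous_intros assms jet2_continuous[OF j])
  then show ?thesis by (rule continuous_on_eq) (simp add: L_op_jet2[OF j assms(1)])
qed

lemma compact_positive_lower_bound:
  fixes f :: "'a::topological_space \<Rightarrow> real"
  assumes "compact K" "continuous_on K f" "\<And>y. y \<in> K \<Longrightarrow> 0 < f y"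
  shows "\<exists>c>0. \<forall>y\<in>K. c \<le> f y"
proof (cases "K = {}")
  case True
  then show ?thesis using zero_less_one by blast
next
  case False
  then obtain z where "z \<in> K" "\<forall>y\<in>K. f z \<le> f y" using continuous_attains_inf[OF assms(1) _ assms(2)] by blast
  then show ?thesis using assms(3) by blast
qed

lemma compact_abs_upper_bound:
  fixes f :: "'a::topological_space \<Rightarrow> real"
  assumes "compact K" "continuous_on K f"
  shows "\<exists>c>0. \<forall>y\<in>K. \<bar>f y\<bar> \<le> c"
proof -
  have "bounded (f ` K)" using compact_continuous_image[OF assms(2,1)] by (rule compact_imp_bounded)
  then show ?thesis unfolding bounded_pos by auto
qed

section \<open>Barriers at the boundary\<close>

locale elliptic_domain =
  fixes X :: "(real ^ 'n) set" and b :: "real ^ 'n \<Rightarrow> real ^ 'n" and B :: "real ^ 'n \<Rightarrow> real ^ 'm ^ 'n"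
  assumes open_X: "open X" and bounded_X: "bounded X" and smooth: "smooth_boundary X"
    and cont_b: "continuous_on UNIV b" and cont_B: "continuous_on UNIV B"
    and full_rank: "\<And>y. rank (B y) = CARD('n)"
begin

abbreviation L :: "(real ^ 'n \<Rightarrow> real) \<Rightarrow> real ^ 'n \<Rightarrow> real" where
  "L \<equiv> L_op b B"

lemma compact_closure_X: "compact (closure X)"
  using bounded_X by (simp add: compact_closure)

lemma compact_frontier_X: "compact (frontier X)"
  using bounded_X by (simp add: compact_frontier_bounded)

lemma frontier_X: "frontier X = closure X - X"
  using open_X by (simp add: frontier_def interior_open)

lemma closure_X: "closure X = X \<union> frontier X"
  using closure_subset[of X] frontier_X by blast

lemma continuous_on_coefficients: "continuous_on S b" "continuous_on S B"
  using cont_b cont_B continuous_on_subset by blast+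

text \<open>For u = exp(\<tau> e . y) one has L u = - u \<tau> (\<tau> Ae . e + b . e), so for large
  \<tau> the diffusion outweighs the drift. Scaling then brings \<open>L\<close> below -1, and a
  constant shift, invisible to \<open>L\<close>, brings the function itself below -1. Besides making
  the problems feasible, such a strict subsolution bounds arbitrary bounded data.\<close>

lemma slater_function:
  obtains v where "Ck_on 2 UNIV v" "\<And>y. y \<in> closure X \<Longrightarrow> L v y \<le> -1" "\<And>y. y \<in> closure X \<Longrightarrow> v y \<le> -1"
proof -
  define e :: "real ^ 'n" where "e = axis undefined 1"
  have "e \<noteq> 0" by (simp add: e_def)
  have "continuous_on (closure X) (\<lambda>y. diffusion_matrix B y \<bullet> outer e e)"
    by (intro continuous_intros continuous_on_coefficients)
  then obtain a where a: "a > 0" "\<And>y. y \<in> closure X \<Longrightarrow> a \<le> diffusion_matrix B y \<bullet> outer e e"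
    using compact_positive_lower_bound[OF compact_closure_X, of "\<lambda>y. diffusion_matrix B y \<bullet> outer e e"]
      diffusion_matrix_outer_pos[of B _ e, OF full_rank \<open>e \<noteq> 0\<close>] by blast
  have "continuous_on (closure X) (\<lambda>y. b y \<bullet> e)" by (intro continuous_intros continuous_on_coefficients)
  then obtain c where c: "c > 0" "\<And>y. y \<in> closure X \<Longrightarrow> \<bar>b y \<bullet> e\<bar> \<le> c"
    using compact_abs_upper_bound[OF compact_closure_X] by blast
  \<comment> \<open>With this rate the bracket \<tau> Ae . e + b . e is at least \<tau> a - c =
    1.\<close>
  define \<tau> where "\<tau> = (c + 1) / a"
  have \<tau>: "\<tau> > 0" "\<tau> * a = c + 1" using a c by (auto simp: \<tau>_def)
  define f where "f = (\<lambda>y. (\<tau> *\<^sub>R e) \<bullet> y)"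
  define u where "u y = exp (f y)" for y
  have j: "jet2 UNIV f (\<lambda>_. \<tau> *\<^sub>R e) (\<lambda>_. 0)" unfolding f_def by (rule jet2_inner)
  have exp: "(exp has_real_derivative exp t) (at t)" "continuous_on UNIV (exp :: real \<Rightarrow> real)" for t
    by (auto intro!: derivative_eq_intros continuous_intros)
  have u2: "Ck_on 2 UNIV u"
    unfolding u_def by (rule Ck_on_2I[OF open_UNIV jet2_compose[OF j exp(1) exp(1) exp(2)]])
  have Lu: "L u y < 0" if "y \<in> closure X" for y
  proof -
    have "L f y = - \<tau> * (b y \<bullet> e)"
      using L_op_jet2[OF j open_UNIV UNIV_I, of b B y] by simp
    then have "L u y = - (u y * \<tau>) * (\<tau> * (diffusion_matrix B y \<bullet> outer e e) + b y \<bullet> e)"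
      unfolding u_def L_op_compose[OF open_UNIV j UNIV_I exp(1) exp(1) exp(2)]
      by (simp add: algebra_simps)
    moreover have "\<tau> * (diffusion_matrix B y \<bullet> outer e e) + b y \<bullet> e \<ge> 1"
      using mult_left_mono[OF a(2)[OF that], of \<tau>] c(2)[OF that] \<tau> by (simp add: abs_le_iff)
    moreover have "u y * \<tau> > 0" using \<tau> by (simp add: u_def)
    ultimately show ?thesis by (simp add: mult_less_0_iff)
  qed
  have "continuous_on (closure X) (\<lambda>y. - L u y)"
    using continuous_on_L_op[OF open_UNIV u2 cont_b cont_B]
    by (intro continuous_intros) (auto intro: continuous_on_subset)
  then obtain k where k: "k > 0" "\<And>y. y \<in> closure X \<Longrightarrow> k \<le> - L u y"
    using compact_positive_lower_bound[OF compact_closure_X, of "\<lambda>y. - L u y"] Lu by (auto simp del: neg_le_iff_le)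
  have "continuous_on (closure X) (\<lambda>y. (1 / k) * u y)"
    using Ck_on_2_continuous[OF open_UNIV u2]
    by (intro continuous_intros) (auto intro: continuous_on_subset)
  then obtain d where d: "\<And>y. y \<in> closure X \<Longrightarrow> \<bar>(1 / k) * u y\<bar> \<le> d"
    using compact_abs_upper_bound[OF compact_closure_X] by blast
  note s2 = Ck_on_2_scale[OF open_UNIV u2, of "1 / k"]
  note c2 = Ck_on_2_const[OF open_UNIV, of "- d - 1"]
  show ?thesis
  proof (rule that[of "\<lambda>y. (1 / k) * u y + (- d - 1)"])
    show "Ck_on 2 UNIV (\<lambda>y. (1 / k) * u y + (- d - 1))" by (rule Ck_on_2_add[OF open_UNIV s2 c2])
    fix y assume y: "y \<in> closure X"
    have eq: "L (\<lambda>y. (1 / k) * u y + (- d - 1)) y = (1 / k) * L u y"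
      by (simp only: L_op_add[OF open_UNIV s2 c2 UNIV_I] L_op_scale[OF open_UNIV u2 UNIV_I] L_op_const add_0_right)
    show "L (\<lambda>y. (1 / k) * u y + (- d - 1)) y \<le> -1"
      unfolding eq using k(1) k(2)[OF y] by (simp add: field_simps)
    show "(1 / k) * u y + (- d - 1) \<le> -1" using abs_ge_self[of "(1 / k) * u y"] d[OF y] by linarith
  qed
qed

text \<open>At the boundary the exponential transform makes the second-order term \<open>\<tau>\<^sup>2 A\<nabla>\<rho> \<cdot> \<nabla>\<rho>\<close>
  dominate everything else, including the terms created by the cut-off.\<close>

lemma local_barrier:
  assumes p: "p \<in> frontier X"
  shows "\<exists>r \<alpha> c Z. r > 0 \<and> \<alpha> > 0 \<and> c > 0 \<and> (\<forall>\<tau>>0. Ck_on 2 UNIV (Z \<tau>) \<and>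
      (\<forall>y\<in>X. Z \<tau> y \<le> 0) \<and> (\<forall>y\<in>X. y \<in> ball p r \<longrightarrow> Z \<tau> y < 0) \<and> (\<forall>y\<in>frontier X. Z \<tau> y = 0) \<and>
      (\<forall>y\<in>frontier X. - c * \<tau> \<le> - L (Z \<tau>) y) \<and>
      (\<forall>y\<in>frontier X. y \<in> ball p r \<longrightarrow> \<alpha> * \<tau>\<^sup>2 - c * \<tau> \<le> - L (Z \<tau>) y))"
proof -
  obtain U \<rho> where U: "open U" "p \<in> U" and sm: "smooth_on U \<rho>" and gr: "\<And>y. y \<in> U \<Longrightarrow> \<exists>i. partial i \<rho> y \<noteq> 0"
    and X: "X \<inter> U = {y\<in>U. \<rho> y < 0}" and fX: "frontier X \<inter> U = {y\<in>U. \<rho> y = 0}"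
    using smooth p unfolding smooth_boundary_def by meson
  have "Ck_on 2 U \<rho>" using sm by (simp add: smooth_on_def)
  then obtain G H where j: "jet2 U \<rho> G H" by (rule Ck_on_2E[OF _ U(1)])
  have G0: "G y \<noteq> 0" if "y \<in> U" for y using gr[OF that] jet2_partial[OF j that] by auto
  obtain R where R: "R > 0" "cball p R \<subseteq> U" using U open_contains_cball by blast
  have cb: "R\<^sup>2 - (y - p) \<bullet> (y - p) > 0 \<longleftrightarrow> y \<in> ball p R" for y
  proof -
    have "(y - p) \<bullet> (y - p) = (dist p y)\<^sup>2" by (simp add: dist_norm norm_minus_commute dot_square_norm)
    then show ?thesis using R(1) abs_le_square_iff[of R "dist p y"] by (auto simp: not_less[symmetric])
  qed
  \<comment> \<open>A C^2 cut-off that is positive exactly on the open ball, thanks to the cube of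
    the positive part of R^2 - |y - p|^2.\<close>
  define \<kappa> where "\<kappa> y = pos_cube (R\<^sup>2 + - 1 * ((y - p) \<bullet> (y - p)))" for y
  have \<kappa>0: "\<kappa> y = 0" if "y \<notin> ball p R" for y
    using cb[of y] that by (auto simp: \<kappa>_def pos_cube_def max_def)
  have \<kappa>pos: "\<kappa> y > 0" if "y \<in> ball p R" for y
    using cb[of y] that by (auto simp: \<kappa>_def pos_cube_def)
  have \<kappa>nn: "\<kappa> y \<ge> 0" for y by (simp add: \<kappa>_def pos_cube_def)
  obtain K J where jk: "jet2 UNIV \<kappa> K J"
    unfolding \<kappa>_def
    using jet2_compose[OF jet2_add[OF jet2_const jet2_scale[OF jet2_norm_square]] pos_cube_derivatives] by blast
  note jkU = jet2_subset[OF jk subset_UNIV[of U]]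
  define A where "A = diffusion_matrix B"
  \<comment> \<open>On the frontier \<rho> = 0, so exp(\<tau> \<rho>) - 1 vanishes and
    \<open>- L (Z \<tau>)\<close> equals \<open>a y * \<tau>\<^sup>2 + e y * \<tau>\<close> exactly:
    \<open>a\<close> collects the terms with two derivatives on the exponential, \<open>e\<close>
    all others, including the mixed terms with the gradient \<open>K\<close> of the cut-off.\<close>
  define a where "a y = \<kappa> y * (A y \<bullet> outer (G y) (G y))" for y
  define e where "e y = \<kappa> y * (A y \<bullet> H y + b y \<bullet> G y) + A y \<bullet> (outer (K y) (G y) + outer (G y) (K y))" for y
  have cont: "continuous_on U a" "continuous_on U e"
    unfolding a_def e_def A_def
    by (intro continuous_intros continuous_on_coefficients jet2_continuous[OF j] jet2_continuous[OF jkU])+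
  have ann: "a y \<ge> 0" for y unfolding a_def A_def by (intro mult_nonneg_nonneg \<kappa>nn diffusion_matrix_outer_nonneg)
  have "a y > 0" if "y \<in> cball p (R / 2)" for y
  proof -
    have "y \<in> ball p R" using that R by auto
    then show ?thesis using \<kappa>pos[of y] diffusion_matrix_outer_pos[of B y "G y"] full_rank G0 R
      by (auto simp: a_def A_def subset_eq)
  qed
  moreover have "continuous_on (cball p (R / 2)) a" using R by (intro continuous_on_subset[OF cont(1)]) (auto simp: subset_eq)
  ultimately obtain \<alpha> where \<alpha>: "\<alpha> > 0" "\<And>y. y \<in> cball p (R / 2) \<Longrightarrow> \<alpha> \<le> a y"
    using compact_positive_lower_bound[OF compact_cball] by blast
  have "continuous_on (cball p R) e" using R by (intro continuous_on_subset[OF cont(2)]) auto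
  then obtain c where c: "c > 0" "\<And>y. y \<in> cball p R \<Longrightarrow> \<bar>e y\<bar> \<le> c"
    using compact_abs_upper_bound[OF compact_cball] by blast
  \<comment> \<open>The factor \<open>\<kappa>\<close> vanishes outside the ball, so the two
    branches agree off \<open>cball p R\<close>. Since \<open>U\<close> and the complement of
    \<open>cball p R\<close> cover the space, \<open>Z \<tau>\<close> is C^2 everywhere.\<close>
  define Z where "Z \<tau> y = (if y \<in> U then \<kappa> y * (exp (\<tau> * \<rho> y) - 1) else 0)" for \<tau> y
  have Z0: "Z \<tau> y = 0" if "y \<notin> ball p R" for \<tau> y using \<kappa>0[OF that] by (simp add: Z_def)
  have UN: "U \<union> - cball p R = UNIV" using R by auto
  have oc: "open (- cball p R)" by (simp add: open_Compl)
  have LZ: "Ck_on 2 UNIV (Z \<tau>) \<and> (\<forall>y\<in>frontier X. - L (Z \<tau>) y = (if y \<in> cball p R then a y * \<tau>\<^sup>2 + e y * \<tau> else 0))" for \<tau>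
  proof -
    have ex: "((\<lambda>t. exp (\<tau> * t) - 1) has_real_derivative \<tau> * exp (\<tau> * t)) (at t)"
      "((\<lambda>t. \<tau> * exp (\<tau> * t)) has_real_derivative \<tau>\<^sup>2 * exp (\<tau> * t)) (at t)" for t
      by (auto intro!: derivative_eq_intros simp: power2_eq_square)
    have exc: "continuous_on UNIV (\<lambda>t. \<tau>\<^sup>2 * exp (\<tau> * t))" by (intro continuous_intros)
    note jZ = jet2_cong[OF jet2_mult[OF jkU jet2_compose[OF j ex exc]] U(1), of "Z \<tau>"]
    have 1: "Ck_on 2 U (Z \<tau>)" by (rule Ck_on_2I[OF U(1) jZ]) (simp add: Z_def)
    have 3: "L (Z \<tau>) y = 0" if "y \<in> - cball p R" for y
    proof -
      have "L (Z \<tau>) y = L (\<lambda>_. 0) y" by (rule L_op_cong[OF oc that]) (auto intro: Z0)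
      then show ?thesis by (simp only: L_op_const)
    qed
    have 2: "Ck_on 2 (- cball p R) (Z \<tau>)"
      by (rule Ck_on_2_cong[OF oc Ck_on_2_const[OF oc, of 0]]) (auto intro: Z0)
    have "Ck_on 2 UNIV (Z \<tau>)" using Ck_on_Un[OF U(1) oc 1 2] UN by simp
    moreover have "- L (Z \<tau>) y = a y * \<tau>\<^sup>2 + e y * \<tau>" if "y \<in> frontier X" "y \<in> cball p R" for y
    proof -
      have y: "y \<in> U" using that R by auto
      then have "\<rho> y = 0" using fX that by auto
      then show ?thesis
        using y
        by (subst L_op_jet2[OF jZ U(1)])
          (auto simp: Z_def a_def e_def A_def inner_add_right algebra_simps)
    qed
    ultimately show ?thesis using 3 by auto
  qed
  show ?thesis
  proof (rule exI[of _ "R / 2"], rule exI[of _ \<alpha>], rule exI[of _ c], rule exI[of _ Z],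
      intro conjI allI impI ballI)
    show "Ck_on 2 UNIV (Z \<tau>)" for \<tau> using LZ by blast
    fix \<tau> :: real and y assume \<tau>: "\<tau> > 0"
    have neg: "exp (\<tau> * \<rho> y) - 1 < 0" if "y \<in> X" "y \<in> U"
    proof -
      have "\<rho> y < 0" using that X by auto
      then have "\<tau> * \<rho> y < 0" using \<tau> by (simp add: mult_less_0_iff)
      then show ?thesis by simp
    qed
    show "Z \<tau> y \<le> 0" if "y \<in> X"
      using mult_nonneg_nonpos[OF \<kappa>nn[of y] less_imp_le[OF neg[OF that]]] by (simp add: Z_def)
    show "Z \<tau> y < 0" if "y \<in> X" "y \<in> ball p (R / 2)"
    proof -
      have y: "y \<in> ball p R" using that R(1) by auto
      then have "y \<in> U" using R by auto
      then show ?thesis using mult_pos_neg[OF \<kappa>pos[OF y] neg[OF that(1)]] by (simp add: Z_def)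
    qed
    assume y: "y \<in> frontier X"
    show "Z \<tau> y = 0" using y fX by (auto simp: Z_def)
    have *: "- c * \<tau> \<le> e y * \<tau>" if "y \<in> cball p R"
      using c(2)[OF that] \<tau> by (intro mult_right_mono) (auto simp: abs_le_iff)
    have eq: "- L (Z \<tau>) y = (if y \<in> cball p R then a y * \<tau>\<^sup>2 + e y * \<tau> else 0)" using LZ y by blast
    have "0 \<le> a y * \<tau>\<^sup>2" "0 \<le> c * \<tau>" using ann c \<tau> by auto
    then show "- c * \<tau> \<le> - L (Z \<tau>) y" unfolding eq using * by auto
    show "\<alpha> * \<tau>\<^sup>2 - c * \<tau> \<le> - L (Z \<tau>) y" if "y \<in> ball p (R / 2)"
    proof -
      have y: "y \<in> cball p R" "y \<in> cball p (R / 2)" using that R(1) by auto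
      have "\<alpha> * \<tau>\<^sup>2 \<le> a y * \<tau>\<^sup>2" by (intro mult_right_mono \<alpha>(2)[OF y(2)]) auto
      then show ?thesis unfolding eq using *[OF y(1)] y(1) by simp
    qed
  qed (use R \<alpha> c in auto)
qed

text \<open>By compactness finitely many local barriers can be added up. At a frontier point one
  summand gains at least a \<tau>^2, and together all lose at most k \<tau>, where a is at most
  every gain \<alpha> and k is the sum of the losses c. Taking a \<tau> = k + 1 leaves a \<tau>^2 -
  k \<tau> = \<tau> > 0, and continuity extends the strict inequality to a neighbourhood.\<close>

lemma global_barrier:
  obtains \<zeta> V where "Ck_on 2 UNIV \<zeta>" "open V" "frontier X \<subseteq> V"
    "\<And>y. y \<in> X \<inter> V \<Longrightarrow> \<zeta> y < 0" "\<And>y. y \<in> frontier X \<Longrightarrow> \<zeta> y = 0" "\<And>y. y \<in> V \<Longrightarrow> L \<zeta> y < 0"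
proof -
  \<comment> \<open>Naming the property keeps it opaque while radii, constants and barriers are
    chosen simultaneously for all frontier points.\<close>
  define Q where "Q p r \<alpha> c Z \<longleftrightarrow> r > 0 \<and> \<alpha> > 0 \<and> c > 0 \<and> (\<forall>\<tau>>0. Ck_on 2 UNIV (Z \<tau>) \<and>
      (\<forall>y\<in>X. Z \<tau> y \<le> 0) \<and> (\<forall>y\<in>X. y \<in> ball p r \<longrightarrow> Z \<tau> y < 0) \<and> (\<forall>y\<in>frontier X. Z \<tau> y = 0) \<and>
      (\<forall>y\<in>frontier X. - c * \<tau> \<le> - L (Z \<tau>) y) \<and>
      (\<forall>y\<in>frontier X. y \<in> ball p r \<longrightarrow> \<alpha> * \<tau>\<^sup>2 - c * \<tau> \<le> - L (Z \<tau>) y))" for p r \<alpha> c Z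
  have "\<forall>p\<in>frontier X. \<exists>r \<alpha> c Z. Q p r \<alpha> c Z"
    unfolding Q_def by (rule ballI) (rule local_barrier)
  then obtain r \<alpha> c Z where Q: "\<forall>p\<in>frontier X. Q p (r p) (\<alpha> p) (c p) (Z p)"
    by metis
  have r: "r p > 0 \<and> \<alpha> p > 0 \<and> c p > 0 \<and> (\<forall>\<tau>>0. Ck_on 2 UNIV (Z p \<tau>) \<and>
      (\<forall>y\<in>X. Z p \<tau> y \<le> 0) \<and> (\<forall>y\<in>X. y \<in> ball p (r p) \<longrightarrow> Z p \<tau> y < 0) \<and> (\<forall>y\<in>frontier X. Z p \<tau> y = 0) \<and>
      (\<forall>y\<in>frontier X. - c p * \<tau> \<le> - L (Z p \<tau>) y) \<and>
      (\<forall>y\<in>frontier X. y \<in> ball p (r p) \<longrightarrow> \<alpha> p * \<tau>\<^sup>2 - c p * \<tau> \<le> - L (Z p \<tau>) y))" if "p \<in> frontier X" for p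
    using bspec[OF Q that] unfolding Q_def .
  have rpos: "r p > 0" if "p \<in> frontier X" for p
    by (rule conjunct1[OF r[OF that]])
  have \<alpha>c: "\<alpha> p > 0 \<and> c p > 0" if "p \<in> frontier X" for p
    using conjunct2[OF r[OF that]] by (elim conjE) (intro conjI)
  note Z = conjunct2[OF conjunct2[OF conjunct2[OF r]], rule_format]
  have Z1: "Ck_on 2 UNIV (Z p \<tau>)" if "p \<in> frontier X" "\<tau> > 0" for p \<tau>
    using Z[OF that] by (elim conjE)
  have Z2: "Z p \<tau> y \<le> 0" if "p \<in> frontier X" "\<tau> > 0" "y \<in> X" for p \<tau> y
    using Z[OF that(1,2)] that(3) by blast
  have Z3: "Z p \<tau> y < 0" if "p \<in> frontier X" "\<tau> > 0" "y \<in> X" "y \<in> ball p (r p)" for p \<tau> y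
    using Z[OF that(1,2)] that(3,4) by blast
  have Z4: "Z p \<tau> y = 0" if "p \<in> frontier X" "\<tau> > 0" "y \<in> frontier X" for p \<tau> y
    using Z[OF that(1,2)] that(3) by blast
  have Z5: "- c p * \<tau> \<le> - L (Z p \<tau>) y" if "p \<in> frontier X" "\<tau> > 0" "y \<in> frontier X" for p \<tau> y
    using Z[OF that(1,2)] that(3) by blast
  have Z6: "\<alpha> p * \<tau>\<^sup>2 - c p * \<tau> \<le> - L (Z p \<tau>) y"
    if "p \<in> frontier X" "\<tau> > 0" "y \<in> frontier X" "y \<in> ball p (r p)" for p \<tau> y
    using Z[OF that(1,2)] that(3,4) by blast
  have cov: "frontier X \<subseteq> (\<Union>p\<in>frontier X. ball p (r p))"
  proof
    fix p assume "p \<in> frontier X"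
    then show "p \<in> (\<Union>p\<in>frontier X. ball p (r p))" using rpos[of p] by (intro UN_I[of p]) auto
  qed
  obtain I where I: "I \<subseteq> frontier X" "finite I" "frontier X \<subseteq> (\<Union>p\<in>I. ball p (r p))"
    by (rule compactE_image[OF compact_frontier_X _ cov]) auto
  \<comment> \<open>Inserting 1 keeps the minimum well defined when \<open>I\<close> is
    empty.\<close>
  define a where "a = Min (insert 1 (\<alpha> ` I))"
  define k where "k = (\<Sum>p\<in>I. c p)"
  have a: "a > 0" "\<And>p. p \<in> I \<Longrightarrow> a \<le> \<alpha> p"
  proof -
    show "a > 0" using I \<alpha>c by (auto simp: a_def)
    show "a \<le> \<alpha> p" if "p \<in> I" for p unfolding a_def using I that by (intro Min_le) auto
  qed
  have k: "k \<ge> 0" unfolding k_def using I \<alpha>c by (intro sum_nonneg) (blast intro: less_imp_le)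
  define \<tau> where "\<tau> = (k + 1) / a"
  have \<tau>: "\<tau> > 0" "a * \<tau> = k + 1" using a k by (auto simp: \<tau>_def)
  define \<zeta> where "\<zeta> y = (\<Sum>p\<in>I. Z p \<tau> y)" for y
  have LC: "L \<zeta> y = (\<Sum>p\<in>I. L (Z p \<tau>) y) \<and> Ck_on 2 UNIV \<zeta>" for y
    unfolding \<zeta>_def using I \<tau> Z1 by (intro L_op_sum) auto
  then have \<zeta>2: "Ck_on 2 UNIV \<zeta>" by blast
  have neg: "L \<zeta> y < 0" if y: "y \<in> frontier X" for y
  proof -
    obtain q where q: "q \<in> I" "y \<in> ball q (r q)" using I y by auto
    have "(\<Sum>p\<in>I. (if p = q then a * \<tau>\<^sup>2 else 0) - c p * \<tau>) \<le> (\<Sum>p\<in>I. - L (Z p \<tau>) y)"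
    proof (rule sum_mono)
      fix p assume p: "p \<in> I"
      have "a * \<tau>\<^sup>2 \<le> \<alpha> p * \<tau>\<^sup>2" by (intro mult_right_mono a p) auto
      then show "(if p = q then a * \<tau>\<^sup>2 else 0) - c p * \<tau> \<le> - L (Z p \<tau>) y"
        using Z6[OF subsetD[OF I(1) q(1)] \<tau>(1) y q(2)] Z5[OF subsetD[OF I(1) p] \<tau>(1) y]
        by (cases "p = q") (simp_all, linarith?)
    qed
    also have "(\<Sum>p\<in>I. (if p = q then a * \<tau>\<^sup>2 else 0) - c p * \<tau>) = a * \<tau>\<^sup>2 - k * \<tau>"
      using I(2) q(1) by (simp add: sum_subtractf k_def sum_distrib_right)
    also have "\<dots> = \<tau>" using \<tau>(2) by (simp add: power2_eq_square algebra_simps flip: mult.assoc)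
    finally show ?thesis using \<tau>(1) LC[of y] by (simp add: sum_negf)
  qed
  \<comment> \<open>Lying in one of the balls makes at least one summand strictly negative inside
    \<open>X\<close>, the others being nonpositive; the second set keeps \<open>L \<zeta>\<close>
    negative.\<close>
  define V where "V = (\<Union>p\<in>I. ball p (r p)) \<inter> L \<zeta> -` {..<0}"
  have "open (L \<zeta> -` {..<0})"
    using continuous_on_L_op[OF open_UNIV \<zeta>2 cont_b cont_B]
    by (intro continuous_open_vimage) (auto simp: continuous_on_eq_continuous_at)
  then have "open V" unfolding V_def by (intro open_Int open_UN) auto
  moreover have "frontier X \<subseteq> V" using I neg by (auto simp: V_def)
  moreover have "\<zeta> y < 0" if yXV: "y \<in> X \<inter> V" for y
  proof -
    obtain q where q: "q \<in> I" "y \<in> ball q (r q)" using yXV by (auto simp: V_def)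
    have "Z q \<tau> y < 0" "\<And>p. p \<in> I \<Longrightarrow> Z p \<tau> y \<le> 0"
      using Z3[OF subsetD[OF I(1) q(1)] \<tau>(1) _ q(2)] Z2[OF subsetD[OF I(1)] \<tau>(1)] that by auto
    then have "(\<Sum>p\<in>I. Z p \<tau> y) < (\<Sum>p\<in>I. 0)"
      using q I(2) by (intro sum_strict_mono_ex1) auto
    then show ?thesis by (simp add: \<zeta>_def)
  qed
  moreover have "\<zeta> y = 0" if "y \<in> frontier X" for y
    unfolding \<zeta>_def using Z4[OF subsetD[OF I(1)] \<tau>(1) that] by (intro sum.neutral) blast
  moreover have "L \<zeta> y < 0" if "y \<in> V" for y using that by (auto simp: V_def)
  ultimately show ?thesis using that[of \<zeta> V] \<zeta>2 by blast
qed

text \<open>Near the frontier \<theta> = s^3 with s the positive part of 1 + \<zeta>/\<delta>,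
  elsewhere \<theta> = 0. As the cube is convex, L \<theta> \<le> 3 s^2 L \<zeta> / \<delta>, and L
  \<zeta> is bounded away from 0, so a thin layer (small \<delta>) makes L \<theta> as negative as
  desired wherever s is not small. The threshold 1/8 is the cube of s = 1/2.\<close>

lemma boundary_layer_subsolution:
  assumes "K > 0"
  shows "\<exists>\<theta> U. open U \<and> closure X \<subseteq> U \<and> Ck_on 2 U \<theta> \<and>
    (\<forall>y\<in>closure X. 0 \<le> \<theta> y \<and> \<theta> y \<le> 1 \<and> L \<theta> y \<le> 0 \<and> (1/8 \<le> \<theta> y \<longrightarrow> L \<theta> y \<le> - K)) \<and>
    (\<forall>y\<in>frontier X. \<theta> y = 1)"
proof -
  obtain \<zeta> V where \<zeta>2: "Ck_on 2 UNIV \<zeta>" and V: "open V" "frontier X \<subseteq> V"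
    and neg: "\<And>y. y \<in> X \<inter> V \<Longrightarrow> \<zeta> y < 0" and \<zeta>0: "\<And>y. y \<in> frontier X \<Longrightarrow> \<zeta> y = 0" and L: "\<And>y. y \<in> V \<Longrightarrow> L \<zeta> y < 0"
    by (rule global_barrier, rule that) blast+
  have \<zeta>le: "\<zeta> y \<le> 0" if "y \<in> closure X" "y \<in> V" for y
    using neg[of y] \<zeta>0[of y] that closure_X by (cases "y \<in> X") auto
  obtain e where e: "e > 0" "(\<Union>p\<in>frontier X. ball p e) \<subseteq> V"
    using compact_subset_open_imp_ball_epsilon_subset[OF compact_frontier_X V] by blast
  \<comment> \<open>Half the radius, so that even the closure of \<open>N\<close> stays inside
    \<open>V\<close>.\<close>
  define N where "N = (\<Union>p\<in>frontier X. ball p (e / 2))"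
  have N: "open N" "frontier X \<subseteq> N" "closure N \<subseteq> V"
  proof -
    show "open N" "frontier X \<subseteq> N" using e by (auto simp: N_def)
    show "closure N \<subseteq> V"
    proof
      fix y assume "y \<in> closure N"
      then obtain z where z: "z \<in> N" "dist z y < e / 2" using e by (meson closure_approachable half_gt_zero)
      then obtain p where p: "p \<in> frontier X" "dist p z < e / 2" by (auto simp: N_def)
      have "dist p y < e" using dist_triangle[of p y z] z p by linarith
      then have "y \<in> ball p e" by simp
      then show "y \<in> V" using e(2) p(1) by blast
    qed
  qed
  have NV: "N \<subseteq> V" using N(3) closure_subset by blast
  have c\<zeta>: "continuous_on S \<zeta>" for S using Ck_on_2_continuous[OF open_UNIV \<zeta>2] continuous_on_subset by blast
  have cL: "continuous_on S (L \<zeta>)" for S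
    using continuous_on_L_op[OF open_UNIV \<zeta>2 cont_b cont_B] continuous_on_subset by blast
  \<comment> \<open>The relative edge of \<open>N\<close>, where the continuation by zero has to
    match. It lies inside \<open>X\<close>, since \<open>N\<close> contains the frontier, so
    \<open>\<zeta>\<close> is bounded away from 0 on it.\<close>
  define Sh where "Sh = closure X \<inter> (closure N - N)"
  have "compact Sh" unfolding Sh_def using N(1) compact_closure_X
    by (intro compact_Int_closed closed_Diff) auto
  moreover have "0 < - \<zeta> y" if "y \<in> Sh" for y using that neg[of y] N closure_X by (auto simp: Sh_def)
  ultimately obtain \<delta>0 where \<delta>0: "\<delta>0 > 0" "\<And>y. y \<in> Sh \<Longrightarrow> \<delta>0 \<le> - \<zeta> y"
    using compact_positive_lower_bound[of Sh "\<lambda>y. - \<zeta> y"] continuous_on_minus[OF c\<zeta>] by blast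
  have "compact (closure X \<inter> closure N)" using compact_closure_X by (intro compact_Int_closed) auto
  moreover have "0 < - L \<zeta> y" if "y \<in> closure X \<inter> closure N" for y using that N L[of y] by auto
  ultimately obtain c where c: "c > 0" "\<And>y. y \<in> closure X \<inter> closure N \<Longrightarrow> c \<le> - L \<zeta> y"
    using compact_positive_lower_bound[of "closure X \<inter> closure N" "\<lambda>y. - L \<zeta> y"] continuous_on_minus[OF cL] by blast
  \<comment> \<open>The first bound makes the cube vanish already before the edge of
    \<open>N\<close> is reached. The second gives K \<le> (3/4) c/\<delta>, where 3/4 = 3 (1/2)^2 is
    the derivative of the cube at s = 1/2.\<close>
  define \<delta> where "\<delta> = min (\<delta>0 / 2) (3 * c / (4 * K))"
  have \<delta>: "\<delta> > 0" "\<delta> < \<delta>0" "K \<le> 3 / 4 * (c / \<delta>)"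
  proof -
    show "\<delta> > 0" "\<delta> < \<delta>0" using \<delta>0 c assms by (auto simp: \<delta>_def)
    have "\<delta> \<le> 3 * c / (4 * K)" by (simp add: \<delta>_def)
    then show "K \<le> 3 / 4 * (c / \<delta>)" using assms \<open>\<delta> > 0\<close> by (simp add: field_simps)
  qed
  define \<theta> where "\<theta> y = (if y \<in> N then pos_cube (1 + (1 / \<delta>) * \<zeta> y) else 0)" for y
  obtain G H where j: "jet2 UNIV \<zeta> G H" using Ck_on_2E[OF \<zeta>2 open_UNIV] .
  note jN = jet2_subset[OF jet2_add[OF jet2_const[of _ 1] jet2_scale[OF j, of "1 / \<delta>"]] subset_UNIV[of N]]
  have \<theta>N: "Ck_on 2 N \<theta>"
    by (rule Ck_on_2_cong[OF N(1), of "\<lambda>y. pos_cube (1 + (1 / \<delta>) * \<zeta> y)"])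
      (rule Ck_on_2I[OF N(1) jet2_compose[OF jN pos_cube_derivatives]], simp add: \<theta>_def)
  \<comment> \<open>An open set on which \<open>\<theta>\<close> is identically 0, either off the
    closure of \<open>N\<close> or where the cube has died out; with \<open>N\<close> it covers the
    closed domain.\<close>
  define A where "A = X \<inter> (- closure N \<union> \<zeta> -` {..<-\<delta>})"
  have oA: "open A" unfolding A_def
    using open_X c\<zeta>[of UNIV] by (intro open_Int open_Un continuous_open_vimage) (auto simp: continuous_on_eq_continuous_at)
  have A0: "\<theta> y = 0" if "y \<in> A" for y
  proof (cases "y \<in> N")
    case True
    then have "\<zeta> y < - \<delta>" using that closure_subset[of N] by (auto simp: A_def)
    then have "1 + (1 / \<delta>) * \<zeta> y \<le> 0" using \<delta> by (simp add: field_simps)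
    then show ?thesis by (simp add: \<theta>_def pos_cube_def)
  qed (simp add: \<theta>_def)
  have \<theta>A: "Ck_on 2 A \<theta>" using Ck_on_2_cong[OF oA Ck_on_2_const[OF oA, of 0]] A0 by blast
  have cover: "y \<in> N \<or> y \<in> A" if "y \<in> closure X" for y
  proof (cases "y \<in> N \<or> y \<notin> closure N")
    case True
    then show ?thesis using that N(2) closure_X by (auto simp: A_def)
  next
    case False
    then have "y \<in> Sh" using that by (auto simp: Sh_def)
    then have "\<zeta> y < - \<delta>" using \<delta>0(2)[of y] \<delta>(2) by linarith
    then show ?thesis using False that N(2) closure_X by (auto simp: A_def)
  qed
  have LA: "L \<theta> y = 0" if "y \<in> A" for y
    using L_op_cong[OF oA that, of \<theta> "\<lambda>_. 0" b B] A0 L_op_const by metis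
  have LN: "L \<theta> y \<le> - (3 * (max 0 (1 + (1 / \<delta>) * \<zeta> y))\<^sup>2 * (c / \<delta>))" if "y \<in> N" "y \<in> closure X" for y
  proof -
    let ?s = "1 + (1 / \<delta>) * \<zeta> y"
    have "L \<theta> y = L (\<lambda>y. pos_cube (1 + (1 / \<delta>) * \<zeta> y)) y"
      by (rule L_op_cong[OF N(1) that(1)]) (simp add: \<theta>_def)
    also have "\<dots> \<le> 3 * (max 0 ?s)\<^sup>2 * L (\<lambda>y. 1 + (1 / \<delta>) * \<zeta> y) y"
      unfolding L_op_compose[OF N(1) jN that(1) pos_cube_derivatives]
      using \<delta>(1) by (auto intro!: divide_nonneg_nonneg mult_nonneg_nonneg diffusion_matrix_outer_nonneg)
    also have "L (\<lambda>y. 1 + (1 / \<delta>) * \<zeta> y) y = (1 / \<delta>) * L \<zeta> y"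
      by (simp only: L_op_add[OF open_UNIV Ck_on_2_const[OF open_UNIV] Ck_on_2_scale[OF open_UNIV \<zeta>2] UNIV_I]
          L_op_scale[OF open_UNIV \<zeta>2 UNIV_I] L_op_const add_0)
    also have "3 * (max 0 ?s)\<^sup>2 * ((1 / \<delta>) * L \<zeta> y) \<le> 3 * (max 0 ?s)\<^sup>2 * (- (c / \<delta>))"
    proof (rule mult_left_mono)
      have "c \<le> - L \<zeta> y" using c(2)[of y] that closure_subset[of N] by auto
      then show "(1 / \<delta>) * L \<zeta> y \<le> - (c / \<delta>)" using \<delta>(1) by (simp add: field_simps)
    qed simp
    finally show ?thesis by simp
  qed
  show ?thesis
  proof (rule exI[of _ \<theta>], rule exI[of _ "N \<union> A"], intro conjI ballI impI)
    show "open (N \<union> A)" "closure X \<subseteq> N \<union> A" using N oA cover by auto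
    show "Ck_on 2 (N \<union> A) \<theta>" by (rule Ck_on_Un[OF N(1) oA \<theta>N \<theta>A])
    show "\<theta> y = 1" if "y \<in> frontier X" for y using that N(2) \<zeta>0 by (auto simp: \<theta>_def pos_cube_def)
    fix y assume y: "y \<in> closure X"
    show "0 \<le> \<theta> y" by (simp add: \<theta>_def pos_cube_def)
    show "\<theta> y \<le> 1"
    proof (cases "y \<in> N")
      case True
      then have "\<zeta> y \<le> 0" using \<zeta>le y NV by auto
      then have "max 0 (1 + (1 / \<delta>) * \<zeta> y) \<le> 1" using \<delta> by (simp add: field_simps)
      then have "(max 0 (1 + (1 / \<delta>) * \<zeta> y)) ^ 3 \<le> 1" by (intro power_le_one) auto
      then show ?thesis using True by (simp add: \<theta>_def pos_cube_def)
    qed (simp add: \<theta>_def)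
    have "0 \<le> c / \<delta>" using c \<delta> by simp
    show "L \<theta> y \<le> 0"
    proof (cases "y \<in> A")
      case False
      then have "y \<in> N" using cover[OF y] by simp
      moreover have "0 \<le> 3 * (max 0 (1 + (1 / \<delta>) * \<zeta> y))\<^sup>2 * (c / \<delta>)"
        by (intro mult_nonneg_nonneg \<open>0 \<le> c / \<delta>\<close>) simp_all
      ultimately show ?thesis using LN[OF _ y] by linarith
    qed (simp add: LA)
    assume t: "1/8 \<le> \<theta> y"
    then have yN: "y \<in> N" by (cases "y \<in> N") (auto simp: \<theta>_def)
    define s where "s = max 0 (1 + (1 / \<delta>) * \<zeta> y)"
    have "(1/2) ^ 3 \<le> s ^ 3" using t yN by (simp add: \<theta>_def pos_cube_def s_def power3_eq_cube)
    moreover have "0 \<le> s" by (simp add: s_def)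
    ultimately have "1/2 \<le> s" using power_strict_mono[of s "1/2" 3] by (auto simp: not_less[symmetric])
    then have "(1/2)\<^sup>2 \<le> s\<^sup>2" by (intro power_mono) auto
    then have "3 / 4 \<le> 3 * s\<^sup>2" by (simp add: power2_eq_square)
    then have "3 / 4 * (c / \<delta>) \<le> 3 * s\<^sup>2 * (c / \<delta>)" using \<open>0 \<le> c / \<delta>\<close> by (rule mult_right_mono)
    then show "L \<theta> y \<le> - K" using LN[OF yN y] \<delta>(3) by (simp add: s_def)
  qed
qed

end

section \<open>Weak duality\<close>

lemma Ck_on_2_mult: "Ck_on 2 S f \<Longrightarrow> Ck_on 2 S g \<Longrightarrow> open S \<Longrightarrow> Ck_on 2 S (\<lambda>y. f y * g y)"
  by (erule (1) Ck_on_2E, erule (1) Ck_on_2E, rule Ck_on_2I, assumption, rule jet2_mult)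

text \<open>Gives the Stone-Weierstrass approximants of boundary data their regularity. A linear
  form is the inner product with the value of its adjoint at 1.\<close>

lemma Ck_on_2_real_polynomial_function:
  fixes f :: "real ^ 'n \<Rightarrow> real"
  assumes "real_polynomial_function f"
  shows "Ck_on 2 UNIV f"
  using assms
proof induction
  case (linear f)
  have "f = (\<lambda>y. adjoint f 1 \<bullet> y)"
    using adjoint_works[OF bounded_linear.linear[OF linear], of _ 1] by (auto simp: inner_commute)
  then show ?case using Ck_on_2I[OF open_UNIV jet2_inner[of UNIV "adjoint f 1"]] by simp
qed (simp_all add: Ck_on_2_const Ck_on_2_add Ck_on_2_mult)

lemma integrable_continuous_on_compact:
  fixes f :: "'a::euclidean_space \<Rightarrow> real"
  assumes "compact K" "finite_measure \<nu>" "sets \<nu> = sets (restrict_space borel K)" "continuous_on K f"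
  shows "integrable \<nu> f"
proof -
  interpret finite_measure \<nu> by fact
  have sp: "space \<nu> = K" using sets_eq_imp_space_eq[OF assms(3)] by (simp add: space_restrict_space)
  obtain c where c: "\<And>y. y \<in> K \<Longrightarrow> \<bar>f y\<bar> \<le> c" using compact_abs_upper_bound[OF assms(1,4)] by blast
  show ?thesis
  proof (rule integrable_const_bound)
    show "AE y in \<nu>. norm (f y) \<le> c" using c sp by (intro AE_I2) auto
    show "f \<in> borel_measurable \<nu>"
      using borel_measurable_continuous_on_restrict[OF assms(4)] measurable_cong_sets[OF assms(3) refl] by blast
  qed
qed

lemma measures_onD:
  assumes "\<mu> \<in> measures_on S"
  shows "finite_measure \<mu>" "sets \<mu> = sets (restrict_space borel S)" "space \<mu> = S"
  using assms sets_eq_imp_space_eq[of \<mu> "restrict_space borel S"]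
  by (auto simp: measures_on_def space_restrict_space)

context elliptic_domain
begin

text \<open>The subsolution \<open>v\<close> is only continuous up to the boundary. Near the boundary it is replaced by
  \<open>w = G + M (\<theta> - 1)\<close>, where the polynomial \<open>G\<close> approximates \<open>v + 2 \<epsilon>\<close> on the frontier:
  \<open>w\<close> is a subsolution where \<open>\<theta> \<ge> 1/8\<close> and lies far below \<open>v\<close> elsewhere, so a convex soft maximum
  of \<open>v\<close> and \<open>w\<close> is a subsolution that is smooth up to the boundary.\<close>

lemma subsolution_smooth_up_to_boundary:
  assumes v: "v \<in> C2_interior X" and Lv: "\<And>y. y \<in> X \<Longrightarrow> L v y \<le> 0" and \<epsilon>: "\<epsilon> > 0"
  obtains f where "f \<in> C2_closure X" "\<And>y. y \<in> X \<Longrightarrow> L f y \<le> 0" "\<And>y. y \<in> X \<Longrightarrow> v y \<le> f y"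
    "\<And>y. y \<in> frontier X \<Longrightarrow> f y \<le> v y + 3 * \<epsilon>"
proof -
  have v2: "Ck_on 2 X v" and vc: "continuous_on (closure X) v" using v by (auto simp: C2_interior_def)
  have sub: "X \<subseteq> closure X" "frontier X \<subseteq> closure X" using closure_X by auto
  have "continuous_on (frontier X) (\<lambda>y. v y + 2 * \<epsilon>)"
    by (intro continuous_intros continuous_on_subset[OF vc sub(2)])
  then obtain G where G: "real_polynomial_function G" "\<And>y. y \<in> frontier X \<Longrightarrow> \<bar>v y + 2 * \<epsilon> - G y\<bar> < \<epsilon>"
    by (rule Stone_Weierstrass_real_polynomial_function[OF compact_frontier_X _ \<epsilon>]) blast
  have G2: "Ck_on 2 UNIV G" by (rule Ck_on_2_real_polynomial_function[OF G(1)])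
  obtain \<theta> U where U: "open U" "closure X \<subseteq> U" and \<theta>2: "Ck_on 2 U \<theta>"
    and \<theta>1: "\<And>y. y \<in> frontier X \<Longrightarrow> \<theta> y = 1" and L\<theta>0: "\<And>y. y \<in> closure X \<Longrightarrow> L \<theta> y \<le> 0"
    and L\<theta>1: "\<And>y. y \<in> closure X \<Longrightarrow> 1/8 \<le> \<theta> y \<Longrightarrow> L \<theta> y \<le> - 1"
    using boundary_layer_subsolution[OF zero_less_one] by blast
  have XU: "X \<subseteq> U" using sub U by blast
  obtain C1 where C1: "C1 > 0" "\<And>y. y \<in> closure X \<Longrightarrow> \<bar>L G y\<bar> \<le> C1"
    using compact_abs_upper_bound[OF compact_closure_X continuous_on_subset[OF continuous_on_L_op[OF open_UNIV G2 cont_b cont_B] subset_UNIV]]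
    by blast
  obtain C2 where C2: "C2 > 0" "\<And>y. y \<in> closure X \<Longrightarrow> \<bar>G y\<bar> \<le> C2"
    using compact_abs_upper_bound[OF compact_closure_X continuous_on_subset[OF Ck_on_2_continuous[OF open_UNIV G2] subset_UNIV]]
    by blast
  obtain C3 where C3: "C3 > 0" "\<And>y. y \<in> closure X \<Longrightarrow> \<bar>v y\<bar> \<le> C3"
    using compact_abs_upper_bound[OF compact_closure_X vc] by blast
  \<comment> \<open>The summand \<open>C1\<close> lets M L \<theta> \<le> - M absorb
    \<open>L G\<close> where \<theta> \<ge> 1/8. Where \<theta> < 1/8 the shift M (\<theta> - 1) is
    below -(7/8) M, and the factor 8/7 makes this enough for w \<le> v - \<epsilon>.\<close>
  define M where "M = C1 + (8/7) * (C2 + C3 + \<epsilon>)"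
  have M: "M \<ge> 0" "C1 \<le> M" "(8/7) * (C2 + C3 + \<epsilon>) \<le> M" using C1 C2 C3 \<epsilon> by (auto simp: M_def)
  define w where "w y = G y + (M * \<theta> y + - M)" for y
  note GU = Ck_on_2_subset[OF open_UNIV U(1) subset_UNIV G2]
  note \<theta>M = Ck_on_2_scale[OF U(1) \<theta>2, of M]
  note \<theta>MM = Ck_on_2_add[OF U(1) \<theta>M Ck_on_2_const[OF U(1), of "- M"]]
  have w2: "Ck_on 2 U w" unfolding w_def by (rule Ck_on_2_add[OF U(1) GU \<theta>MM])
  have Lw: "L w y = L G y + M * L \<theta> y" if "y \<in> closure X" for y
  proof -
    have yU: "y \<in> U" using that U by blast
    show ?thesis unfolding w_def
      by (simp only: L_op_add[OF U(1) GU \<theta>MM yU] L_op_add[OF U(1) \<theta>M Ck_on_2_const[OF U(1)] yU]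
          L_op_scale[OF U(1) \<theta>2 yU] L_op_const add_0_right)
  qed
  have Lw0: "L w y \<le> 0" if "y \<in> closure X" "1/8 \<le> \<theta> y" for y
  proof -
    have "M * L \<theta> y \<le> M * (- 1)" by (intro mult_left_mono L\<theta>1 that M)
    then show ?thesis using C1(2)[OF that(1)] M(2) unfolding Lw[OF that(1)] by (simp add: abs_le_iff)
  qed
  have wv: "w y - v y \<le> - \<epsilon>" if "y \<in> closure X" "\<theta> y < 1/8" for y
  proof -
    have "M * \<theta> y \<le> M * (1/8)" using that by (intro mult_left_mono M) auto
    then show ?thesis using C2(2)[OF that(1)] C3(2)[OF that(1)] M(3) by (simp add: w_def abs_le_iff)
  qed
  have wG: "w y = G y" if "y \<in> frontier X" for y using \<theta>1[OF that] by (simp add: w_def)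
  define h where "h y = (1 / \<epsilon>) * (w y + - 1 * v y)" for y
  \<comment> \<open>With h = (w - v)/\<epsilon> this is \<open>v\<close> where w \<le> v -
    \<epsilon> and \<open>w\<close> where w \<ge> v + \<epsilon>. Outside \<open>X\<close>, where no
    regularity of \<open>v\<close> is available, the formula for \<open>w\<close> is used.\<close>
  define f where "f y = (if y \<in> X then v y + \<epsilon> * soft_pos (h y) else w y)" for y
  note wX = Ck_on_2_subset[OF U(1) open_X XU w2]
  note vX = Ck_on_2_scale[OF open_X v2, of "- 1"]
  note wvX = Ck_on_2_add[OF open_X wX vX]
  have h2: "Ck_on 2 X h" unfolding h_def by (rule Ck_on_2_scale[OF open_X wvX])
  obtain hG hH where j: "jet2 X h hG hH" using Ck_on_2E[OF h2 open_X] .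
  have sp2: "Ck_on 2 X (\<lambda>y. soft_pos (h y))"
    by (rule Ck_on_2I[OF open_X jet2_compose[OF j soft_pos_derivatives]])
  note spX = Ck_on_2_scale[OF open_X sp2, of \<epsilon>]
  have f_X: "Ck_on 2 X f"
    by (rule Ck_on_2_cong[OF open_X Ck_on_2_add[OF open_X v2 spX]]) (simp add: f_def)
  have Lf: "L f y \<le> 0" if y: "y \<in> X" for y
  proof -
    have ycl: "y \<in> closure X" using y sub by blast
    have Lh: "L h y = (1 / \<epsilon>) * (L w y + - 1 * L v y)" unfolding h_def
      by (simp only: L_op_scale[OF open_X wvX y] L_op_add[OF open_X wX vX y] L_op_scale[OF open_X v2 y])
    have "L f y = L (\<lambda>y. v y + \<epsilon> * soft_pos (h y)) y"
      by (rule L_op_cong[OF open_X y]) (simp add: f_def)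
    also have "\<dots> = L v y + \<epsilon> * L (\<lambda>y. soft_pos (h y)) y"
      by (simp only: L_op_add[OF open_X v2 spX y] L_op_scale[OF open_X sp2 y])
    also have "\<dots> \<le> L v y + \<epsilon> * (soft_pos' (h y) * L h y)"
    proof -
      have "L (\<lambda>y. soft_pos (h y)) y \<le> soft_pos' (h y) * L h y"
        unfolding L_op_compose[OF open_X j y soft_pos_derivatives]
        using mult_nonneg_nonneg[OF soft_pos''_nonneg[of "h y"] diffusion_matrix_outer_nonneg[of B y "hG y"]] by simp
      then show ?thesis using \<epsilon> by (simp add: mult_left_mono)
    qed
    \<comment> \<open>The scale \<epsilon> cancels against the factor 1/\<epsilon> in
      \<open>h\<close>, leaving a convex combination. Its second term disappears exactly where
      \<open>w\<close> is not known to be a subsolution.\<close>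
    also have "\<dots> = (1 - soft_pos' (h y)) * L v y + soft_pos' (h y) * L w y"
      unfolding Lh using \<epsilon> by (simp add: field_simps)
    also have "\<dots> \<le> 0"
    proof (cases "1/8 \<le> \<theta> y")
      case True
      then show ?thesis using soft_pos'_bounds[of "h y"] Lw0[OF ycl True] Lv[OF y]
        by (intro add_nonpos_nonpos mult_nonneg_nonpos) auto
    next
      case False
      then have "h y \<le> - 1" using wv[OF ycl] \<epsilon> by (simp add: h_def field_simps)
      then show ?thesis using Lv[OF y] by (simp add: soft_pos'_eq_0)
    qed
    finally show ?thesis .
  qed
  \<comment> \<open>The condition w - v > \<epsilon> is relatively open in the closed domain and
    holds on the frontier. On the resulting neighbourhood \<open>f\<close> is \<open>w\<close> on
    both sides of the frontier, hence C^2 across it.\<close>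
  have wvc: "continuous_on (closure X) (\<lambda>y. w y - v y)"
    by (intro continuous_intros vc continuous_on_subset[OF Ck_on_2_continuous[OF U(1) w2] U(2)])
  then obtain N where N: "open N" "N \<inter> closure X = (\<lambda>y. w y - v y) -` {\<epsilon><..} \<inter> closure X"
    unfolding continuous_on_open_invariant using open_greaterThan by meson
  have oNU: "open (N \<inter> U)" using N U by blast
  have fN: "f y = w y" if y: "y \<in> N \<inter> U" for y
  proof (cases "y \<in> X")
    case True
    then have "y \<in> N \<inter> closure X" using y sub by blast
    then have "\<epsilon> < w y - v y" unfolding N(2) by simp
    then have "1 \<le> h y" using \<epsilon> by (simp add: h_def field_simps)
    then have "soft_pos (h y) = h y" by (rule soft_pos_eq_self)
    then show ?thesis using True \<epsilon> by (simp add: f_def h_def)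
  qed (simp add: f_def)
  have f_N: "Ck_on 2 (N \<inter> U) f"
    by (rule Ck_on_2_cong[OF oNU Ck_on_2_subset[OF U(1) oNU _ w2] fN]) auto
  have "frontier X \<subseteq> N \<inter> U"
  proof
    fix y assume y: "y \<in> frontier X"
    then have "\<epsilon> < w y - v y" using G(2)[OF y] wG[OF y] by linarith
    then have "y \<in> N \<inter> closure X" unfolding N(2) using y sub by auto
    then show "y \<in> N \<inter> U" using U by blast
  qed
  then have cl: "closure X \<subseteq> X \<union> (N \<inter> U)" using closure_X by blast
  show ?thesis
  proof (rule that[of f])
    show "f \<in> C2_closure X"
      by (rule C2_closureI[OF open_X open_Un[OF open_X oNU] cl Ck_on_Un[OF open_X oNU f_X f_N]])
    show "v y \<le> f y" if "y \<in> X" for y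
      using that \<epsilon> soft_pos_nonneg[of "h y"] by (simp add: f_def)
    show "f y \<le> v y + 3 * \<epsilon>" if y: "y \<in> frontier X" for y
    proof -
      have "y \<notin> X" using y frontier_X by blast
      then show ?thesis using G(2)[OF y] wG[OF y] unfolding f_def by (simp add: abs_less_iff)
    qed
  qed (rule Lf)
qed

text \<open>The usual computation v x \<le> f x = \<integral>f d\<nu> + \<integral>L f d\<mu> \<le>
  \<integral>g d\<nu> is carried out for the smoothed subsolution \<open>f\<close>. The excess over
  \<open>g\<close> on the frontier costs 3 \<epsilon> times the mass of \<nu>, which is arbitrarily
  small.\<close>

lemma weak_duality:
  assumes v: "v \<in> dual_feasible X b B g" and \<mu>\<nu>: "(\<mu>, \<nu>) \<in> primal_feasible X b B x"
    and x: "x \<in> X" and g: "continuous_on (frontier X) g"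
  shows "v x \<le> (\<integral>y. g y \<partial>\<nu>)"
proof (rule field_le_epsilon)
  fix e :: real assume e: "e > 0"
  have v2: "v \<in> C2_interior X" and Lv: "\<And>y. y \<in> X \<Longrightarrow> L v y \<le> 0" and vg: "\<And>y. y \<in> frontier X \<Longrightarrow> v y \<le> g y"
    using v by (auto simp: dual_feasible_def)
  have \<mu>: "\<mu> \<in> measures_on X" and \<nu>: "\<nu> \<in> measures_on (frontier X)"
    and eq: "\<And>f. f \<in> C2_closure X \<Longrightarrow> (\<integral>y. f y \<partial>\<nu>) + (\<integral>y. L f y \<partial>\<mu>) = f x"
    using \<mu>\<nu> by (auto simp: primal_feasible_def)
  interpret \<nu>: finite_measure \<nu> by (rule measures_onD(1)[OF \<nu>])
  define m where "m = measure \<nu> (space \<nu>)"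
  have m: "m \<ge> 0" by (simp add: m_def)
  \<comment> \<open>Chosen so that 3 \<epsilon> m \<le> e; the added 1 avoids division by zero when
    \<nu> has no mass.\<close>
  define \<epsilon> where "\<epsilon> = e / (3 * (m + 1))"
  have \<epsilon>: "\<epsilon> > 0" using e m by (simp add: \<epsilon>_def)
  obtain f where f: "f \<in> C2_closure X" and Lf: "\<And>y. y \<in> X \<Longrightarrow> L f y \<le> 0" and vf: "\<And>y. y \<in> X \<Longrightarrow> v y \<le> f y"
    and fv: "\<And>y. y \<in> frontier X \<Longrightarrow> f y \<le> v y + 3 * \<epsilon>"
    using subsolution_smooth_up_to_boundary[OF v2 Lv \<epsilon>] by blast
  have int: "integrable \<nu> h" if "continuous_on (frontier X) h" for h :: "real ^ 'n \<Rightarrow> real"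
    by (rule integrable_continuous_on_compact[OF compact_frontier_X measures_onD(1,2)[OF \<nu>] that])
  have fc: "continuous_on (frontier X) f"
    using f closure_X by (auto simp: C2_closure_def intro: continuous_on_subset)
  have "v x \<le> f x" by (rule vf[OF x])
  also have "\<dots> = (\<integral>y. f y \<partial>\<nu>) + (\<integral>y. L f y \<partial>\<mu>)" by (rule eq[OF f, symmetric])
  also have "(\<integral>y. L f y \<partial>\<mu>) \<le> 0"
  proof -
    have "0 \<le> (\<integral>y. - L f y \<partial>\<mu>)"
      using Lf measures_onD(3)[OF \<mu>] by (intro integral_nonneg_AE AE_I2) auto
    then show ?thesis by simp
  qed
  also have "(\<integral>y. f y \<partial>\<nu>) \<le> (\<integral>y. g y + 3 * \<epsilon> \<partial>\<nu>)"
  proof (rule integral_mono)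
    show "integrable \<nu> f" by (rule int[OF fc])
    show "integrable \<nu> (\<lambda>y. g y + 3 * \<epsilon>)" by (intro int continuous_intros g)
    fix y assume "y \<in> space \<nu>"
    then have "y \<in> frontier X" using measures_onD(3)[OF \<nu>] by simp
    then show "f y \<le> g y + 3 * \<epsilon>" using fv vg by fastforce
  qed
  also have "(\<integral>y. g y + 3 * \<epsilon> \<partial>\<nu>) = (\<integral>y. g y \<partial>\<nu>) + 3 * \<epsilon> * m"
    using int[OF g] by (simp add: m_def)
  also have "3 * \<epsilon> * m = e * (m / (m + 1))" using m by (simp add: \<epsilon>_def divide_simps) (simp add: algebra_simps)?
  also have "\<dots> \<le> e * 1" using e m by (intro mult_left_mono) auto
  finally show "v x \<le> (\<integral>y. g y \<partial>\<nu>) + e" by simp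
qed

end

section \<open>Dominated extension and the Riesz representation\<close>

text \<open>The set \<open>E\<close> of real functions plays the part of a vector space. Homogeneity
  is required only as an inequality for positive factors; applying it to the inverse factor gives
  equality.\<close>

definition sublinear_on :: "('k \<Rightarrow> real) set \<Rightarrow> (('k \<Rightarrow> real) \<Rightarrow> real) \<Rightarrow> bool" where
  "sublinear_on E p \<longleftrightarrow>
     (\<forall>\<phi>\<in>E. \<forall>\<psi>\<in>E. p (\<lambda>k. \<phi> k + \<psi> k) \<le> p \<phi> + p \<psi>) \<and>
     (\<forall>\<phi>\<in>E. \<forall>c>0. p (\<lambda>k. c * \<phi> k) \<le> c * p \<phi>) \<and> p (\<lambda>_. 0) = 0"

lemma sublinear_onI:
  assumes "\<And>\<phi> \<psi>. \<phi> \<in> E \<Longrightarrow> \<psi> \<in> E \<Longrightarrow> p (\<lambda>k. \<phi> k + \<psi> k) \<le> p \<phi> + p \<psi>"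
    and "\<And>\<phi> c. \<phi> \<in> E \<Longrightarrow> c > 0 \<Longrightarrow> p (\<lambda>k. c * \<phi> k) \<le> c * p \<phi>"
    and "p (\<lambda>_. 0) = 0"
  shows "sublinear_on E p"
  using assms by (auto simp: sublinear_on_def)

lemma sublinear_on_add: "sublinear_on E p \<Longrightarrow> \<phi> \<in> E \<Longrightarrow> \<psi> \<in> E \<Longrightarrow> p (\<lambda>k. \<phi> k + \<psi> k) \<le> p \<phi> + p \<psi>"
  by (auto simp: sublinear_on_def)

lemma sublinear_on_0: "sublinear_on E p \<Longrightarrow> p (\<lambda>_. 0) = 0"
  by (auto simp: sublinear_on_def)

lemma sublinear_on_scale:
  assumes p: "sublinear_on E p" and E: "\<And>\<phi> c. \<phi> \<in> E \<Longrightarrow> (\<lambda>k. c * \<phi> k) \<in> E"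
    and "\<phi> \<in> E" "c \<ge> 0"
  shows "p (\<lambda>k. c * \<phi> k) = c * p \<phi>"
proof (cases "c = 0")
  case True
  then show ?thesis using sublinear_on_0[OF p] by simp
next
  case False
  with assms have c: "c > 0" by simp
  have 1: "p (\<lambda>k. c * \<phi> k) \<le> c * p \<phi>"
    using p c assms by (auto simp: sublinear_on_def)
  have "p (\<lambda>k. inverse c * (c * \<phi> k)) \<le> inverse c * p (\<lambda>k. c * \<phi> k)"
    using p c E[OF assms(3), of c] by (auto simp: sublinear_on_def)
  moreover have "(\<lambda>k. inverse c * (c * \<phi> k)) = \<phi>" using c by auto
  ultimately have "p \<phi> \<le> inverse c * p (\<lambda>k. c * \<phi> k)" by simp
  then have "c * p \<phi> \<le> p (\<lambda>k. c * \<phi> k)" using c by (simp add: field_simps)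
  with 1 show ?thesis by simp
qed

lemma sublinear_on_minus:
  assumes p: "sublinear_on E p" and E: "\<And>\<phi> c. \<phi> \<in> E \<Longrightarrow> (\<lambda>k. c * \<phi> k) \<in> E" and "\<phi> \<in> E"
  shows "- p (\<lambda>k. - \<phi> k) \<le> p \<phi>"
proof -
  have "(\<lambda>k. - \<phi> k) \<in> E" using E[OF assms(3), of "-1"] by simp
  from sublinear_on_add[OF p assms(3) this] sublinear_on_0[OF p] show ?thesis by simp
qed

text \<open>Zorn's lemma, downwards. The infimum over a chain is finite because every q below p
  satisfies - p(-\<phi>) \<le> q \<phi>, and it is subadditive because two members of a chain can be
  replaced by the smaller one.\<close>

lemma minimal_sublinear_exists:
  fixes p :: "('k \<Rightarrow> real) \<Rightarrow> real"
  assumes E0: "(\<lambda>_. 0) \<in> E"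
    and Ea: "\<And>\<phi> \<psi>. \<phi> \<in> E \<Longrightarrow> \<psi> \<in> E \<Longrightarrow> (\<lambda>k. \<phi> k + \<psi> k) \<in> E"
    and Es: "\<And>\<phi> c. \<phi> \<in> E \<Longrightarrow> (\<lambda>k. c * \<phi> k) \<in> E"
    and p: "sublinear_on E p"
  shows "\<exists>m. sublinear_on E m \<and> (\<forall>\<phi>\<in>E. m \<phi> \<le> p \<phi>) \<and>
    (\<forall>r. sublinear_on E r \<longrightarrow> (\<forall>\<phi>\<in>E. r \<phi> \<le> m \<phi>) \<longrightarrow> (\<forall>\<phi>\<in>E. r \<phi> = m \<phi>))"
proof -
  \<comment> \<open>Values outside \<open>E\<close> are pinned to 0, so that the order of functions
    compares the candidates on \<open>E\<close> only.\<close>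
  define S where "S = {q. sublinear_on E q \<and> (\<forall>\<phi>\<in>E. q \<phi> \<le> p \<phi>) \<and> (\<forall>\<phi>. \<phi> \<notin> E \<longrightarrow> q \<phi> = 0)}"
  \<comment> \<open>Reversed order: \<open>predicate_Zorn\<close> yields maximal elements, and a
    minimal one is wanted.\<close>
  define P where "P = (\<lambda>q r :: ('k \<Rightarrow> real) \<Rightarrow> real. r \<le> q)"
  have restrict: "(\<lambda>\<phi>. if \<phi> \<in> E then q \<phi> else 0) \<in> S"
    if "sublinear_on E q" "\<And>\<phi>. \<phi> \<in> E \<Longrightarrow> q \<phi> \<le> p \<phi>" for q
    using that E0 Ea Es by (auto simp: S_def sublinear_on_def)
  have Sle: "q \<phi> \<le> p \<phi>" if "q \<in> S" "\<phi> \<in> E" for q \<phi>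
    using that by (simp add: S_def)
  have S0: "q \<phi> = 0" if "q \<in> S" "\<phi> \<notin> E" for q \<phi>
    using that by (simp add: S_def)
  have lower: "- p (\<lambda>k. - \<phi> k) \<le> q \<phi>" if "q \<in> S" "\<phi> \<in> E" for q \<phi>
  proof -
    have "(\<lambda>k. - \<phi> k) \<in> E" using Es[OF that(2), of "-1"] by simp
    then have "q (\<lambda>k. - \<phi> k) \<le> p (\<lambda>k. - \<phi> k)" using that by (auto simp: S_def)
    moreover have "- q (\<lambda>k. - \<phi> k) \<le> q \<phi>"
      using that by (intro sublinear_on_minus[OF _ Es]) (auto simp: S_def)
    ultimately show ?thesis by linarith
  qed
  have "\<exists>m\<in>S. \<forall>a\<in>S. P m a \<longrightarrow> a = m"
  proof (rule predicate_Zorn)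
    show "partial_order_on S (relation_of P S)"
      by (rule partial_order_on_relation_ofI) (auto simp: P_def)
    fix C assume C: "C \<in> Chains (relation_of P S)"
    then have CS: "C \<subseteq> S" by (auto simp: Chains_def relation_of_def)
    have tot: "a \<le> b \<or> b \<le> a" if "a \<in> C" "b \<in> C" for a b
      using C that by (auto simp: Chains_def relation_of_def P_def)
    show "\<exists>u\<in>S. \<forall>a\<in>C. P a u"
    proof (cases "C = {}")
      case True
      then show ?thesis using restrict[OF p] by auto
    next
      case ne: False
      define u where "u = (\<lambda>\<phi>. INF q\<in>C. q \<phi>)"
      have bdd: "bdd_below ((\<lambda>q. q \<phi>) ` C)" if "\<phi> \<in> E" for \<phi>
        using lower that CS by (intro bdd_belowI2[where m="- p (\<lambda>k. - \<phi> k)"]) auto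
      have ule: "u \<phi> \<le> q \<phi>" if "\<phi> \<in> E" "q \<in> C" for \<phi> q
        unfolding u_def using bdd that by (intro cINF_lower) auto
      have uge: "c \<le> u \<phi>" if "\<And>q. q \<in> C \<Longrightarrow> c \<le> q \<phi>" for \<phi> c
        unfolding u_def using ne that by (intro cINF_greatest) auto
      have sub: "sublinear_on E u"
      proof (rule sublinear_onI)
        fix \<phi> \<psi> assume E: "\<phi> \<in> E" "\<psi> \<in> E"
        have "u (\<lambda>k. \<phi> k + \<psi> k) \<le> q \<phi> + r \<psi>" if qr: "q \<in> C" "r \<in> C" for q r
        proof -
          obtain s where s: "s \<in> C" "s \<le> q" "s \<le> r" using tot[OF qr] qr by blast
          have "u (\<lambda>k. \<phi> k + \<psi> k) \<le> s (\<lambda>k. \<phi> k + \<psi> k)" using ule Ea E s by auto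
          also have "\<dots> \<le> s \<phi> + s \<psi>" using s CS E by (intro sublinear_on_add[of E]) (auto simp: S_def)
          also have "\<dots> \<le> q \<phi> + r \<psi>" using s by (intro add_mono) (auto simp: le_fun_def)
          finally show ?thesis .
        qed
        note step = this
        have step2: "u (\<lambda>k. \<phi> k + \<psi> k) - q \<phi> \<le> u \<psi>" if "q \<in> C" for q
          by (rule uge) (use step[OF that] in \<open>fastforce simp: diff_le_eq add.commute\<close>)
        have "u (\<lambda>k. \<phi> k + \<psi> k) - u \<psi> \<le> u \<phi>"
          by (rule uge) (use step2 in \<open>fastforce simp: diff_le_eq add.commute\<close>)
        then show "u (\<lambda>k. \<phi> k + \<psi> k) \<le> u \<phi> + u \<psi>" by simp
      next
        fix \<phi> and c :: real assume E: "\<phi> \<in> E" "c > 0"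
        have "u (\<lambda>k. c * \<phi> k) / c \<le> q \<phi>" if "q \<in> C" for q
        proof -
          have "u (\<lambda>k. c * \<phi> k) \<le> q (\<lambda>k. c * \<phi> k)" using ule Es E that by auto
          also have "\<dots> = c * q \<phi>"
            using that CS E Es by (intro sublinear_on_scale[of E]) (auto simp: S_def)
          finally show ?thesis using E by (simp add: field_simps)
        qed
        then have "u (\<lambda>k. c * \<phi> k) / c \<le> u \<phi>" by (rule uge)
        then show "u (\<lambda>k. c * \<phi> k) \<le> c * u \<phi>" using E by (simp add: field_simps)
      next
        have "q (\<lambda>_. 0) = 0" if "q \<in> C" for q
          using that CS by (auto simp: S_def sublinear_on_def)
        then have "(\<lambda>q. q (\<lambda>_. 0)) ` C = {0}" using ne by (auto simp: image_iff)
        then show "u (\<lambda>_. 0) = 0" unfolding u_def by simp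
      qed
      have le: "u \<phi> \<le> p \<phi>" if "\<phi> \<in> E" for \<phi>
      proof -
        obtain q where "q \<in> C" using ne by blast
        then show ?thesis using ule[OF that \<open>q \<in> C\<close>] Sle[of q] CS that by fastforce
      qed
      have "(\<lambda>\<phi>. if \<phi> \<in> E then u \<phi> else 0) \<in> S" using restrict[OF sub le] .
      moreover have "P a (\<lambda>\<phi>. if \<phi> \<in> E then u \<phi> else 0)" if "a \<in> C" for a
      proof -
        have "a \<in> S" using that CS by blast
        show ?thesis unfolding P_def le_fun_def
        proof
          fix \<phi>
          show "(if \<phi> \<in> E then u \<phi> else 0) \<le> a \<phi>"
            by (cases "\<phi> \<in> E") (simp_all add: ule that S0[OF \<open>a \<in> S\<close>])
        qed
      qed
      ultimately show ?thesis by blast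
    qed
  qed
  then obtain m where m: "m \<in> S" and min: "\<And>a. a \<in> S \<Longrightarrow> a \<le> m \<Longrightarrow> a = m" by (auto simp: P_def)
  show ?thesis
  proof (intro exI[of _ m] conjI allI impI ballI)
    fix r \<phi> assume r: "sublinear_on E r" "\<forall>\<phi>\<in>E. r \<phi> \<le> m \<phi>" and "\<phi> \<in> E"
    have rm: "r \<phi> \<le> m \<phi>" if "\<phi> \<in> E" for \<phi> using r(2) that ..
    have "(\<lambda>\<phi>. if \<phi> \<in> E then r \<phi> else 0) \<in> S"
      by (rule restrict[OF r(1)]) (rule order_trans[OF rm Sle[OF m]])
    then have "(\<lambda>\<phi>. if \<phi> \<in> E then r \<phi> else 0) = m"
      by (rule min) (simp add: le_fun_def rm S0[OF m])
    from fun_cong[OF this, of \<phi>] show "r \<phi> = m \<phi>" using \<open>\<phi> \<in> E\<close> by simp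
  next
    show "sublinear_on E m" using m by (simp add: S_def)
  qed (rule Sle[OF m])
qed

text \<open>Replacing \<open>m\<close> by \<open>\<phi> \<mapsto> inf\<^sub>t (m (\<phi> + t \<psi>) - t m \<psi>)\<close> shows that a minimal sublinear functional is linear.\<close>

theorem hahn_banach_sublinear:
  fixes p :: "('k \<Rightarrow> real) \<Rightarrow> real"
  assumes E0: "(\<lambda>_. 0) \<in> E"
    and Ea: "\<And>\<phi> \<psi>. \<phi> \<in> E \<Longrightarrow> \<psi> \<in> E \<Longrightarrow> (\<lambda>k. \<phi> k + \<psi> k) \<in> E"
    and Es: "\<And>\<phi> c. \<phi> \<in> E \<Longrightarrow> (\<lambda>k. c * \<phi> k) \<in> E"
    and p: "sublinear_on E p"
  obtains l where "\<And>\<phi> \<psi>. \<phi> \<in> E \<Longrightarrow> \<psi> \<in> E \<Longrightarrow> l (\<lambda>k. \<phi> k + \<psi> k) = l \<phi> + l \<psi>"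
    "\<And>\<phi> c. \<phi> \<in> E \<Longrightarrow> l (\<lambda>k. c * \<phi> k) = c * l \<phi>" "\<And>\<phi>. \<phi> \<in> E \<Longrightarrow> l \<phi> \<le> p \<phi>"
proof -
  have "\<exists>m. sublinear_on E m \<and> (\<forall>\<phi>\<in>E. m \<phi> \<le> p \<phi>) \<and>
    (\<forall>r. sublinear_on E r \<longrightarrow> (\<forall>\<phi>\<in>E. r \<phi> \<le> m \<phi>) \<longrightarrow> (\<forall>\<phi>\<in>E. r \<phi> = m \<phi>))"
    by (rule minimal_sublinear_exists[OF E0 Ea Es p]; assumption)
  then obtain m where m: "sublinear_on E m" and mp': "\<forall>\<phi>\<in>E. m \<phi> \<le> p \<phi>" and
    min: "\<forall>r. sublinear_on E r \<longrightarrow> (\<forall>\<phi>\<in>E. r \<phi> \<le> m \<phi>) \<longrightarrow> (\<forall>\<phi>\<in>E. r \<phi> = m \<phi>)"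
    by (elim exE conjE)
  have mp: "m \<phi> \<le> p \<phi>" if "\<phi> \<in> E" for \<phi> using mp' that ..
  have add: "m (\<lambda>k. \<phi> k + \<psi> k) = m \<phi> + m \<psi>" if \<phi>: "\<phi> \<in> E" and \<psi>: "\<psi> \<in> E" for \<phi> \<psi>
  proof -
    define h where "h = (\<lambda>\<phi> t. m (\<lambda>k. \<phi> k + t * \<psi> k) - t * m \<psi>)"
    \<comment> \<open>At t = 0 the quantity is \<open>m \<phi>\<close>, so r \<le> m and minimality
      forces r = m. Comparison with t = 1 then gives m \<phi> + m \<psi> \<le> m (\<phi> + \<psi>),
      the half of additivity that sublinearity lacks.\<close>
    define r where "r = (\<lambda>\<phi>. INF t\<in>{0::real..}. h \<phi> t)"
    have lower: "- m (\<lambda>k. - \<xi> k) \<le> h \<xi> t" if "\<xi> \<in> E" "t \<ge> 0" for \<xi> t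
    proof -
      have E: "(\<lambda>k. - \<xi> k) \<in> E" "(\<lambda>k. \<xi> k + t * \<psi> k) \<in> E"
        using Es[OF that(1), of "-1"] Ea[OF that(1) Es[OF \<psi>]] by simp_all
      have "t * m \<psi> = m (\<lambda>k. t * \<psi> k)" using sublinear_on_scale[OF m Es \<psi> that(2)] by simp
      also have "\<dots> = m (\<lambda>k. - \<xi> k + (\<xi> k + t * \<psi> k))" by simp
      also have "\<dots> \<le> m (\<lambda>k. - \<xi> k) + m (\<lambda>k. \<xi> k + t * \<psi> k)"
        by (rule sublinear_on_add[OF m E])
      finally show ?thesis by (simp add: h_def)
    qed
    have bdd: "bdd_below (h \<xi> ` {0..})" if "\<xi> \<in> E" for \<xi>
      using lower[OF that] by (intro bdd_belowI2[where m="- m (\<lambda>k. - \<xi> k)"]) auto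
    have rle: "r \<xi> \<le> h \<xi> t" if "\<xi> \<in> E" "t \<ge> 0" for \<xi> t
      unfolding r_def using bdd that by (intro cINF_lower) auto
    have rge: "c \<le> r \<xi>" if "\<And>t. t \<ge> 0 \<Longrightarrow> c \<le> h \<xi> t" for \<xi> c
      unfolding r_def using that by (intro cINF_greatest) auto
    have "sublinear_on E r"
    proof (rule sublinear_onI)
      fix \<phi>1 \<phi>2 assume E: "\<phi>1 \<in> E" "\<phi>2 \<in> E"
      have "r (\<lambda>k. \<phi>1 k + \<phi>2 k) \<le> h \<phi>1 s + h \<phi>2 t" if "s \<ge> 0" "t \<ge> 0" for s t
      proof -
        have "r (\<lambda>k. \<phi>1 k + \<phi>2 k) \<le> h (\<lambda>k. \<phi>1 k + \<phi>2 k) (s + t)"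
          using rle Ea E that by auto
        also have "\<dots> = m (\<lambda>k. (\<phi>1 k + s * \<psi> k) + (\<phi>2 k + t * \<psi> k)) - (s + t) * m \<psi>"
          by (simp add: h_def algebra_simps)
        also have "\<dots> \<le> h \<phi>1 s + h \<phi>2 t"
          using sublinear_on_add[OF m Ea[OF E(1) Es[OF \<psi>, of s]] Ea[OF E(2) Es[OF \<psi>, of t]]]
          by (simp add: h_def algebra_simps)
        finally show ?thesis .
      qed
      note step = this
      have step2: "r (\<lambda>k. \<phi>1 k + \<phi>2 k) - h \<phi>1 s \<le> r \<phi>2" if "s \<ge> 0" for s
        by (rule rge) (use step[OF that] in \<open>fastforce simp: diff_le_eq add.commute\<close>)
      have "r (\<lambda>k. \<phi>1 k + \<phi>2 k) - r \<phi>2 \<le> r \<phi>1"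
        by (rule rge) (use step2 in \<open>fastforce simp: diff_le_eq add.commute\<close>)
      then show "r (\<lambda>k. \<phi>1 k + \<phi>2 k) \<le> r \<phi>1 + r \<phi>2" by simp
    next
      fix \<xi> and c :: real assume E: "\<xi> \<in> E" "c > 0"
      have "r (\<lambda>k. c * \<xi> k) / c \<le> h \<xi> t" if "t \<ge> 0" for t
      proof -
        have "r (\<lambda>k. c * \<xi> k) \<le> h (\<lambda>k. c * \<xi> k) (c * t)" using rle Es E that by auto
        also have "\<dots> = m (\<lambda>k. c * (\<xi> k + t * \<psi> k)) - c * (t * m \<psi>)"
          by (simp add: h_def algebra_simps)
        also have "\<dots> = c * h \<xi> t"
          using sublinear_on_scale[OF m Es Ea[OF E(1) Es[OF \<psi>, of t]], of c] E
          by (simp add: h_def algebra_simps)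
        finally show ?thesis using E by (simp add: field_simps)
      qed
      then have "r (\<lambda>k. c * \<xi> k) / c \<le> r \<xi>" by (rule rge)
      then show "r (\<lambda>k. c * \<xi> k) \<le> c * r \<xi>" using E by (simp add: field_simps)
    next
      have "h (\<lambda>_. 0) t = 0" if "t \<ge> 0" for t
        using sublinear_on_scale[OF m Es \<psi> that] by (simp add: h_def)
      then have "h (\<lambda>_. 0) ` {0..} = {0}" by (auto simp: image_iff)
      then show "r (\<lambda>_. 0) = 0" by (simp add: r_def)
    qed
    moreover have "r \<xi> \<le> m \<xi>" if "\<xi> \<in> E" for \<xi>
      using rle[OF that, of 0] by (simp add: h_def)
    ultimately have "r \<phi> = m \<phi>" using min \<phi> by blast
    then have "m \<phi> \<le> h \<phi> 1" using rle[OF \<phi>, of 1] by simp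
    then show ?thesis using sublinear_on_add[OF m \<phi> \<psi>] by (simp add: h_def)
  qed
  have neg: "m (\<lambda>k. - \<phi> k) = - m \<phi>" if "\<phi> \<in> E" for \<phi>
    using add[OF that, of "\<lambda>k. - \<phi> k"] Es[OF that, of "-1"] sublinear_on_0[OF m] by simp
  have scale: "m (\<lambda>k. c * \<phi> k) = c * m \<phi>" if "\<phi> \<in> E" for \<phi> c
  proof (cases "c \<ge> 0")
    case True
    then show ?thesis using sublinear_on_scale[OF m Es that] by simp
  next
    case False
    then have "m (\<lambda>k. - ((- c) * \<phi> k)) = - ((- c) * m \<phi>)"
      using neg[OF Es[OF that, of "-c"]] sublinear_on_scale[OF m Es that, of "-c"] by simp
    then show ?thesis by simp
  qed
  show ?thesis by (rule that[OF add scale mp])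
qed

section \<open>The Riesz representation on a compact set\<close>

text \<open>The functional is defined on every bounded function, so a set is charged through its
  indicator directly instead of through continuous functions above or below it. Monotonicity refers
  to \<open>C\<close> only, hence values off \<open>C\<close> do not matter.\<close>

locale positive_functional =
  fixes C :: "'a::euclidean_space set" and l :: "('a \<Rightarrow> real) \<Rightarrow> real"
  assumes compact_C: "compact C"
    and l_add: "\<And>\<phi> \<psi>. bounded (\<phi> ` C) \<Longrightarrow> bounded (\<psi> ` C) \<Longrightarrow> l (\<lambda>y. \<phi> y + \<psi> y) = l \<phi> + l \<psi>"
    and l_scale: "\<And>\<phi> c. bounded (\<phi> ` C) \<Longrightarrow> l (\<lambda>y. c * \<phi> y) = c * l \<phi>"
    and l_mono: "\<And>\<phi> \<psi>. bounded (\<phi> ` C) \<Longrightarrow> bounded (\<psi> ` C) \<Longrightarrow> (\<And>y. y \<in> C \<Longrightarrow> \<phi> y \<le> \<psi> y) \<Longrightarrow> l \<phi> \<le> l \<psi>"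
begin

definition charge :: "'a set \<Rightarrow> real" where
  "charge A = l (indicator A)"

text \<open>The charge is only finitely additive; compactness makes it countably additive on the sets that
  it measures regularly from both sides (Alexandroff).\<close>

definition regular_sets :: "'a set set" where
  "regular_sets = {A. A \<subseteq> C \<and> A \<in> sets borel \<and>
     (\<forall>\<epsilon>>0. \<exists>D U. compact D \<and> D \<subseteq> A \<and> open U \<and> A \<subseteq> U \<and> charge (U - D) < \<epsilon>)}"

lemma bounded_indicator: "bounded ((indicator A :: 'a \<Rightarrow> real) ` S)"
  by (rule bounded_subset[of "{0, 1}"]) (auto simp: indicator_def)

lemma bounded_const_image: "bounded ((\<lambda>_. c :: real) ` S)"
  by (rule bounded_subset[of "{c}"]) auto

lemma l_cong: "bounded (\<phi> ` C) \<Longrightarrow> (\<And>y. y \<in> C \<Longrightarrow> \<phi> y = \<psi> y) \<Longrightarrow> l \<phi> = l \<psi>"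
proof -
  assume a: "bounded (\<phi> ` C)" "\<And>y. y \<in> C \<Longrightarrow> \<phi> y = \<psi> y"
  then have "\<phi> ` C = \<psi> ` C" by auto
  then show ?thesis using a by (intro antisym l_mono) auto
qed

lemma l_0: "l (\<lambda>_. 0) = 0"
  using l_scale[OF bounded_const_image, of 0 0] by simp

lemma charge_mono: "A \<inter> C \<subseteq> B \<Longrightarrow> charge A \<le> charge B"
  unfolding charge_def by (intro l_mono bounded_indicator) (auto simp: indicator_def)

lemma charge_empty [simp]: "charge {} = 0"
proof -
  have "indicator {} = (\<lambda>_::'a. 0::real)" by auto
  then show ?thesis using l_0 by (simp add: charge_def)
qed

lemma charge_nonneg [simp]: "0 \<le> charge A"
  using charge_mono[of "{}" A] by simp

lemma charge_Un:
  assumes "A \<inter> B = {}"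
  shows "charge (A \<union> B) = charge A + charge B"
proof -
  have "indicator (A \<union> B) = (\<lambda>y. indicator A y + indicator B y :: real)"
    by (intro ext) (use assms in \<open>auto split: split_indicator\<close>)
  then show ?thesis unfolding charge_def using l_add[OF bounded_indicator bounded_indicator] by simp
qed

lemma charge_Un_le: "charge (A \<union> B) \<le> charge A + charge B"
proof -
  have "charge (A \<union> (B - A)) = charge A + charge (B - A)" by (rule charge_Un) auto
  moreover have "charge (B - A) \<le> charge B" by (rule charge_mono) auto
  ultimately show ?thesis by simp
qed

lemma charge_UN_le: "finite I \<Longrightarrow> charge (\<Union>i\<in>I. A i) \<le> (\<Sum>i\<in>I. charge (A i))"
proof (induction I rule: finite_induct)
  case (insert i I)
  then show ?case using charge_Un_le[of "A i" "\<Union>i\<in>I. A i"] by simp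
qed simp

lemma regular_setsE:
  assumes "A \<in> regular_sets" "\<epsilon> > 0"
  obtains D U where "compact D" "D \<subseteq> A" "open U" "A \<subseteq> U" "charge (U - D) < \<epsilon>"
  using assms by (auto simp: regular_sets_def)

text \<open>A compact-open sandwich D, U of A becomes the sandwich C - U, - D of the complement;
  unions of sandwiches serve for unions.\<close>

lemma algebra_regular_sets: "algebra C regular_sets"
  unfolding algebra_iff_Un
proof (intro conjI ballI)
  show "regular_sets \<subseteq> Pow C" by (auto simp: regular_sets_def)
  have "\<exists>D U. compact D \<and> D \<subseteq> {} \<and> open U \<and> {} \<subseteq> U \<and> charge (U - D) < \<epsilon>" if "\<epsilon> > 0" for \<epsilon>
    using that by (intro exI[of _ "{}"]) auto
  then show "{} \<in> regular_sets" by (auto simp: regular_sets_def)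
next
  fix A assume A: "A \<in> regular_sets"
  have "\<exists>D U. compact D \<and> D \<subseteq> C - A \<and> open U \<and> C - A \<subseteq> U \<and> charge (U - D) < \<epsilon>" if \<epsilon>: "\<epsilon> > 0" for \<epsilon>
  proof -
    obtain D U where DU: "compact D" "D \<subseteq> A" "open U" "A \<subseteq> U" "charge (U - D) < \<epsilon>"
      using regular_setsE[OF A \<epsilon>] .
    \<comment> \<open>Only points of \<open>C\<close> are charged, and those in the set on the left
      lie in \<open>U - D\<close>.\<close>
    have "charge (- D - (C - U)) \<le> charge (U - D)" by (rule charge_mono) auto
    with DU compact_C show ?thesis
      by (intro exI[of _ "C - U"] exI[of _ "- D"])
        (auto intro: compact_diff compact_imp_closed)
  qed
  moreover have "C \<in> sets borel" using compact_C by (intro borel_compact)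
  ultimately show "C - A \<in> regular_sets" using A by (auto simp: regular_sets_def)
next
  fix A B assume A: "A \<in> regular_sets" and B: "B \<in> regular_sets"
  have "\<exists>D U. compact D \<and> D \<subseteq> A \<union> B \<and> open U \<and> A \<union> B \<subseteq> U \<and> charge (U - D) < \<epsilon>" if "\<epsilon> > 0" for \<epsilon>
  proof -
    have "\<epsilon> / 2 > 0" using that by simp
    obtain D1 U1 where 1: "compact D1" "D1 \<subseteq> A" "open U1" "A \<subseteq> U1" "charge (U1 - D1) < \<epsilon> / 2"
      using regular_setsE[OF A \<open>\<epsilon> / 2 > 0\<close>] .
    obtain D2 U2 where 2: "compact D2" "D2 \<subseteq> B" "open U2" "B \<subseteq> U2" "charge (U2 - D2) < \<epsilon> / 2"
      using regular_setsE[OF B \<open>\<epsilon> / 2 > 0\<close>] .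
    have "charge ((U1 \<union> U2) - (D1 \<union> D2)) \<le> charge ((U1 - D1) \<union> (U2 - D2))"
      by (rule charge_mono) auto
    also have "\<dots> \<le> charge (U1 - D1) + charge (U2 - D2)" by (rule charge_Un_le)
    also have "\<dots> < \<epsilon>" using 1 2 by simp
    finally show ?thesis using 1 2
      by (intro exI[of _ "D1 \<union> D2"] exI[of _ "U1 \<union> U2"]) auto
  qed
  then show "A \<union> B \<in> regular_sets" using A B by (auto simp: regular_sets_def)
qed

text \<open>Replace each \<open>A n\<close> by a compact subset at cost \<epsilon> / 2^(n + 1). The
  finite intersections of these compact sets decrease to the empty set, so one of them is already
  empty. From that index on \<open>A n\<close> is covered by the discarded pieces, whose total
  charge is below \<epsilon>.\<close>

lemma charge_decseq_tendsto_0: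
  assumes A: "range A \<subseteq> regular_sets" "decseq A" "(\<Inter>i::nat. A i) = {}"
  shows "(\<lambda>i. charge (A i)) \<longlonglongrightarrow> 0"
proof (rule LIMSEQ_I)
  fix \<epsilon> :: real assume "\<epsilon> > 0"
  have "\<exists>D. compact D \<and> D \<subseteq> A n \<and> charge (A n - D) < \<epsilon> / 2 ^ (n + 1)" for n
  proof -
    have "A n \<in> regular_sets" "\<epsilon> / 2 ^ (n + 1) > 0" using A(1) \<open>\<epsilon> > 0\<close> by auto
    then obtain D U where DU: "compact D" "D \<subseteq> A n" "open U" "A n \<subseteq> U" "charge (U - D) < \<epsilon> / 2 ^ (n + 1)"
      by (rule regular_setsE)
    moreover have "charge (A n - D) \<le> charge (U - D)" using DU by (intro charge_mono) auto
    ultimately show ?thesis by force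
  qed
  then obtain D where D: "\<And>n. compact (D n)" "\<And>n. D n \<subseteq> A n"
    "\<And>n. charge (A n - D n) < \<epsilon> / 2 ^ (n + 1)" by metis
  define E where "E n = (\<Inter>k\<in>{..n}. D k)" for n
  have "\<exists>N. E N = {}"
  proof (rule ccontr)
    assume ne: "\<nexists>N. E N = {}"
    have "\<Inter>(range E) \<noteq> {}"
    proof (rule compact_nest)
      show "compact (E n)" for n
        unfolding E_def using D(1) by (intro compact_Inter) auto
    qed (use ne in \<open>auto simp: E_def\<close>)
    moreover have "E n \<subseteq> A n" for n using D(2)[of n] by (auto simp: E_def)
    then have "\<Inter>(range E) \<subseteq> (\<Inter>i. A i)" by blast
    ultimately show False using A(3) by simp
  qed
  then obtain N where N: "E N = {}" ..
  have "charge (A n) < \<epsilon>" if "n \<ge> N" for n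
  proof -
    have "A n \<subseteq> (\<Union>k\<in>{..N}. A k - D k)"
    proof
      fix y assume y: "y \<in> A n"
      then have "y \<in> A k" if "k \<le> N" for k
        using decseqD[OF A(2), of k n] that \<open>n \<ge> N\<close> by auto
      moreover obtain k where "k \<le> N" "y \<notin> D k" using N by (auto simp: E_def)
      ultimately show "y \<in> (\<Union>k\<in>{..N}. A k - D k)" by auto
    qed
    then have "charge (A n) \<le> charge (\<Union>k\<in>{..N}. A k - D k)" by (intro charge_mono) auto
    also have "\<dots> \<le> (\<Sum>k\<in>{..N}. charge (A k - D k))" by (rule charge_UN_le) simp
    also have "\<dots> \<le> (\<Sum>k\<in>{..N}. \<epsilon> / 2 ^ (k + 1))"
      using D(3) by (intro sum_mono less_imp_le) auto
    also have "\<dots> = \<epsilon> * (1 - (1/2) ^ (N + 1))"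
      by (induction N) (auto simp: field_simps)
    also have "\<dots> < \<epsilon>" using \<open>\<epsilon> > 0\<close> by simp
    finally show ?thesis .
  qed
  then show "\<exists>no. \<forall>n\<ge>no. norm (charge (A n) - 0) < \<epsilon>" by auto
qed

text \<open>The charge of {\<phi> < t} is monotone in t, hence continuous off a countable set. At a
  point of continuity the compact set {\<phi> \<le> s} with s slightly below t approximates from
  inside, and an open set with the same trace on \<open>C\<close> serves from outside.\<close>

lemma countable_irregular_levels:
  fixes \<phi> :: "'a \<Rightarrow> real"
  assumes \<phi>: "continuous_on C \<phi>"
  shows "countable {t. {y\<in>C. \<phi> y < t} \<notin> regular_sets}"
proof -
  define h where "h t = charge {y\<in>C. \<phi> y < t}" for t
  have "mono h" unfolding h_def by (intro monoI charge_mono) auto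
  moreover have "{y\<in>C. \<phi> y < t} \<in> regular_sets" if "isCont h t" for t
  proof -
    obtain V where V: "open V" "V \<inter> C = \<phi> -` {..<t} \<inter> C"
      using \<phi> unfolding continuous_on_open_invariant by (meson open_lessThan)
    have Veq: "{y\<in>C. \<phi> y < t} = V \<inter> C" using V(2) by auto
    have "\<exists>D U. compact D \<and> D \<subseteq> {y\<in>C. \<phi> y < t} \<and> open U \<and> {y\<in>C. \<phi> y < t} \<subseteq> U \<and> charge (U - D) < \<epsilon>"
      if \<epsilon>: "\<epsilon> > 0" for \<epsilon>
    proof -
      obtain \<delta> where \<delta>: "\<delta> > 0" "\<And>s. dist s t < \<delta> \<Longrightarrow> dist (h s) (h t) < \<epsilon>"
        using \<open>isCont h t\<close> \<epsilon> unfolding continuous_at_eps_delta by meson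
      define s where "s = t - \<delta> / 2"
      define D where "D = {y\<in>C. \<phi> y \<le> s}"
      have s: "s < t" "h t - h s < \<epsilon>" using \<delta>(1) \<delta>(2)[of s] by (auto simp: s_def dist_real_def)
      have "D = C \<inter> \<phi> -` {..s}" by (auto simp: D_def)
      then have "compact D"
        using continuous_closedin_preimage[OF \<phi> closed_atMost] closedin_compact[OF compact_C] by metis
      moreover have "charge (V - D) < \<epsilon>"
      proof -
        have "h s + charge (V - D) \<le> charge ({y\<in>C. \<phi> y < s} \<union> ((V \<inter> C) - D))"
          unfolding h_def
          by (subst charge_Un) (auto simp: D_def intro: charge_mono)
        also have "\<dots> \<le> h t"
          unfolding h_def using s V(2) by (intro charge_mono) auto
        finally show ?thesis using s by simp
      qed
      ultimately show ?thesis using V Veq s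
        by (intro exI[of _ D] exI[of _ V]) (auto simp: D_def)
    qed
    moreover have "V \<inter> C \<in> sets borel" by (intro sets.Int borel_open borel_compact V(1) compact_C)
    ultimately show ?thesis using Veq by (auto simp: regular_sets_def)
  qed
  then have "{t. {y\<in>C. \<phi> y < t} \<notin> regular_sets} \<subseteq> {t. \<not> isCont h t}" by auto
  ultimately show ?thesis using mono_ctble_discont countable_subset by blast
qed

text \<open>An open set is the union of the sets where the distance to its complement is at least t,
  for t tending to 0; as only countably many levels are bad, all these t can be taken
  regular.\<close>

lemma open_in_sigma_regular:
  assumes "open U"
  shows "C \<inter> U \<in> sigma_sets C regular_sets"
proof (cases "U = UNIV")
  \<comment> \<open>Treated apart because \<open>infdist\<close> to the empty set is 0 by
    convention, which would break the description of \<open>U\<close> by positive distance.\<close>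
  case True
  then show ?thesis using sigma_sets_top by simp
next
  case False
  interpret algebra C regular_sets by (rule algebra_regular_sets)
  define d where "d y = infdist y (- U)" for y
  have "continuous_on C d" unfolding d_def by (intro continuous_intros)
  then have cnt: "countable {t. {y\<in>C. d y < t} \<notin> regular_sets}" by (rule countable_irregular_levels)
  have "\<exists>t. 0 < t \<and> t < 1 / Suc n \<and> {y\<in>C. d y < t} \<in> regular_sets" for n
  proof -
    have "uncountable {0<..<1 / real (Suc n)}" by (subst uncountable_open_interval) simp
    then have "\<not> {0<..<1 / real (Suc n)} \<subseteq> {t. {y\<in>C. d y < t} \<notin> regular_sets}"
      using cnt countable_subset by blast
    then show ?thesis by auto
  qed
  then obtain t where t: "\<And>n. 0 < t n" "\<And>n. t n < 1 / Suc n" "\<And>n. {y\<in>C. d y < t n} \<in> regular_sets"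
    by metis
  have dU: "y \<in> U \<longleftrightarrow> d y > 0" for y
  proof -
    have "- U \<noteq> {}" "closed (- U)" using False assms by auto
    then have "y \<in> - U \<longleftrightarrow> d y = 0" unfolding d_def by (intro in_closed_iff_infdist_zero) auto
    then show ?thesis using infdist_nonneg[of y "- U"] by (auto simp: d_def)
  qed
  have "C \<inter> U = (\<Union>n. C - {y\<in>C. d y < t n})"
  proof (intro equalityI subsetI)
    fix y assume y: "y \<in> C \<inter> U"
    then obtain n where "1 / Suc n < d y" using dU[of y] reals_Archimedean by (auto simp: inverse_eq_divide)
    then have "t n < d y" using t(2)[of n] by linarith
    then show "y \<in> (\<Union>n. C - {y\<in>C. d y < t n})" using y by (auto simp: not_less intro: less_imp_le)
  next
    fix y assume "y \<in> (\<Union>n. C - {y\<in>C. d y < t n})"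
    then obtain n where "y \<in> C" "t n \<le> d y" by (auto simp: not_less)
    then show "y \<in> C \<inter> U" using dU[of y] t(1)[of n] by auto
  qed
  also have "\<dots> \<in> sigma_sets C regular_sets"
    using t(3) by (intro sigma_sets.Union sigma_sets.Basic) auto
  finally show ?thesis .
qed

lemma sigma_regular_sets: "sigma_sets C regular_sets = sets (restrict_space borel C)"
proof -
  have Cb: "C \<in> sets borel" using compact_C by (rule borel_compact)
  have sub: "regular_sets \<subseteq> Pow C" by (auto simp: regular_sets_def)
  define N where "N = sigma C regular_sets"
  have N: "sets N = sigma_sets C regular_sets" "space N = C"
    unfolding N_def using sub by (auto simp: space_measure_of)
  have "(\<lambda>y. y) \<in> borel_measurable N"
  proof (rule borel_measurableI)
    fix S :: "'a set" assume "open S"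
    then have "C \<inter> S \<in> sets N" unfolding N by (rule open_in_sigma_regular)
    moreover have "(\<lambda>y. y) -` S \<inter> space N = C \<inter> S" using N by auto
    ultimately show "(\<lambda>y. y) -` S \<inter> space N \<in> sets N" by simp
  qed
  then have "C \<inter> S \<in> sigma_sets C regular_sets" if "S \<in> sets borel" for S
    using measurable_sets[of "\<lambda>y. y" N borel S] that by (auto simp: N Int_commute)
  moreover have "sigma_sets C regular_sets \<subseteq> sets (restrict_space borel C)"
  proof -
    have "regular_sets \<subseteq> sets (restrict_space borel C)"
      using Cb by (auto simp: regular_sets_def sets_restrict_space_iff)
    from sets.sigma_sets_subset[OF this] show ?thesis by (simp add: space_restrict_space)
  qed
  ultimately show ?thesis by (auto simp: sets_restrict_space)
qed

text \<open>Caratheodory's extension theorem, with countable additivity supplied as continuity at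
  the empty set by \<open>charge_decseq_tendsto_0\<close>.\<close>

lemma charge_extension:
  obtains N where "sets N = sets (restrict_space borel C)" "space N = C" "finite_measure N"
    "\<And>A. A \<in> regular_sets \<Longrightarrow> measure N A = charge A"
proof -
  interpret algebra C regular_sets by (rule algebra_regular_sets)
  have "\<exists>\<mu>. (\<forall>s\<in>regular_sets. \<mu> s = ennreal (charge s)) \<and> measure_space C (sigma_sets C regular_sets) \<mu>"
  proof (rule caratheodory_empty_continuous)
    show "positive regular_sets (\<lambda>x. ennreal (charge x))" by (simp add: positive_def)
    show "additive regular_sets (\<lambda>x. ennreal (charge x))"
      by (auto simp: additive_def charge_Un simp flip: ennreal_plus)
    fix A :: "nat \<Rightarrow> 'a set" assume "range A \<subseteq> regular_sets" "decseq A" "(\<Inter>i. A i) = {}"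
    from charge_decseq_tendsto_0[OF this] show "(\<lambda>i. ennreal (charge (A i))) \<longlonglongrightarrow> 0"
      using tendsto_ennrealI by force
  qed simp
  then obtain \<mu> where \<mu>: "\<And>s. s \<in> regular_sets \<Longrightarrow> \<mu> s = ennreal (charge s)"
    and ms: "measure_space C (sigma_sets C regular_sets) \<mu>" by auto
  define N where "N = measure_of C (sigma_sets C regular_sets) \<mu>"
  have sub: "sigma_sets C regular_sets \<subseteq> Pow C"
    using sigma_sets_into_sp[OF space_closed] by blast
  have sets: "sets N = sigma_sets C regular_sets" and space: "space N = C"
    unfolding N_def using sub ms by (auto simp: sigma_sets_sigma_sets_eq space_closed measure_space_def space_measure_of)
  have em: "emeasure N A = \<mu> A" if "A \<in> sigma_sets C regular_sets" for A
    unfolding N_def using ms that by (intro emeasure_measure_of_sigma) (auto simp: measure_space_def)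
  have reg: "emeasure N A = ennreal (charge A)" if "A \<in> regular_sets" for A
    using em \<mu> that by auto
  show ?thesis
  proof (rule that[of N])
    show "sets N = sets (restrict_space borel C)" using sets sigma_regular_sets by simp
    show "finite_measure N"
      using reg[OF top] space by (intro finite_measureI) auto
    show "measure N A = charge A" if "A \<in> regular_sets" for A
      using reg[OF that] by (simp add: measure_def)
  qed (rule space)
qed

lemma l_sum:
  assumes "finite I" "\<And>i. i \<in> I \<Longrightarrow> bounded (f i ` C)"
  shows "l (\<lambda>y. \<Sum>i\<in>I. f i y) = (\<Sum>i\<in>I. l (f i)) \<and> bounded ((\<lambda>y. \<Sum>i\<in>I. f i y) ` C)"
  using assms
proof (induction I rule: finite_induct)
  case empty
  then show ?case using l_0 bounded_const_image by simp
next
  case (insert i I)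
  then show ?case by (auto simp: l_add intro!: bounded_plus_comp)
qed

lemma l_simple_function:
  assumes N: "space N = C" "finite_measure N" "\<And>A. A \<in> regular_sets \<Longrightarrow> measure N A = charge A"
    "regular_sets \<subseteq> sets N"
    and fin: "finite (\<psi> ` C)" and reg: "\<And>z. {y\<in>C. \<psi> y = z} \<in> regular_sets"
  shows "l \<psi> = (\<integral>y. \<psi> y \<partial>N)" "integrable N \<psi>"
proof -
  interpret finite_measure N by fact
  have eq: "\<psi> y = (\<Sum>z\<in>\<psi> ` C. z * indicator {y\<in>C. \<psi> y = z} y)" if "y \<in> C" for y
    using that fin by (simp add: indicator_def if_distrib[of "\<lambda>x. _ * x"] cong: if_cong)
  have bi: "bounded ((\<lambda>y. z * indicator A y) ` C)" for z :: real and A :: "'a set"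
    by (rule bounded_subset[of "{0, z}"]) (auto simp: indicator_def)
  have "l \<psi> = l (\<lambda>y. \<Sum>z\<in>\<psi> ` C. z * indicator {y\<in>C. \<psi> y = z} y)"
    using fin eq by (intro l_cong finite_imp_bounded)
  also have "\<dots> = (\<Sum>z\<in>\<psi> ` C. l (\<lambda>y. z * indicator {y\<in>C. \<psi> y = z} y))"
    using l_sum[OF fin, of "\<lambda>z y. z * indicator {y\<in>C. \<psi> y = z} y"] bi by blast
  also have "\<dots> = (\<Sum>z\<in>\<psi> ` C. z * charge {y\<in>C. \<psi> y = z})"
    by (intro sum.cong refl) (simp add: l_scale bounded_indicator charge_def)
  also have "\<dots> = (\<Sum>z\<in>\<psi> ` C. \<integral>y. z * indicator {y\<in>C. \<psi> y = z} y \<partial>N)"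
    using reg N by (intro sum.cong refl) (auto simp: subset_iff)
  also have int: "\<dots> = (\<integral>y. (\<Sum>z\<in>\<psi> ` C. z * indicator {y\<in>C. \<psi> y = z} y) \<partial>N)"
    using reg N emeasure_finite
    by (intro Bochner_Integration.integral_sum[symmetric] integrable_mult_right integrable_real_indicator)
      (auto simp: subset_iff less_top[symmetric])
  also have "\<dots> = (\<integral>y. \<psi> y \<partial>N)"
    by (rule Bochner_Integration.integral_cong[OF refl]) (rule eq[symmetric], simp add: N(1))
  finally show "l \<psi> = (\<integral>y. \<psi> y \<partial>N)" .
  have "integrable N (\<lambda>y. \<Sum>z\<in>\<psi> ` C. z * indicator {y\<in>C. \<psi> y = z} y)"
    using reg N emeasure_finite
    by (intro Bochner_Integration.integrable_sum integrable_mult_right integrable_real_indicator)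
      (auto simp: subset_iff less_top[symmetric])
  then show "integrable N \<psi>"
    by (rule Bochner_Integration.integrable_cong[THEN iffD1, OF refl, rotated])
      (rule eq[symmetric], simp add: N(1))
qed

text \<open>Round \<phi> down to a grid of mesh 1/k. The grid is shifted by \<tau> so that none of
  its points is an irregular level; the fibres of the step function are then differences of regular
  sets.\<close>

lemma regular_step_approximation:
  fixes \<phi> :: "'a \<Rightarrow> real" and k :: real
  assumes \<phi>: "continuous_on C \<phi>" and k: "k > 0"
  obtains \<psi> where "finite (\<psi> ` C)" "\<And>z. {y\<in>C. \<psi> y = z} \<in> regular_sets"
    "\<And>y. y \<in> C \<Longrightarrow> \<bar>\<psi> y - \<phi> y\<bar> \<le> 1 / k"
proof -
  interpret algebra C regular_sets by (rule algebra_regular_sets)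
  define Z where "Z = {t. {y\<in>C. \<phi> y < t} \<notin> regular_sets}"
  \<comment> \<open>The shifts for which the grid point (j + \<tau>)/k is irregular; countably many
    for each of countably many j.\<close>
  have "countable (\<Union>j::int. (\<lambda>t. k * t - of_int j) ` Z)"
    using countable_irregular_levels[OF \<phi>] by (intro countable_UN countable_image) (auto simp: Z_def)
  then have "(\<Union>j::int. (\<lambda>t. k * t - of_int j) ` Z) \<noteq> UNIV" using uncountable_UNIV_real by metis
  then obtain \<tau> where \<tau>: "\<And>j::int. \<tau> \<notin> (\<lambda>t. k * t - of_int j) ` Z" by blast
  have good: "{y\<in>C. \<phi> y < (of_int j + \<tau>) / k} \<in> regular_sets" for j
  proof (rule ccontr)
    assume "{y\<in>C. \<phi> y < (of_int j + \<tau>) / k} \<notin> regular_sets"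
    then have "(of_int j + \<tau>) / k \<in> Z" by (simp add: Z_def)
    then have "k * ((of_int j + \<tau>) / k) - of_int j \<in> (\<lambda>t. k * t - of_int j) ` Z" by (rule imageI)
    then show False using \<tau>[of j] k by simp
  qed
  define F where "F y = \<lfloor>k * \<phi> y - \<tau>\<rfloor>" for y
  define \<psi> where "\<psi> y = (of_int (F y) + \<tau>) / k" for y
  show ?thesis
  proof (rule that[of \<psi>])
    have "bounded (\<phi> ` C)" using compact_continuous_image[OF \<phi> compact_C] by (rule compact_imp_bounded)
    then obtain M where M: "\<And>y. y \<in> C \<Longrightarrow> \<bar>\<phi> y\<bar> \<le> M" by (auto simp: bounded_iff)
    have "F ` C \<subseteq> {\<lfloor>k * (- M) - \<tau>\<rfloor>..\<lfloor>k * M - \<tau>\<rfloor>}"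
    proof
      fix j assume "j \<in> F ` C"
      then obtain y where y: "y \<in> C" "j = F y" by auto
      have "k * (- M) \<le> k * \<phi> y" "k * \<phi> y \<le> k * M"
        using M[OF y(1)] k by (intro mult_left_mono; simp add: abs_le_iff)+
      then show "j \<in> {\<lfloor>k * (- M) - \<tau>\<rfloor>..\<lfloor>k * M - \<tau>\<rfloor>}" unfolding y(2) F_def by (auto intro!: floor_mono)
    qed
    then have "finite (F ` C)" by (rule finite_subset) simp
    moreover have "\<psi> ` C = (\<lambda>j. (of_int j + \<tau>) / k) ` (F ` C)" by (auto simp: \<psi>_def)
    ultimately show "finite (\<psi> ` C)" by simp
  next
    fix z
    show "{y\<in>C. \<psi> y = z} \<in> regular_sets"
    proof (cases "\<exists>j. z = (of_int j + \<tau>) / k")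
      case True
      then obtain j where j: "z = (of_int j + \<tau>) / k" ..
      have "\<psi> y = z \<longleftrightarrow> F y = j" for y using k by (auto simp: \<psi>_def j)
      also have "F y = j \<longleftrightarrow> \<not> \<phi> y < (of_int j + \<tau>) / k \<and> \<phi> y < (of_int (j + 1) + \<tau>) / k" for y
        using k unfolding F_def floor_eq_iff by (auto simp: field_simps)
      finally have "{y\<in>C. \<psi> y = z} = {y\<in>C. \<phi> y < (of_int (j + 1) + \<tau>) / k} - {y\<in>C. \<phi> y < (of_int j + \<tau>) / k}"
        by auto
      then show ?thesis by (simp only:) (rule Diff[OF good good])
    next
      case False
      then have empty: "{y\<in>C. \<psi> y = z} = {}" by (auto simp: \<psi>_def)
      show ?thesis unfolding empty by (rule empty_sets)
    qed
  next
    fix y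
    have "of_int (F y) \<le> k * \<phi> y - \<tau>" "k * \<phi> y - \<tau> < of_int (F y) + 1"
      unfolding F_def by linarith+
    then have "\<psi> y \<le> \<phi> y" "\<phi> y \<le> \<psi> y + 1 / k" using k by (auto simp: \<psi>_def field_simps)
    then show "\<bar>\<psi> y - \<phi> y\<bar> \<le> 1 / k" by simp
  qed
qed

text \<open>On regular step functions the integral and \<open>l\<close> agree. Passing to a function
  within 1/k uniformly changes either by at most l(1)/k, because l(1) is also the total mass of the
  measure.\<close>

theorem riesz_representation:
  "\<exists>N. sets N = sets (restrict_space borel C) \<and> space N = C \<and> finite_measure N \<and>
    (\<forall>\<phi>. continuous_on C \<phi> \<longrightarrow> (\<integral>y. \<phi> y \<partial>N) = l \<phi>)"
proof -
  obtain N where N: "sets N = sets (restrict_space borel C)" "space N = C" "finite_measure N"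
    "\<And>A. A \<in> regular_sets \<Longrightarrow> measure N A = charge A" using charge_extension by metis
  interpret finite_measure N by fact
  interpret algebra C regular_sets by (rule algebra_regular_sets)
  have sub: "regular_sets \<subseteq> sets N" unfolding N(1) sigma_regular_sets[symmetric] by auto
  have int: "integrable N \<phi>" if \<phi>: "continuous_on C \<phi>" for \<phi> :: "'a \<Rightarrow> real"
  proof -
    have "bounded (\<phi> ` C)" using compact_continuous_image[OF \<phi> compact_C] by (rule compact_imp_bounded)
    then obtain M where M: "\<And>y. y \<in> C \<Longrightarrow> \<bar>\<phi> y\<bar> \<le> M" by (auto simp: bounded_iff)
    show ?thesis
    proof (rule integrable_const_bound)
      show "AE y in N. norm (\<phi> y) \<le> M" using M N(2) by (intro AE_I2) auto
      show "\<phi> \<in> borel_measurable N"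
        using borel_measurable_continuous_on_restrict[OF \<phi>] measurable_cong_sets[OF N(1) refl] by blast
    qed
  qed
  have "(\<integral>y. \<phi> y \<partial>N) = l \<phi>" if \<phi>: "continuous_on C \<phi>" for \<phi>
  proof -
    have b\<phi>: "bounded (\<phi> ` C)" using compact_continuous_image[OF \<phi> compact_C] by (rule compact_imp_bounded)
    note bc = bounded_const_image
    have close: "\<bar>(\<integral>y. \<phi> y \<partial>N) - l \<phi>\<bar> \<le> (2 * l (\<lambda>_. 1)) / k" if k: "k > 0" for k
    proof -
      obtain \<psi> where \<psi>: "finite (\<psi> ` C)" "\<And>z. {y\<in>C. \<psi> y = z} \<in> regular_sets"
        "\<And>y. y \<in> C \<Longrightarrow> \<bar>\<psi> y - \<phi> y\<bar> \<le> 1 / k" using regular_step_approximation[OF \<phi> k] by metis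
      have b\<psi>: "bounded (\<psi> ` C)" using \<psi>(1) by (rule finite_imp_bounded)
      have l1: "l (\<lambda>_. 1 / k) = l (\<lambda>_. 1) / k" using l_scale[OF bc, of "1/k" 1] by simp
      have "l \<phi> \<le> l (\<lambda>y. \<psi> y + 1 / k)"
        by (intro l_mono bounded_plus_comp b\<phi> b\<psi> bc) (use \<psi>(3) in \<open>fastforce simp: abs_le_iff\<close>)
      moreover have "l \<psi> \<le> l (\<lambda>y. \<phi> y + 1 / k)"
        by (intro l_mono bounded_plus_comp b\<phi> b\<psi> bc) (use \<psi>(3) in \<open>fastforce simp: abs_le_iff\<close>)
      ultimately have 1: "\<bar>l \<phi> - l \<psi>\<bar> \<le> l (\<lambda>_. 1) / k"
        using l_add[OF b\<psi> bc] l_add[OF b\<phi> bc] l1 by (simp add: abs_le_iff)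
      have "charge C = l (\<lambda>_. 1)" unfolding charge_def by (rule l_cong[OF bounded_indicator]) simp
      then have mC: "measure N C = l (\<lambda>_. 1)" using N(4)[OF top] by simp
      note s = l_simple_function[OF N(2,3,4) sub \<psi>(1,2)]
      have "\<bar>(\<integral>y. \<phi> y \<partial>N) - (\<integral>y. \<psi> y \<partial>N)\<bar> = \<bar>\<integral>y. \<phi> y - \<psi> y \<partial>N\<bar>"
        using int[OF \<phi>] s(2) by simp
      also have "\<dots> \<le> (\<integral>y. \<bar>\<phi> y - \<psi> y\<bar> \<partial>N)" by (rule integral_abs_bound)
      also have "\<dots> \<le> (\<integral>y. 1 / k \<partial>N)"
        using int[OF \<phi>] s(2) \<psi>(3) N(2) by (intro integral_mono) (auto simp: abs_minus_commute)
      also have "\<dots> = l (\<lambda>_. 1) / k" using mC N(2) by simp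
      finally show ?thesis using 1 s(1) by (simp add: abs_le_iff)
    qed
    have "\<bar>(\<integral>y. \<phi> y \<partial>N) - l \<phi>\<bar> \<le> 0"
    proof (rule field_le_epsilon)
      fix e :: real assume e: "e > 0"
      have "l (\<lambda>_. 0) \<le> l (\<lambda>_. 1)" by (intro l_mono bc) simp
      then have L: "l (\<lambda>_. 1) \<ge> 0" using l_0 by simp
      have "\<bar>(\<integral>y. \<phi> y \<partial>N) - l \<phi>\<bar> \<le> (2 * l (\<lambda>_. 1)) / ((2 * l (\<lambda>_. 1) + 1) / e)"
        using L e by (intro close) auto
      also have "\<dots> \<le> e" using L e by (simp add: field_simps)
      finally show "\<bar>(\<integral>y. \<phi> y \<partial>N) - l \<phi>\<bar> \<le> 0 + e" by simp
    qed
    then show ?thesis by simp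
  qed
  then show ?thesis using N(1,2,3) by blast
qed

end

section \<open>Strong duality\<close>

lemma extends_continuously_add:
  assumes "extends_continuously S h" "extends_continuously S k" "\<And>y. y \<in> S \<Longrightarrow> u y = h y + k y"
  shows "extends_continuously S u"
proof -
  obtain H K where "continuous_on (closure S) H" "\<forall>y\<in>S. H y = h y" "continuous_on (closure S) K" "\<forall>y\<in>S. K y = k y"
    using assms(1,2) by (auto simp: extends_continuously_def)
  then show ?thesis unfolding extends_continuously_def using assms(3)
    by (intro exI[of _ "\<lambda>y. H y + K y"]) (auto intro: continuous_on_add)
qed

lemma extends_continuously_mult:
  assumes "extends_continuously S h" "continuous_on (closure S) c" "\<And>y. y \<in> S \<Longrightarrow> u y = c y * h y"
  shows "extends_continuously S u"
proof -
  obtain H where "continuous_on (closure S) H" "\<forall>y\<in>S. H y = h y"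
    using assms(1) by (auto simp: extends_continuously_def)
  then show ?thesis unfolding extends_continuously_def using assms(2,3)
    by (intro exI[of _ "\<lambda>y. c y * H y"]) (auto intro: continuous_on_mult)
qed

lemma extends_continuously_sum:
  assumes "\<And>i. i \<in> I \<Longrightarrow> extends_continuously S (h i)"
  shows "extends_continuously S (\<lambda>y. \<Sum>i\<in>I. h i y)"
  using assms
proof (induction I rule: infinite_finite_induct)
  case (insert i I)
  show ?case by (rule extends_continuously_add[of S "h i" "\<lambda>y. \<Sum>i\<in>I. h i y"]) (use insert in auto)
qed (auto simp: extends_continuously_def intro!: exI[of _ "\<lambda>_. 0"])

lemma C2_closureD:
  assumes "f \<in> C2_closure S"
  shows "Ck_on 2 S f" "continuous_on (closure S) f"
    "extends_continuously S (partial i f)" "extends_continuously S (partial i (partial j f))"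
  using assms by (auto simp: C2_closure_def)

lemma C2_closure_add:
  assumes "open S" and f: "f \<in> C2_closure S" and g: "g \<in> C2_closure S"
  shows "(\<lambda>y. f y + g y) \<in> C2_closure S"
proof -
  note c = C2_closureD[OF f] C2_closureD[OF g]
  obtain G H where j: "jet2 S f G H" using Ck_on_2E[OF c(1) assms(1)] .
  obtain G' H' where k: "jet2 S g G' H'" using Ck_on_2E[OF c(5) assms(1)] .
  note jk = jet2_add[OF j k]
  have "extends_continuously S (partial i (\<lambda>y. f y + g y))" for i
    by (rule extends_continuously_add[OF c(3)[of i] c(7)[of i]])
      (simp add: jet2_partial[OF j] jet2_partial[OF k] jet2_partial[OF jk])
  moreover have "extends_continuously S (partial i (partial l (\<lambda>y. f y + g y)))" for i l
    by (rule extends_continuously_add[OF c(4)[of i l] c(8)[of i l]])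
      (simp add: jet2_partial_partial(2)[OF j assms(1)] jet2_partial_partial(2)[OF k assms(1)]
        jet2_partial_partial(2)[OF jk assms(1)])
  moreover have "continuous_on (closure S) (\<lambda>y. f y + g y)" by (rule continuous_on_add[OF c(2,6)])
  ultimately show ?thesis using Ck_on_2I[OF assms(1) jk] by (simp add: C2_closure_def)
qed

lemma C2_closure_scale:
  assumes "open S" and f: "f \<in> C2_closure S"
  shows "(\<lambda>y. c * f y) \<in> C2_closure S"
proof -
  note d = C2_closureD[OF f]
  obtain G H where j: "jet2 S f G H" using Ck_on_2E[OF d(1) assms(1)] .
  note jk = jet2_scale[OF j, of c]
  have "extends_continuously S (partial i (\<lambda>y. c * f y))" for i
    by (rule extends_continuously_mult[OF d(3)[of i] continuous_on_const[where c=c]])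
      (simp add: jet2_partial[OF j] jet2_partial[OF jk])
  moreover have "extends_continuously S (partial i (partial l (\<lambda>y. c * f y)))" for i l
    by (rule extends_continuously_mult[OF d(4)[of i l] continuous_on_const[where c=c]])
      (simp add: jet2_partial_partial(2)[OF j assms(1)] jet2_partial_partial(2)[OF jk assms(1)])
  moreover have "continuous_on (closure S) (\<lambda>y. c * f y)" by (intro continuous_intros d(2))
  ultimately show ?thesis using Ck_on_2I[OF assms(1) jk] by (simp add: C2_closure_def)
qed

lemma C2_closure_0: "open S \<Longrightarrow> (\<lambda>_. 0) \<in> C2_closure S"
  by (rule C2_closureI[OF _ open_UNIV subset_UNIV Ck_on_2_const[OF open_UNIV]])

context elliptic_domain
begin

section \<open>Majorants and the separating functional\<close>

text \<open>On the frontier \<open>L f\<close> itself is meaningless, as \<open>f\<close> need not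
  be differentiable there. Integrals over the closed domain therefore use a continuous function that
  agrees with \<open>L f\<close> on \<open>X\<close>.\<close>

lemma L_extends:
  assumes f: "f \<in> C2_closure X"
  obtains \<Lambda> where "continuous_on (closure X) \<Lambda>" "\<And>y. y \<in> X \<Longrightarrow> \<Lambda> y = L f y"
proof -
  note d = C2_closureD[OF f]
  have a: "continuous_on (closure X) (\<lambda>y. - (diffusion_matrix B y $ i $ j))" for i j
    by (intro continuous_intros continuous_on_coefficients)
  have b': "continuous_on (closure X) (\<lambda>y. - (b y $ i))" for i
    by (intro continuous_intros continuous_on_coefficients)
  have 1: "extends_continuously X (\<lambda>y. \<Sum>i\<in>UNIV. \<Sum>j\<in>UNIV. - (diffusion_matrix B y $ i $ j) * partial i (partial j f) y)"
    by (intro extends_continuously_sum extends_continuously_mult[OF d(4) a]) simp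
  have 2: "extends_continuously X (\<lambda>y. \<Sum>i\<in>UNIV. - (b y $ i) * partial i f y)"
    by (intro extends_continuously_sum extends_continuously_mult[OF d(3) b']) simp
  have "extends_continuously X (L f)"
    by (rule extends_continuously_add[OF 1 2]) (simp add: L_op_def sum_negf)
  then show ?thesis using that by (auto simp: extends_continuously_def)
qed

text \<open>A function on \<open>primal_index\<close> is a pair of integrands, one for \<open>\<mu>\<close> on \<open>X\<close> and one for \<open>\<nu>\<close> on the
  frontier. A linear functional below \<open>\<phi> \<mapsto> inf {v x + \<beta> D}\<close>, the infimum over all majorants
  \<open>(v, \<beta>)\<close> of \<open>\<phi>\<close>, is positive (take \<open>v = 0\<close>), maps \<open>(L f, f)\<close> to \<open>f x\<close> (take \<open>v = \<plusminus>f\<close>) and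
  \<open>(0, g)\<close> to at most \<open>D\<close> (take \<open>\<beta> = 1\<close>).\<close>

definition primal_index :: "(real ^ 'n + real ^ 'n) set" where
  "primal_index = Inl ` X \<union> Inr ` frontier X"

definition majorant :: "(real ^ 'n \<Rightarrow> real) \<Rightarrow> (real ^ 'n + real ^ 'n \<Rightarrow> real) \<Rightarrow> (real ^ 'n \<Rightarrow> real) \<Rightarrow> real \<Rightarrow> bool" where
  "majorant g \<phi> v \<beta> \<longleftrightarrow> v \<in> C2_closure X \<and> 0 \<le> \<beta> \<and> (\<forall>y\<in>X. \<phi> (Inl y) \<le> L v y) \<and>
     (\<forall>y\<in>frontier X. \<phi> (Inr y) \<le> v y + \<beta> * g y)"

lemma majorant_add:
  assumes "majorant g \<phi> v \<beta>" "majorant g \<psi> w \<gamma>"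
  shows "majorant g (\<lambda>k. \<phi> k + \<psi> k) (\<lambda>y. v y + w y) (\<beta> + \<gamma>)"
proof -
  have vw: "v \<in> C2_closure X" "w \<in> C2_closure X" using assms by (auto simp: majorant_def)
  have "L (\<lambda>y. v y + w y) y = L v y + L w y" if "y \<in> X" for y
    by (rule L_op_add[OF open_X C2_closureD(1)[OF vw(1)] C2_closureD(1)[OF vw(2)] that])
  then show ?thesis using assms C2_closure_add[OF open_X vw]
    by (fastforce simp: majorant_def algebra_simps)
qed

lemma majorant_scale:
  assumes "majorant g \<phi> v \<beta>" "0 \<le> c"
  shows "majorant g (\<lambda>k. c * \<phi> k) (\<lambda>y. c * v y) (c * \<beta>)"
proof -
  have v: "v \<in> C2_closure X" using assms by (auto simp: majorant_def)
  have Lc: "L (\<lambda>y. c * v y) y = c * L v y" if "y \<in> X" for y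
    by (rule L_op_scale[OF open_X C2_closureD(1)[OF v] that])
  have "c * \<phi> (Inr y) \<le> c * v y + c * \<beta> * g y" if "y \<in> frontier X" for y
  proof -
    have "c * \<phi> (Inr y) \<le> c * (v y + \<beta> * g y)"
      using assms that by (intro mult_left_mono) (auto simp: majorant_def)
    then show ?thesis by (simp add: algebra_simps)
  qed
  then show ?thesis using assms Lc C2_closure_scale[OF open_X v]
    by (auto simp: majorant_def mult_left_mono)
qed

text \<open>A negative multiple of the Slater function: if v \<le> -1 and L v \<le> -1, then - c v
  and L (- c v) are both at least c, which dominates any pair bounded by c.\<close>

lemma majorant_exists:
  assumes "bounded (\<phi> ` primal_index)"
  obtains v where "majorant g \<phi> v 0"
proof -
  obtain c where c: "c > 0" "\<And>k. k \<in> primal_index \<Longrightarrow> \<bar>\<phi> k\<bar> \<le> c"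
    using assms unfolding bounded_pos by auto
  obtain v where v: "Ck_on 2 UNIV v" "\<And>y. y \<in> closure X \<Longrightarrow> L v y \<le> -1" "\<And>y. y \<in> closure X \<Longrightarrow> v y \<le> -1"
    using slater_function by blast
  have le: "\<phi> k \<le> - c * t" if "k \<in> primal_index" "t \<le> -1" for k t
    using mult_left_mono[OF that(2), of c] c(1) c(2)[OF that(1)] by (simp add: abs_le_iff)
  have vc: "v \<in> C2_closure X" by (rule C2_closureI[OF open_X open_UNIV subset_UNIV v(1)])
  have Lv: "L (\<lambda>y. - c * v y) y = - c * L v y" if "y \<in> X" for y
    by (rule L_op_scale[OF open_UNIV v(1) UNIV_I])
  have "majorant g \<phi> (\<lambda>y. - c * v y) 0"
    unfolding majorant_def
  proof (intro conjI ballI)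
    show "(\<lambda>y. - c * v y) \<in> C2_closure X" by (rule C2_closure_scale[OF open_X vc])
    show "\<phi> (Inl y) \<le> L (\<lambda>y. - c * v y) y" if "y \<in> X" for y
      unfolding Lv[OF that] using that closure_X by (intro le v) (auto simp: primal_index_def)
    show "\<phi> (Inr y) \<le> - c * v y + 0 * g y" if "y \<in> frontier X" for y
      using le[of "Inr y" "v y"] v(3)[of y] that closure_X by (auto simp: primal_index_def)
  qed simp
  then show ?thesis by (rule that)
qed

lemma dual_feasible_C2_closureI:
  assumes "v \<in> C2_closure X" "\<And>y. y \<in> X \<Longrightarrow> L v y \<le> 0" "\<And>y. y \<in> frontier X \<Longrightarrow> v y \<le> g y"
  shows "v \<in> dual_feasible X b B g"
  using assms by (auto simp: dual_feasible_def C2_interior_def C2_closure_def)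

lemma dual_feasible_exists:
  assumes g: "continuous_on (frontier X) g"
  obtains v where "v \<in> C2_closure X" "v \<in> dual_feasible X b B g"
proof -
  obtain c where c: "c > 0" "\<And>y. y \<in> frontier X \<Longrightarrow> \<bar>g y\<bar> \<le> c"
    using compact_abs_upper_bound[OF compact_frontier_X g] by blast
  obtain v where v: "Ck_on 2 UNIV v" "\<And>y. y \<in> closure X \<Longrightarrow> L v y \<le> -1" "\<And>y. y \<in> closure X \<Longrightarrow> v y \<le> -1"
    using slater_function by blast
  have vc: "(\<lambda>y. c * v y) \<in> C2_closure X"
    by (rule C2_closure_scale[OF open_X C2_closureI[OF open_X open_UNIV subset_UNIV v(1)]])
  have Lv: "L (\<lambda>y. c * v y) y = c * L v y" for y
    by (rule L_op_scale[OF open_UNIV v(1) UNIV_I])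
  have neg: "c * t \<le> - c" if "t \<le> -1" for t
    using mult_left_mono[OF that, of c] c(1) by simp
  have "(\<lambda>y. c * v y) \<in> dual_feasible X b B g"
  proof (rule dual_feasible_C2_closureI[OF vc])
    show "L (\<lambda>y. c * v y) y \<le> 0" if "y \<in> X" for y
      unfolding Lv using neg[OF v(2)[of y]] that closure_X c(1) by fastforce
    show "c * v y \<le> g y" if "y \<in> frontier X" for y
      using neg[OF v(3)[of y]] c(2)[OF that] that closure_X by (force simp: abs_le_iff)
  qed
  with vc show ?thesis by (rule that)
qed

text \<open>If \<beta> > 0, then - v/\<beta> is feasible for (D), so its value at x is at most
  \<open>D\<close>. If \<beta> = 0, then - v is a direction of recession: w - t v is feasible for
  every t \<ge> 0, and the bound \<open>D\<close> forces v x \<ge> 0.\<close>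

lemma majorant_0_value:
  assumes D: "\<forall>v\<in>dual_feasible X b B g. v x \<le> D" and g: "continuous_on (frontier X) g"
    and m: "majorant g (\<lambda>_. 0) v \<beta>"
  shows "0 \<le> v x + \<beta> * D"
proof -
  have v: "v \<in> C2_closure X" "0 \<le> \<beta>" "\<And>y. y \<in> X \<Longrightarrow> 0 \<le> L v y" "\<And>y. y \<in> frontier X \<Longrightarrow> 0 \<le> v y + \<beta> * g y"
    using m by (auto simp: majorant_def)
  have Lc: "L (\<lambda>y. c * v y) y = c * L v y" if "y \<in> X" for y c
    by (rule L_op_scale[OF open_X C2_closureD(1)[OF v(1)] that])
  show ?thesis
  proof (cases "\<beta> = 0")
    case False
    then have \<beta>: "\<beta> > 0" using v by simp
    have "(\<lambda>y. (- 1 / \<beta>) * v y) \<in> dual_feasible X b B g"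
    proof (rule dual_feasible_C2_closureI[OF C2_closure_scale[OF open_X v(1)]])
      show "L (\<lambda>y. (- 1 / \<beta>) * v y) y \<le> 0" if "y \<in> X" for y
        unfolding Lc[OF that] using v(3)[OF that] \<beta> by (simp add: field_simps)
      show "(- 1 / \<beta>) * v y \<le> g y" if "y \<in> frontier X" for y
        using v(4)[OF that] \<beta> by (simp add: field_simps)
    qed
    from bspec[OF D this] show ?thesis using \<beta> by (simp add: field_simps)
  next
    case True
    obtain w where w: "w \<in> C2_closure X" "w \<in> dual_feasible X b B g" using dual_feasible_exists[OF g] .
    have "w x + t * (- v x) \<le> D" if t: "t \<ge> 0" for t
    proof -
      note tv = C2_closure_scale[OF open_X v(1), of "- t"]
      have "(\<lambda>y. w y + - t * v y) \<in> dual_feasible X b B g"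
      proof (rule dual_feasible_C2_closureI[OF C2_closure_add[OF open_X w(1) tv]])
        fix y assume y: "y \<in> X"
        have "L (\<lambda>y. w y + - t * v y) y = L w y + - t * L v y"
          using L_op_add[OF open_X C2_closureD(1)[OF w(1)] C2_closureD(1)[OF tv] y, where b=b and B=B] Lc[OF y, of "- t"]
          by simp
        moreover have "L w y \<le> 0" using w(2) y by (auto simp: dual_feasible_def)
        moreover have "0 \<le> t * L v y" using t v(3)[OF y] by simp
        ultimately show "L (\<lambda>y. w y + - t * v y) y \<le> 0" by simp
      next
        fix y assume y: "y \<in> frontier X"
        have "w y \<le> g y" using w(2) y by (auto simp: dual_feasible_def)
        moreover have "0 \<le> t * v y" using t v(4)[OF y] True by simp
        ultimately show "w y + - t * v y \<le> g y" by simp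
      qed
      from bspec[OF D this] show ?thesis by simp
    qed
    note bound = this
    have "0 \<le> v x"
    proof (rule ccontr)
      assume "\<not> 0 \<le> v x"
      then have vx: "v x < 0" by simp
      \<comment> \<open>Far enough along the ray for the value at \<open>x\<close> to be at least D
        + 1.\<close>
      define t where "t = (\<bar>D - w x\<bar> + 1) / (- v x)"
      have "t \<ge> 0" unfolding t_def using vx by (intro divide_nonneg_pos) auto
      moreover have "t * (- v x) = \<bar>D - w x\<bar> + 1" using vx by (simp add: t_def)
      ultimately show False using bound[of t] by linarith
    qed
    then show ?thesis using True by simp
  qed
qed

text \<open>The infimum over majorants is finite: the set is nonempty by
  \<open>majorant_exists\<close>, and a majorant of \<phi> plus one of - \<phi> majorizes 0, so its
  value is nonnegative by \<open>majorant_0_value\<close>. Sublinearity is inherited from sums and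
  multiples of majorants.\<close>

lemma dual_functional:
  assumes D: "\<forall>v\<in>dual_feasible X b B g. v x \<le> D" and g: "continuous_on (frontier X) g"
  obtains l :: "(real ^ 'n + real ^ 'n \<Rightarrow> real) \<Rightarrow> real"
  where "\<And>\<phi> \<psi>. bounded (\<phi> ` primal_index) \<Longrightarrow> bounded (\<psi> ` primal_index) \<Longrightarrow> l (\<lambda>k. \<phi> k + \<psi> k) = l \<phi> + l \<psi>"
    "\<And>\<phi> c. bounded (\<phi> ` primal_index) \<Longrightarrow> l (\<lambda>k. c * \<phi> k) = c * l \<phi>"
    "\<And>\<phi> v \<beta>. bounded (\<phi> ` primal_index) \<Longrightarrow> majorant g \<phi> v \<beta> \<Longrightarrow> l \<phi> \<le> v x + \<beta> * D"
proof -
  define E where "E = {\<phi> :: real ^ 'n + real ^ 'n \<Rightarrow> real. bounded (\<phi> ` primal_index)}"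
  define V where "V \<phi> = {v x + \<beta> * D | v \<beta>. majorant g \<phi> v \<beta>}" for \<phi>
  define p where "p \<phi> = Inf (V \<phi>)" for \<phi>
  have val: "0 \<le> v x + \<beta> * D" if "majorant g (\<lambda>_. 0) v \<beta>" for v \<beta>
    by (rule majorant_0_value[OF D g that])
  have E0: "(\<lambda>_. 0) \<in> E" by (auto simp: E_def intro: bounded_subset[of "{0}"])
  have Ea: "(\<lambda>k. \<phi> k + \<psi> k) \<in> E" if "\<phi> \<in> E" "\<psi> \<in> E" for \<phi> \<psi>
    using that by (simp add: E_def bounded_plus_comp)
  have Es: "(\<lambda>k. c * \<phi> k) \<in> E" if "\<phi> \<in> E" for \<phi> c
    using bounded_scaling[of "\<phi> ` primal_index" c] that by (simp add: E_def image_image)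
  have ne: "V \<phi> \<noteq> {}" if \<phi>: "\<phi> \<in> E" for \<phi>
  proof -
    obtain v where "majorant g \<phi> v 0" using majorant_exists[of \<phi> g] \<phi> unfolding E_def by blast
    then show ?thesis unfolding V_def by blast
  qed
  have bdd: "bdd_below (V \<phi>)" if \<phi>: "\<phi> \<in> E" for \<phi>
  proof -
    have "bounded ((\<lambda>k. - 1 * \<phi> k) ` primal_index)"
      using Es[OF \<phi>, of "- 1"] by (simp only: E_def mem_Collect_eq)
    then obtain w where w: "majorant g (\<lambda>k. - 1 * \<phi> k) w 0" by (rule majorant_exists)
    show ?thesis
    proof (rule bdd_belowI[of _ "- w x"])
      fix r assume "r \<in> V \<phi>"
      then obtain v \<beta> where v: "r = v x + \<beta> * D" "majorant g \<phi> v \<beta>" by (auto simp: V_def)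
      have "majorant g (\<lambda>_. 0) (\<lambda>y. v y + w y) (\<beta> + 0)"
        using majorant_add[OF v(2) w] by simp
      from val[OF this] show "- w x \<le> r" using v(1) by simp
    qed
  qed
  have le: "p \<phi> \<le> v x + \<beta> * D" if "\<phi> \<in> E" "majorant g \<phi> v \<beta>" for \<phi> v \<beta>
    unfolding p_def using that by (intro cInf_lower bdd) (auto simp: V_def)
  have ge: "c \<le> p \<phi>" if "\<phi> \<in> E" "\<And>v \<beta>. majorant g \<phi> v \<beta> \<Longrightarrow> c \<le> v x + \<beta> * D" for c \<phi>
    unfolding p_def using that(2) by (intro cInf_greatest ne[OF that(1)]) (auto simp: V_def)
  have "sublinear_on E p"
  proof (rule sublinear_onI)
    fix \<phi> \<psi> assume e: "\<phi> \<in> E" "\<psi> \<in> E"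
    have *: "p (\<lambda>k. \<phi> k + \<psi> k) \<le> (v x + \<beta> * D) + (w x + \<gamma> * D)"
      if "majorant g \<phi> v \<beta>" "majorant g \<psi> w \<gamma>" for v \<beta> w \<gamma>
      using le[OF Ea[OF e] majorant_add[OF that]] by (simp add: algebra_simps)
    have **: "p (\<lambda>k. \<phi> k + \<psi> k) - (v x + \<beta> * D) \<le> p \<psi>" if m: "majorant g \<phi> v \<beta>" for v \<beta>
    proof (rule ge[OF e(2)])
      fix w \<gamma> assume "majorant g \<psi> w \<gamma>"
      from *[OF m this] show "p (\<lambda>k. \<phi> k + \<psi> k) - (v x + \<beta> * D) \<le> w x + \<gamma> * D" by linarith
    qed
    have "p (\<lambda>k. \<phi> k + \<psi> k) - p \<psi> \<le> p \<phi>"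
    proof (rule ge[OF e(1)])
      fix v \<beta> assume "majorant g \<phi> v \<beta>"
      from **[OF this] show "p (\<lambda>k. \<phi> k + \<psi> k) - p \<psi> \<le> v x + \<beta> * D" by linarith
    qed
    then show "p (\<lambda>k. \<phi> k + \<psi> k) \<le> p \<phi> + p \<psi>" by linarith
  next
    fix \<phi> and c :: real assume e: "\<phi> \<in> E" and c: "c > 0"
    have "p (\<lambda>k. c * \<phi> k) / c \<le> p \<phi>"
    proof (rule ge[OF e])
      fix v \<beta> assume m: "majorant g \<phi> v \<beta>"
      from le[OF Es[OF e] majorant_scale[OF m less_imp_le[OF c]]]
      show "p (\<lambda>k. c * \<phi> k) / c \<le> v x + \<beta> * D" using c by (simp add: field_simps)
    qed
    then show "p (\<lambda>k. c * \<phi> k) \<le> c * p \<phi>" using c by (simp add: field_simps)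
  next
    have "L (\<lambda>_. 0) y = 0" for y by (rule L_op_const)
    then have "majorant g (\<lambda>_. 0) (\<lambda>_. 0) 0" by (auto simp: majorant_def C2_closure_0[OF open_X])
    from le[OF E0 this] have "p (\<lambda>_. 0) \<le> 0" by simp
    moreover have "0 \<le> p (\<lambda>_. 0)" by (rule ge[OF E0]) (rule val)
    ultimately show "p (\<lambda>_. 0) = 0" by simp
  qed
  then obtain l where l: "\<And>\<phi> \<psi>. \<phi> \<in> E \<Longrightarrow> \<psi> \<in> E \<Longrightarrow> l (\<lambda>k. \<phi> k + \<psi> k) = l \<phi> + l \<psi>"
    "\<And>\<phi> c. \<phi> \<in> E \<Longrightarrow> l (\<lambda>k. c * \<phi> k) = c * l \<phi>" "\<And>\<phi>. \<phi> \<in> E \<Longrightarrow> l \<phi> \<le> p \<phi>"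
    using hahn_banach_sublinear[OF E0 Ea Es] by blast
  show ?thesis
  proof (rule that[of l])
    show "l \<phi> \<le> v x + \<beta> * D" if "bounded (\<phi> ` primal_index)" "majorant g \<phi> v \<beta>" for \<phi> v \<beta>
      using l(3)[of \<phi>] le[of \<phi> v \<beta>] that by (simp add: E_def)
  qed (use l(1,2) in \<open>simp_all add: E_def\<close>)
qed

end

lemma bounded_case_sum:
  assumes "bounded (\<phi> ` A)" "bounded (\<psi> ` C)"
  shows "bounded (case_sum \<phi> \<psi> ` (Inl ` A \<union> Inr ` C))"
  using assms by (simp add: image_Un image_image)

context elliptic_domain
begin

text \<open>Compactness yields the first measure only on the closed domain. Testing with \<open>\<theta>\<close>, for which
  \<open>- L \<theta> \<ge> K\<close> on the frontier with \<open>K\<close> arbitrary, shows that the frontier carries no mass.\<close>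

lemma frontier_null:
  assumes N0: "finite_measure N0" "sets N0 = sets (restrict_space borel (closure X))"
    and N1: "finite_measure N1" "sets N1 = sets (restrict_space borel (frontier X))"
    and x: "x \<in> X"
    and eq: "\<And>f \<Lambda>. f \<in> C2_closure X \<Longrightarrow> continuous_on (closure X) \<Lambda> \<Longrightarrow> (\<And>y. y \<in> X \<Longrightarrow> \<Lambda> y = L f y) \<Longrightarrow>
        (\<integral>y. f y \<partial>N1) + (\<integral>y. \<Lambda> y \<partial>N0) = f x"
  shows "measure N0 (frontier X) = 0"
proof -
  interpret N0: finite_measure N0 by fact
  interpret N1: finite_measure N1 by fact
  have sp: "space N0 = closure X" "space N1 = frontier X"
    using sets_eq_imp_space_eq[OF N0(2)] sets_eq_imp_space_eq[OF N1(2)] by (auto simp: space_restrict_space)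
  have fr: "frontier X \<in> sets N0"
    unfolding N0(2) sets_restrict_space
    by (rule image_eqI[of _ _ "frontier X"]) (use closure_X in auto)
  \<comment> \<open>Since \<theta> x \<ge> 0 and \<theta> = 1 on the frontier, the tested equation
    bounds the integral of - L \<theta> by the mass of \<open>N1\<close>, whatever K is.\<close>
  have bound: "K * measure N0 (frontier X) \<le> measure N1 (space N1)" if K: "K > 0" for K
  proof -
    obtain \<theta> U where U: "open U" "closure X \<subseteq> U" "Ck_on 2 U \<theta>"
      and \<theta>: "\<forall>y\<in>closure X. 0 \<le> \<theta> y \<and> \<theta> y \<le> 1 \<and> L \<theta> y \<le> 0 \<and> (1/8 \<le> \<theta> y \<longrightarrow> L \<theta> y \<le> - K)"
      and \<theta>1: "\<forall>y\<in>frontier X. \<theta> y = 1"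
      using boundary_layer_subsolution[OF K] by blast
    have cL: "continuous_on (closure X) (L \<theta>)"
      by (rule continuous_on_subset[OF continuous_on_L_op[OF U(1,3) continuous_on_coefficients] U(2)])
    have "(\<integral>y. \<theta> y \<partial>N1) + (\<integral>y. L \<theta> y \<partial>N0) = \<theta> x"
      by (rule eq[OF C2_closureI[OF open_X U] cL]) simp
    moreover have "0 \<le> \<theta> x" using \<theta> x closure_X by blast
    moreover have "(\<integral>y. \<theta> y \<partial>N1) = measure N1 (space N1)"
    proof -
      have "(\<integral>y. \<theta> y \<partial>N1) = (\<integral>y. 1 \<partial>N1)"
        by (rule Bochner_Integration.integral_cong[OF refl]) (use \<theta>1 sp in auto)
      then show ?thesis by simp
    qed
    moreover have "K * measure N0 (frontier X) \<le> (\<integral>y. - L \<theta> y \<partial>N0)"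
    proof -
      have "K * measure N0 (frontier X) = (\<integral>y. K * indicator (frontier X) y \<partial>N0)" using fr by simp
      also have "\<dots> \<le> (\<integral>y. - L \<theta> y \<partial>N0)"
      proof (rule integral_mono)
        show "integrable N0 (\<lambda>y. K * indicator (frontier X) y)"
          using fr N0.emeasure_finite by (intro integrable_mult_right integrable_real_indicator) (auto simp: less_top[symmetric])
        show "integrable N0 (\<lambda>y. - L \<theta> y)"
          by (rule integrable_continuous_on_compact[OF compact_closure_X N0 continuous_on_minus[OF cL]])
        fix y assume "y \<in> space N0"
        then have y: "y \<in> closure X" using sp by simp
        show "K * indicator (frontier X) y \<le> - L \<theta> y"
        proof (cases "y \<in> frontier X")
          case True
          then have "\<theta> y = 1" using \<theta>1 by blast
          then have "L \<theta> y \<le> - K" using \<theta> y by auto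
          then show ?thesis using True by simp
        next
          case False
          then show ?thesis using \<theta> y by auto
        qed
      qed
      finally show ?thesis .
    qed
    ultimately show ?thesis by simp
  qed
  show ?thesis
  proof (rule ccontr)
    assume "measure N0 (frontier X) \<noteq> 0"
    then have m: "measure N0 (frontier X) > 0" by (simp add: zero_less_measure_iff)
    have "(measure N1 (space N1) + 1) / measure N0 (frontier X) * measure N0 (frontier X) \<le> measure N1 (space N1)"
      using m by (intro bound divide_pos_pos add_nonneg_pos) auto
    then show False using m by simp
  qed
qed

lemma strong_duality:
  assumes D: "\<forall>v\<in>dual_feasible X b B g. v x \<le> D" and g: "continuous_on (frontier X) g"
    and x: "x \<in> X"
  obtains \<mu> \<nu> where "(\<mu>, \<nu>) \<in> primal_feasible X b B x" "(\<integral>y. g y \<partial>\<nu>) \<le> D"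
proof -
  obtain l :: "(real ^ 'n + real ^ 'n \<Rightarrow> real) \<Rightarrow> real" where
    l_add: "\<And>\<phi> \<psi>. bounded (\<phi> ` primal_index) \<Longrightarrow> bounded (\<psi> ` primal_index) \<Longrightarrow> l (\<lambda>k. \<phi> k + \<psi> k) = l \<phi> + l \<psi>"
    and l_scale: "\<And>\<phi> c. bounded (\<phi> ` primal_index) \<Longrightarrow> l (\<lambda>k. c * \<phi> k) = c * l \<phi>"
    and l_le: "\<And>\<phi> v \<beta>. bounded (\<phi> ` primal_index) \<Longrightarrow> majorant g \<phi> v \<beta> \<Longrightarrow> l \<phi> \<le> v x + \<beta> * D"
    using dual_functional[OF D g] by blast
  have bc: "bounded ((\<lambda>_. c :: real) ` S)" for c and S :: "'z set"
    by (rule bounded_subset[of "{c}"]) auto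
  have bcase: "bounded (case_sum \<phi> \<psi> ` primal_index)" if "bounded (\<phi> ` X)" "bounded (\<psi> ` frontier X)"
    for \<phi> \<psi> :: "real ^ 'n \<Rightarrow> real"
    unfolding primal_index_def by (rule bounded_case_sum[OF that])
  have bminus: "bounded ((\<lambda>k. - 1 * \<phi> k) ` primal_index)" if "bounded (\<phi> ` primal_index)" for \<phi> :: "real ^ 'n + real ^ 'n \<Rightarrow> real"
    using bounded_scaling[of "\<phi> ` primal_index" "-1"] that by (simp add: image_image)
  have l_minus: "l (\<lambda>k. - 1 * \<phi> k) = - l \<phi>" if "bounded (\<phi> ` primal_index)" for \<phi> :: "real ^ 'n + real ^ 'n \<Rightarrow> real"
    using l_scale[OF that, of "-1"] by simp
  have l_mono: "l \<phi> \<le> l \<psi>" if b: "bounded (\<phi> ` primal_index)" "bounded (\<psi> ` primal_index)"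
    and le: "\<And>k. k \<in> primal_index \<Longrightarrow> \<phi> k \<le> \<psi> k" for \<phi> \<psi>
  proof -
    have "l (\<lambda>k. \<phi> k + - 1 * \<psi> k) \<le> (\<lambda>_. 0) x + 0 * D"
    proof (rule l_le)
      show "bounded ((\<lambda>k. \<phi> k + - 1 * \<psi> k) ` primal_index)"
        by (rule bounded_plus_comp[OF b(1) bminus[OF b(2)]])
      show "majorant g (\<lambda>k. \<phi> k + - 1 * \<psi> k) (\<lambda>_. 0) 0"
        using le C2_closure_0[OF open_X] by (auto simp: majorant_def L_op_const primal_index_def)
    qed
    then show ?thesis using l_add[OF b(1) bminus[OF b(2)]] l_minus[OF b(2)] by simp
  qed
  have l_cong: "l \<phi> = l \<psi>" if b: "bounded (\<phi> ` primal_index)" "bounded (\<psi> ` primal_index)"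
    and eq: "\<And>k. k \<in> primal_index \<Longrightarrow> \<phi> k = \<psi> k" for \<phi> \<psi>
    by (rule antisym; rule l_mono) (use b eq in auto)
  \<comment> \<open>The functional sees only values on \<open>X\<close>, but is represented on the
    compact closure; a priori its measure may charge the frontier.\<close>
  define l0 where "l0 \<phi> = l (case_sum \<phi> (\<lambda>_. 0))" for \<phi>
  define l1 where "l1 \<psi> = l (case_sum (\<lambda>_. 0) \<psi>)" for \<psi>
  have b0: "bounded (case_sum \<phi> (\<lambda>_. 0) ` primal_index)" if "bounded (\<phi> ` closure X)" for \<phi> :: "real ^ 'n \<Rightarrow> real"
    using that bounded_subset[OF that image_mono[OF closure_subset]] by (intro bcase bc) auto
  have b1: "bounded (case_sum (\<lambda>_. 0) \<psi> ` primal_index)" if "bounded (\<psi> ` frontier X)" for \<psi> :: "real ^ 'n \<Rightarrow> real"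
    using that by (intro bcase bc) auto
  interpret p0: positive_functional "closure X" l0
  proof
    show "compact (closure X)" by (rule compact_closure_X)
    show "l0 (\<lambda>y. \<phi> y + \<psi> y) = l0 \<phi> + l0 \<psi>" if "bounded (\<phi> ` closure X)" "bounded (\<psi> ` closure X)" for \<phi> \<psi>
      unfolding l0_def l_add[OF b0[OF that(1)] b0[OF that(2)], symmetric]
      by (intro arg_cong[of _ _ l] ext) (simp split: sum.split)
    show "l0 (\<lambda>y. c * \<phi> y) = c * l0 \<phi>" if "bounded (\<phi> ` closure X)" for \<phi> c
      unfolding l0_def l_scale[OF b0[OF that], symmetric]
      by (intro arg_cong[of _ _ l] ext) (simp split: sum.split)
    show "l0 \<phi> \<le> l0 \<psi>" if "bounded (\<phi> ` closure X)" "bounded (\<psi> ` closure X)"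
      "\<And>y. y \<in> closure X \<Longrightarrow> \<phi> y \<le> \<psi> y" for \<phi> \<psi>
      unfolding l0_def using that closure_X
      by (intro l_mono b0) (auto simp: primal_index_def split: sum.split)
  qed
  interpret p1: positive_functional "frontier X" l1
  proof
    show "compact (frontier X)" by (rule compact_frontier_X)
    show "l1 (\<lambda>y. \<phi> y + \<psi> y) = l1 \<phi> + l1 \<psi>" if "bounded (\<phi> ` frontier X)" "bounded (\<psi> ` frontier X)" for \<phi> \<psi>
      unfolding l1_def l_add[OF b1[OF that(1)] b1[OF that(2)], symmetric]
      by (intro arg_cong[of _ _ l] ext) (simp split: sum.split)
    show "l1 (\<lambda>y. c * \<phi> y) = c * l1 \<phi>" if "bounded (\<phi> ` frontier X)" for \<phi> c
      unfolding l1_def l_scale[OF b1[OF that], symmetric]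
      by (intro arg_cong[of _ _ l] ext) (simp split: sum.split)
    show "l1 \<phi> \<le> l1 \<psi>" if "bounded (\<phi> ` frontier X)" "bounded (\<psi> ` frontier X)"
      "\<And>y. y \<in> frontier X \<Longrightarrow> \<phi> y \<le> \<psi> y" for \<phi> \<psi>
      unfolding l1_def using that
      by (intro l_mono b1) (auto simp: primal_index_def split: sum.split)
  qed
  obtain N0 where N0: "sets N0 = sets (restrict_space borel (closure X))" "space N0 = closure X" "finite_measure N0"
    and I0: "\<And>\<phi>. continuous_on (closure X) \<phi> \<Longrightarrow> (\<integral>y. \<phi> y \<partial>N0) = l0 \<phi>"
    using p0.riesz_representation by blast
  obtain N1 where N1: "sets N1 = sets (restrict_space borel (frontier X))" "space N1 = frontier X" "finite_measure N1"
    and I1: "\<And>\<phi>. continuous_on (frontier X) \<phi> \<Longrightarrow> (\<integral>y. \<phi> y \<partial>N1) = l1 \<phi>"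
    using p1.riesz_representation by blast
  have bcl: "bounded (f ` closure X)" if "continuous_on (closure X) f" for f :: "real ^ 'n \<Rightarrow> real"
    using compact_imp_bounded[OF compact_continuous_image[OF that compact_closure_X]] .
  have bfr: "bounded (f ` frontier X)" if "continuous_on (frontier X) f" for f :: "real ^ 'n \<Rightarrow> real"
    using compact_imp_bounded[OF compact_continuous_image[OF that compact_frontier_X]] .
  have eq: "(\<integral>y. f y \<partial>N1) + (\<integral>y. \<Lambda> y \<partial>N0) = f x"
    if f: "f \<in> C2_closure X" and \<Lambda>: "continuous_on (closure X) \<Lambda>" "\<And>y. y \<in> X \<Longrightarrow> \<Lambda> y = L f y" for f \<Lambda>
  proof -
    have fc: "continuous_on (frontier X) f"
      using C2_closureD(2)[OF f] closure_X by (auto intro: continuous_on_subset)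
    note b = b0[OF bcl[OF \<Lambda>(1)]] b1[OF bfr[OF fc]]
    \<comment> \<open>On \<open>primal_index\<close> this is the pair (L f, f). Both f and - f yield
      majorants without slack, so the two upper bounds combine to an equality.\<close>
    let ?T = "\<lambda>k. case_sum \<Lambda> (\<lambda>_. 0) k + case_sum (\<lambda>_. 0) f k"
    have bT: "bounded (?T ` primal_index)" by (rule bounded_plus_comp[OF b])
    have "(\<integral>y. f y \<partial>N1) + (\<integral>y. \<Lambda> y \<partial>N0) = l ?T"
      by (simp add: I0[OF \<Lambda>(1)] I1[OF fc] l0_def l1_def l_add[OF b])
    moreover have "l ?T \<le> f x + 0 * D"
      by (rule l_le[OF bT]) (use f \<Lambda> in \<open>auto simp: majorant_def\<close>)
    moreover have "l (\<lambda>k. - 1 * ?T k) \<le> - 1 * f x + 0 * D"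
    proof (rule l_le[OF bminus[OF bT]])
      have "L (\<lambda>y. - 1 * f y) y = - 1 * L f y" if "y \<in> X" for y
        by (rule L_op_scale[OF open_X C2_closureD(1)[OF f] that])
      then show "majorant g (\<lambda>k. - 1 * ?T k) (\<lambda>y. - 1 * f y) 0"
        using C2_closure_scale[OF open_X f, of "-1"] \<Lambda> by (auto simp: majorant_def)
    qed
    ultimately show ?thesis using l_minus[OF bT] by linarith
  qed
  have null: "measure N0 (frontier X) = 0"
    by (rule frontier_null[OF N0(3,1) N1(3,1) x eq])
  interpret N0: finite_measure N0 by (rule N0(3))
  have fr: "frontier X \<in> sets N0"
    unfolding N0(1) sets_restrict_space
    by (rule image_eqI[of _ _ "frontier X"]) (use closure_X in auto)
  have XN0: "X \<in> sets N0"
    unfolding N0(1) sets_restrict_space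
    by (rule image_eqI[of _ _ X]) (use closure_X open_X in auto)
  define \<mu> where "\<mu> = restrict_space N0 X"
  have \<mu>: "\<mu> \<in> measures_on X"
  proof -
    have "X \<inter> (closure X \<inter> A) = X \<inter> A" for A using closure_X by blast
    then have "sets \<mu> = sets (restrict_space borel X)"
      by (simp add: \<mu>_def sets_restrict_space N0(1) image_image)
    then show ?thesis using finite_measure_restrict_space[OF N0(3) XN0] by (simp add: measures_on_def \<mu>_def)
  qed
  have \<nu>: "N1 \<in> measures_on (frontier X)" using N1 by (simp add: measures_on_def)
  have "(\<integral>y. f y \<partial>N1) + (\<integral>y. L f y \<partial>\<mu>) = f x" if f: "f \<in> C2_closure X" for f
  proof -
    obtain \<Lambda> where \<Lambda>: "continuous_on (closure X) \<Lambda>" "\<And>y. y \<in> X \<Longrightarrow> \<Lambda> y = L f y" using L_extends[OF f] by blast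
    have int: "integrable N0 \<Lambda>"
      by (rule integrable_continuous_on_compact[OF compact_closure_X N0(3,1) \<Lambda>(1)])
    \<comment> \<open>Restricting the measure to \<open>X\<close> loses nothing because the frontier
      is a null set, and on \<open>X\<close> the extension is \<open>L f\<close>.\<close>
    have "(\<integral>y. L f y \<partial>\<mu>) = (\<integral>y. indicator X y *\<^sub>R L f y \<partial>N0)"
      unfolding \<mu>_def by (rule integral_restrict_space) (use XN0 in auto)
    also have "\<dots> = (\<integral>y. indicator X y *\<^sub>R \<Lambda> y \<partial>N0)"
      by (rule Bochner_Integration.integral_cong[OF refl]) (auto simp: indicator_def \<Lambda>(2))
    also have "\<dots> = (\<integral>y. \<Lambda> y \<partial>N0)"
    proof (rule integral_cong_AE)
      have "emeasure N0 (frontier X) = 0" using null N0.emeasure_eq_measure by simp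
      then have "AE y in N0. y \<notin> frontier X" using fr by (intro AE_not_in) (auto simp: null_sets_def)
      then show "AE y in N0. indicator X y *\<^sub>R \<Lambda> y = \<Lambda> y"
        by (rule AE_mp) (use N0(2) closure_X in \<open>auto intro!: AE_I2\<close>)
    qed (use int XN0 in auto)
    finally show ?thesis using eq[OF f \<Lambda>] by simp
  qed
  then have "(\<mu>, N1) \<in> primal_feasible X b B x" using \<mu> \<nu> by (simp add: primal_feasible_def)
  moreover have "(\<integral>y. g y \<partial>N1) \<le> D"
  proof -
    have "l (case_sum (\<lambda>_. 0) g) \<le> (\<lambda>_. 0) x + 1 * D"
      by (rule l_le[OF b1[OF bfr[OF g]]])
        (auto simp: majorant_def L_op_const C2_closure_0[OF open_X])
    then show ?thesis using I1[OF g] by (simp add: l1_def)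
  qed
  ultimately show ?thesis by (rule that)
qed

text \<open>Strong duality is needed only for a finite dual value: the value +\<infinity> bounds
  everything, and -\<infinity> is excluded by a feasible function.\<close>

lemma no_duality_gap:
  assumes g: "continuous_on (frontier X) g" and x: "x \<in> X"
  shows "dual_value X b B g x = primal_value X b B g x"
proof (rule antisym)
  show "dual_value X b B g x \<le> primal_value X b B g x"
    unfolding dual_value_def primal_value_def
    by (auto intro!: SUP_least INF_greatest weak_duality[OF _ _ x g])
  show "primal_value X b B g x \<le> dual_value X b B g x"
  proof (cases "dual_value X b B g x")
    case (real D)
    have "\<forall>v\<in>dual_feasible X b B g. v x \<le> D"
    proof
      fix v assume v: "v \<in> dual_feasible X b B g"
      have "ereal (v x) \<le> dual_value X b B g x" unfolding dual_value_def by (rule SUP_upper[OF v])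
      then show "v x \<le> D" using real by simp
    qed
    then obtain \<mu> \<nu> where \<mu>\<nu>: "(\<mu>, \<nu>) \<in> primal_feasible X b B x" "(\<integral>y. g y \<partial>\<nu>) \<le> D"
      using strong_duality[OF _ g x, where D=D] by blast
    have "primal_value X b B g x \<le> ereal (\<integral>y. g y \<partial>\<nu>)"
      unfolding primal_value_def using INF_lower[OF \<mu>\<nu>(1), of "\<lambda>(\<mu>, \<nu>). ereal (\<integral>y. g y \<partial>\<nu>)"] by simp
    also have "\<dots> \<le> dual_value X b B g x" using \<mu>\<nu>(2) real by simp
    finally show ?thesis .
  next
    case MInf
    obtain v where v: "v \<in> dual_feasible X b B g" using dual_feasible_exists[OF g] by blast
    have "ereal (v x) \<le> dual_value X b B g x" unfolding dual_value_def by (rule SUP_upper[OF v])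
    then show ?thesis using MInf by simp
  qed simp
qed

section \<open>The Lagrange dual function\<close>

lemma zero_measure_on: "null_measure (restrict_space borel S) \<in> measures_on S"
  by (auto simp: measures_on_def intro!: finite_measureI)

text \<open>The multiple t of the Dirac measure at y, living on the subspace \<open>S\<close>.
  Writing t as a constant density reduces its integrals to the rules for \<open>density\<close> and
  \<open>return\<close>.\<close>

definition point_mass :: "(real ^ 'n) set \<Rightarrow> real \<Rightarrow> real ^ 'n \<Rightarrow> (real ^ 'n) measure" where
  "point_mass S t y = density (return (restrict_space borel S) y) (\<lambda>_. ennreal t)"

lemma space_borel_restrict: "space (restrict_space borel S) = (S :: (real ^ 'n) set)"
  by (simp add: space_restrict_space)

lemma point_mass_on:
  assumes "y \<in> S"
  shows "point_mass S t y \<in> measures_on S"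
proof -
  let ?R = "return (restrict_space borel S) y"
  have "emeasure (point_mass S t y) (space ?R) = ennreal t * emeasure ?R (space ?R)"
    unfolding point_mass_def by (rule emeasure_density_const) simp
  also have "emeasure ?R (space ?R) = 1"
    using assms by (intro prob_space.emeasure_space_1 prob_space_return) (simp add: space_borel_restrict)
  finally have "finite_measure (point_mass S t y)"
    by (intro finite_measureI) (simp add: point_mass_def)
  then show ?thesis by (simp add: measures_on_def point_mass_def)
qed

lemma integral_point_mass:
  fixes f :: "real ^ 'n \<Rightarrow> real"
  assumes f: "f \<in> borel_measurable (restrict_space borel S)" and "y \<in> S" "t \<ge> 0"
  shows "(\<integral>z. f z \<partial>point_mass S t y) = t * f y"
proof -
  let ?R = "return (restrict_space borel S) y"
  have "(\<integral>z. f z \<partial>point_mass S t y) = (\<integral>z. t *\<^sub>R f z \<partial>?R)"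
    unfolding point_mass_def using f assms(3) by (intro integral_density) auto
  also have "\<dots> = t *\<^sub>R f y"
    using f assms(2) by (intro integral_return) (auto simp: space_borel_restrict)
  finally show ?thesis by simp
qed

lemma nn_integral_point_mass:
  assumes f: "f \<in> borel_measurable (restrict_space borel S)" and "y \<in> S"
  shows "(\<integral>\<^sup>+z. f z \<partial>point_mass S t y) = ennreal t * f y"
proof -
  let ?R = "return (restrict_space borel S) y"
  have "(\<integral>\<^sup>+z. f z \<partial>point_mass S t y) = (\<integral>\<^sup>+z. ennreal t * f z \<partial>?R)"
    unfolding point_mass_def using f by (intro nn_integral_density) auto
  also have "\<dots> = ennreal t * f y"
    using f assms(2) by (intro nn_integral_return) (auto simp: space_borel_restrict)
  finally show ?thesis .
qed

text \<open>For feasible \<open>v\<close> both integrals in the Lagrangian are nonnegative and the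
  zero measures make them vanish. Otherwise a constraint fails at a point, and growing multiples of
  the Dirac measure there drive the Lagrangian to -\<infinity>.\<close>

lemma lagrange_dual_function_eq:
  assumes v: "v \<in> C2_interior X" and g: "continuous_on (frontier X) g"
  shows "lagrange_dual_function X b B g x v = (if v \<in> dual_feasible X b B g then ereal (v x) else - \<infinity>)"
proof -
  let ?Lag = "lagrangian b B g x"
  let ?z = "\<lambda>S. null_measure (restrict_space borel S) :: (real ^ 'n) measure"
  have v2: "Ck_on 2 X v" and vc: "continuous_on (closure X) v" using v by (auto simp: C2_interior_def)
  have Lm: "L v \<in> borel_measurable (restrict_space borel X)"
    by (rule borel_measurable_continuous_on_restrict[OF continuous_on_L_op[OF open_X v2 continuous_on_coefficients]])
  have gvm: "(\<lambda>y. g y - v y) \<in> borel_measurable (restrict_space borel (frontier X))"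
    using closure_X by (intro borel_measurable_continuous_on_restrict continuous_intros g continuous_on_subset[OF vc]) auto
  have upper: "lagrange_dual_function X b B g x v \<le> ?Lag \<mu> \<nu> v"
    if "\<mu> \<in> measures_on X" "\<nu> \<in> measures_on (frontier X)" for \<mu> \<nu>
    unfolding lagrange_dual_function_def
    using INF_lower[of "(\<mu>, \<nu>)" "measures_on X \<times> measures_on (frontier X)" "\<lambda>(\<mu>, \<nu>). ?Lag \<mu> \<nu> v"] that by simp
  show ?thesis
  proof (cases "v \<in> dual_feasible X b B g")
    case True
    then have Lv: "\<And>y. y \<in> X \<Longrightarrow> L v y \<le> 0" and vg: "\<And>y. y \<in> frontier X \<Longrightarrow> v y \<le> g y"
      by (auto simp: dual_feasible_def)
    have "?Lag (?z X) (?z (frontier X)) v = ereal (v x)"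
      by (simp add: lagrangian_def ext_integral_def)
    then have 1: "lagrange_dual_function X b B g x v \<le> ereal (v x)"
      using upper[OF zero_measure_on zero_measure_on] by simp
    have "ereal (v x) \<le> ?Lag \<mu> \<nu> v" if \<mu>: "\<mu> \<in> measures_on X" and \<nu>: "\<nu> \<in> measures_on (frontier X)" for \<mu> \<nu>
    proof -
      have "0 \<le> (\<integral>y. g y - v y \<partial>\<nu>)"
        using vg measures_onD(3)[OF \<nu>] by (intro integral_nonneg_AE AE_I2) auto
      moreover have "(\<integral>\<^sup>+y. ennreal (- (- L v y)) \<partial>\<mu>) = (\<integral>\<^sup>+y. 0 \<partial>\<mu>)"
        using Lv measures_onD(3)[OF \<mu>] by (intro nn_integral_cong) (auto simp: ennreal_neg)
      then have "0 \<le> ext_integral \<mu> (\<lambda>y. - L v y)"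
        by (simp add: ext_integral_def zero_ennreal.rep_eq enn2ereal_nonneg)
      ultimately have "0 + 0 + ereal (v x) \<le> ?Lag \<mu> \<nu> v"
        unfolding lagrangian_def by (intro add_mono) auto
      then show ?thesis by simp
    qed
    then have "ereal (v x) \<le> lagrange_dual_function X b B g x v"
      unfolding lagrange_dual_function_def by (intro INF_greatest) auto
    with 1 True show ?thesis by simp
  next
    case False
    then consider y where "y \<in> X" "L v y > 0" | y where "y \<in> frontier X" "v y > g y"
      using v by (auto simp: dual_feasible_def not_le)
    \<comment> \<open>The amount \<open>c\<close> of the violation is the rate of decrease,
      whichever constraint fails.\<close>
    then obtain c where c: "c > 0" and le: "\<And>t. t > 0 \<Longrightarrow> lagrange_dual_function X b B g x v \<le> ereal (- t * c + v x)"
    proof cases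
      case 1
      have "lagrange_dual_function X b B g x v \<le> ereal (- t * L v y + v x)" if t: "t > 0" for t
      proof -
        have "(\<integral>\<^sup>+z. ennreal (- L v z) \<partial>point_mass X t y) = 0"
          using Lm 1 by (subst nn_integral_point_mass) (auto simp: ennreal_neg)
        moreover have "(\<integral>\<^sup>+z. ennreal (- (- L v z)) \<partial>point_mass X t y) = ennreal (t * L v y)"
          using Lm 1 t by (subst nn_integral_point_mass) (auto simp: ennreal_mult)
        ultimately have "ext_integral (point_mass X t y) (\<lambda>y. - L v y) = ereal (- (t * L v y))"
          using 1 t by (simp add: ext_integral_def enn2ereal_ennreal zero_ennreal.rep_eq)
        then have "?Lag (point_mass X t y) (?z (frontier X)) v = ereal (- t * L v y + v x)"
          by (simp add: lagrangian_def)
        then show ?thesis using upper[OF point_mass_on[OF 1(1)] zero_measure_on] by metis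
      qed
      then show ?thesis using that[of "L v y"] 1(2) by blast
    next
      case 2
      have "lagrange_dual_function X b B g x v \<le> ereal (- t * (v y - g y) + v x)" if t: "t > 0" for t
      proof -
        have "(\<integral>z. g z - v z \<partial>point_mass (frontier X) t y) = - t * (v y - g y)"
          using t by (subst integral_point_mass[OF gvm 2(1)]) (auto simp: algebra_simps)
        then have "?Lag (?z X) (point_mass (frontier X) t y) v = ereal (- t * (v y - g y) + v x)"
          by (simp add: lagrangian_def ext_integral_def)
        then show ?thesis using upper[OF zero_measure_on point_mass_on[OF 2(1)]] by metis
      qed
      then show ?thesis using that[of "v y - g y"] 2(2) by simp
    qed
    have "lagrange_dual_function X b B g x v \<le> ereal r" for r
    proof -
      define t where "t = (\<bar>v x - r\<bar> + 1) / c"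
      have "t > 0" "t * c = \<bar>v x - r\<bar> + 1" using c by (auto simp: t_def)
      then have "- t * c + v x \<le> r" by simp
      then show ?thesis using le[OF \<open>t > 0\<close>] by (meson ereal_less_eq(3) order_trans)
    qed
    then have "lagrange_dual_function X b B g x v = - \<infinity>" by (rule ereal_bot)
    then show ?thesis using False by simp
  qed
qed

end

text \<open>The first conjunct is what makes (D) the Lagrangian dual: discarding competitors with
  value -\<infinity> turns the maximization of the dual function over \<open>C2_interior\<close>
  into \<open>dual_value\<close>.\<close>

theorem lemma2:
  fixes M :: "'w measure"
    and F :: "real \<Rightarrow> 'w measure"
    and W :: "real \<Rightarrow> 'w \<Rightarrow> real ^ 'm"
    and b :: "real ^ 'n \<Rightarrow> real ^ 'n"
    and B :: "real ^ 'n \<Rightarrow> real ^ 'm ^ 'n"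
    and \<X> :: "(real ^ 'n) set"
    and g :: "real ^ 'n \<Rightarrow> real"
    and x :: "real ^ 'n"
  assumes "brownian_motion M F W"
    and "open \<X>" "bounded \<X>" "smooth_boundary \<X>"
    and "continuous_on UNIV b" "continuous_on UNIV B"
    and "linear_growth_outside \<X> b" "linear_growth_outside \<X> B"
    and "\<And>y. rank (B y) = CARD('n)"
    and "\<And>y. sde_uniquely_solvable M F W b B y"
    and "continuous_on (frontier \<X>) g"
    and "x \<in> \<X>"
  shows "(\<forall>v\<in>C2_interior \<X>. lagrange_dual_function \<X> b B g x v =
            (if v \<in> dual_feasible \<X> b B g then ereal (v x) else - \<infinity>)) \<and>
         dual_value \<X> b B g x = primal_value \<X> b B g x"
proof -
  interpret elliptic_domain \<X> b B by (unfold_locales) (use assms in auto)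
  show ?thesis using lagrange_dual_function_eq no_duality_gap assms(11,12) by blast
qed

end
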